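(* Let $(W,\mathcal{S})$ be a finite Coxeter system, $c$ a Coxeter element, $m\ge0$, and $w,u\in\mathrm{Sort}^{(m)}(W,c)$. Then (1) $w\le u$ in right weak order if and only if $\mathrm{inv}(w)\subseteq\mathrm{inv}(u)$; and (2) $\mathrm{inv}(w\wedge u)=\mathrm{inv}(w)\cap\mathrm{inv}(u)$.
   Context: $B^+$ is the positive Artin monoid of $(W,\mathcal{S})$ (generated by $\mathcal{S}$ with the braid relations), with right weak order $u\le w$ iff $uv=w$ for some $v\in B^+$, a lattice with meet $\wedge$; $w_\circ$ is the longest element of $W$ and $W^{(m)}=\{w\in B^+:w\le w_\circ^m\}$. $\Phi^+$ is the set of positive roots of a root system for $W$ with simple roots $\alpha_s$. Colored positive roots are $\beta^{(k)}$, $\beta\in\Phi^+$, $k\ge0$; $s\in\mathcal{S}$ acts by $s(\beta^{(k)})=[s(\beta)]^{(k)}$ if $\beta\ne\alpha_s$, $s(\alpha_s^{(k)})=\alpha_s^{(k+1)}$. The colored inversion sequence of a word $s_1\cdots s_p$ has $i$-th entry $s_1(\cdots s_{i-1}(\alpha_{s_i}^{(0)}))$, and $\mathrm{inv}(w)$ for $w\in B^+$ is the set of entries of the colored inversion sequence of a word for $w$. A Coxeter element $c$ is a product of all simple reflections in some order; fix a reduced word $s_1\cdots s_n$. The $c$-sorting word of $w$ is the lexicographically first subword of $(s_1\cdots s_n)^\infty$ which is a reduced word for $w$; $w$ is $c$-sortable if the sets of positions used in successive copies of $s_1\cdots s_n$ form a weakly decreasing sequence. $\mathrm{Sort}^{(m)}(W,c)$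 is the set of $c$-sortable elements of $W^{(m)}$. *)

theory Defs
  imports
    "HOL-Analysis.Analysis"
    "HOL-Algebra.Lattice"
    "HOL-Algebra.Generated_Groups"
    "HOL-Algebra.Multiplicative_Group"
    "HOL-Algebra.Group_Action"
begin

section \<open>Words and monoid presentations\<close>

definition word_step :: "('a list \<times> 'a list) set \<Rightarrow> ('a list \<times> 'a list) set" where
  "word_step R = {(us @ l @ vs, us @ r @ vs) | us l r vs. (l, r) \<in> R}"

text \<open>The congruence on the free monoid of words over \<open>S\<close> generated by the relations \<open>R\<close>.\<close>

definition word_congruence :: "'a set \<Rightarrow> ('a list \<times> 'a list) set \<Rightarrow> ('a list \<times> 'a list) set" where
  "word_congruence S R =
     (word_step R \<union> (word_step R)\<inverse>)\<^sup>* \<inter> (lists S \<times> lists S)"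

definition word_prod :: "('a, 'b) monoid_scheme \<Rightarrow> 'a list \<Rightarrow> 'a" where
  "word_prod G ws = foldr (\<otimes>\<^bsub>G\<^esub>) ws \<one>\<^bsub>G\<^esub>"

section \<open>Coxeter systems\<close>

text \<open>The Coxeter matrix. The library's \<open>group.ord\<close> is \<open>0\<close> on elements of
  infinite order, for which the relations below degenerate to \<open>([], [])\<close>.\<close>

definition cox_mat :: "('a, 'b) monoid_scheme \<Rightarrow> 'a \<Rightarrow> 'a \<Rightarrow> nat" where
  "cox_mat G s t = group.ord G (s \<otimes>\<^bsub>G\<^esub> t)"

definition coxeter_relations ::
    "('a, 'b) monoid_scheme \<Rightarrow> 'a set \<Rightarrow> ('a list \<times> 'a list) set" where
  "coxeter_relations G S =
     {(concat (replicate (cox_mat G s t) [s, t]), []) | s t. s \<in> S \<and> t \<in> S}"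

text \<open>The last two conditions express that \<open>G\<close> has the group presentation with
  generators \<open>S\<close> and relations \<open>(s t)\<^sup>m\<^sup>(\<^sup>s\<^sup>,\<^sup>t\<^sup>) = 1\<close>; words without formal inverses
  suffice because the relations include \<open>s s = 1\<close>.\<close>

definition coxeter_system :: "('a, 'b) monoid_scheme \<Rightarrow> 'a set \<Rightarrow> bool" where
  "coxeter_system G S \<longleftrightarrow>
     group G \<and> S \<subseteq> carrier G \<and>
     (\<forall>s\<in>S. group.ord G s = 2) \<and>
     generate G S = carrier G \<and>
     (\<forall>us\<in>lists S. \<forall>vs\<in>lists S.
        word_prod G us = word_prod G vs \<longleftrightarrow>
        (us, vs) \<in> word_congruence S (coxeter_relations G S))"

definition cox_length :: "('a, 'b) monoid_scheme \<Rightarrow> 'a set \<Rightarrow> 'a \<Rightarrow> nat" where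
  "cox_length G S g = (LEAST n. \<exists>ws\<in>lists S. word_prod G ws = g \<and> length ws = n)"

definition reduced_word :: "('a, 'b) monoid_scheme \<Rightarrow> 'a set \<Rightarrow> 'a \<Rightarrow> 'a list \<Rightarrow> bool" where
  "reduced_word G S g ws \<longleftrightarrow>
     ws \<in> lists S \<and> word_prod G ws = g \<and> length ws = cox_length G S g"

definition longest_element :: "('a, 'b) monoid_scheme \<Rightarrow> 'a set \<Rightarrow> 'a" where
  "longest_element G S =
     (THE w. w \<in> carrier G \<and> (\<forall>g\<in>carrier G. cox_length G S g \<le> cox_length G S w))"

definition coxeter_element :: "('a, 'b) monoid_scheme \<Rightarrow> 'a set \<Rightarrow> 'a \<Rightarrow> bool" where
  "coxeter_element G S c \<longleftrightarrow> (\<exists>ws. distinct ws \<and> set ws = S \<and> word_prod G ws = c)"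

section \<open>The positive Artin monoid\<close>

fun alternating_word :: "'a \<Rightarrow> 'a \<Rightarrow> nat \<Rightarrow> 'a list" where
  "alternating_word s t 0 = []"
| "alternating_word s t (Suc k) = s # alternating_word t s k"

definition braid_relations ::
    "('a, 'b) monoid_scheme \<Rightarrow> 'a set \<Rightarrow> ('a list \<times> 'a list) set" where
  "braid_relations G S =
     {(alternating_word s t (cox_mat G s t), alternating_word t s (cox_mat G s t)) | s t.
        s \<in> S \<and> t \<in> S \<and> s \<noteq> t}"

definition braid_congruence ::
    "('a, 'b) monoid_scheme \<Rightarrow> 'a set \<Rightarrow> ('a list \<times> 'a list) set" where
  "braid_congruence G S = word_congruence S (braid_relations G S)"

text \<open>An element of the monoid is the set of all words representing it; all these words
  have the same length, so each of them is reduced.\<close>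

definition artin_monoid :: "('a, 'b) monoid_scheme \<Rightarrow> 'a set \<Rightarrow> 'a list set monoid" where
  "artin_monoid G S =
     \<lparr>carrier = lists S // braid_congruence G S,
      mult = (\<lambda>A B. braid_congruence G S `` {us @ vs | us vs. us \<in> A \<and> vs \<in> B}),
      one = braid_congruence G S `` {[]}\<rparr>"

definition weak_order :: "('a, 'b) monoid_scheme \<Rightarrow> 'a set \<Rightarrow> 'a list set gorder" where
  "weak_order G S =
     \<lparr>carrier = carrier (artin_monoid G S),
      eq = (=),
      le = (\<lambda>u w. \<exists>v\<in>carrier (artin_monoid G S). u \<otimes>\<^bsub>artin_monoid G S\<^esub> v = w)\<rparr>"

text \<open>The copy of \<open>W\<close> inside the monoid: \<open>g\<close> is lifted along any of its reduced words
  (by Matsumoto's theorem the choice is immaterial).\<close>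

definition artin_lift :: "('a, 'b) monoid_scheme \<Rightarrow> 'a set \<Rightarrow> 'a \<Rightarrow> 'a list set" where
  "artin_lift G S g = braid_congruence G S `` {SOME ws. reduced_word G S g ws}"

definition W_fuss :: "('a, 'b) monoid_scheme \<Rightarrow> 'a set \<Rightarrow> nat \<Rightarrow> 'a list set set" where
  "W_fuss G S m =
     {w \<in> carrier (artin_monoid G S).
        w \<sqsubseteq>\<^bsub>weak_order G S\<^esub>
          artin_lift G S (longest_element G S) [^]\<^bsub>artin_monoid G S\<^esub> m}"

section \<open>Sortable elements\<close>

text \<open>A subword of \<open>cs\<^sup>\<infinity>\<close> is given by its increasing sequence of positions; position \<open>i\<close>
  carries the letter \<open>cs ! (i mod length cs)\<close>.\<close>

definition subword_positions :: "'a list \<Rightarrow> 'a list set \<Rightarrow> nat list set" where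
  "subword_positions cs w =
     {is. sorted_wrt (<) is \<and> map (\<lambda>i. cs ! (i mod length cs)) is \<in> w}"

definition sorting_positions :: "'a list \<Rightarrow> 'a list set \<Rightarrow> nat list" where
  "sorting_positions cs w =
     (THE is. is \<in> subword_positions cs w \<and>
        (\<forall>js\<in>subword_positions cs w. js = is \<or> (is, js) \<in> lexord {(i, j). i < j}))"

definition sorting_block :: "'a list \<Rightarrow> 'a list set \<Rightarrow> nat \<Rightarrow> nat set" where
  "sorting_block cs w k =
     {i. i < length cs \<and> k * length cs + i \<in> set (sorting_positions cs w)}"

definition c_sortable :: "'a list \<Rightarrow> 'a list set \<Rightarrow> bool" where
  "c_sortable cs w \<longleftrightarrow> (\<forall>k. sorting_block cs w (Suc k) \<subseteq> sorting_block cs w k)"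

definition Sort_fuss ::
    "('a, 'b) monoid_scheme \<Rightarrow> 'a set \<Rightarrow> nat \<Rightarrow> 'a list \<Rightarrow> 'a list set set" where
  "Sort_fuss G S m cs = {w \<in> W_fuss G S m. c_sortable cs w}"

section \<open>Root systems and colored inversions\<close>

definition root_reflection :: "'v::euclidean_space \<Rightarrow> 'v \<Rightarrow> 'v" where
  "root_reflection b x = x - (2 * (x \<bullet> b) / (b \<bullet> b)) *\<^sub>R b"

definition positive_roots :: "'a set \<Rightarrow> 'v::euclidean_space set \<Rightarrow> ('a \<Rightarrow> 'v) \<Rightarrow> 'v set" where
  "positive_roots S \<Phi> \<alpha> =
     {\<beta> \<in> \<Phi>. \<exists>a::'a \<Rightarrow> real. (\<forall>s\<in>S. 0 \<le> a s) \<and> \<beta> = (\<Sum>s\<in>S. a s *\<^sub>R \<alpha> s)}"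

text \<open>\<open>\<Phi>\<close> is a (reduced, not necessarily crystallographic or spanning) root system for the
  finite Coxeter system \<open>(G, S)\<close> with simple roots \<open>\<alpha> s\<close>. The last clause identifies \<open>G\<close>
  with a group of transformations in which \<open>s\<close> is the reflection in \<open>\<alpha> s\<close>.\<close>

definition root_system_for ::
    "('a, 'b) monoid_scheme \<Rightarrow> 'a set \<Rightarrow> 'v::euclidean_space set \<Rightarrow> ('a \<Rightarrow> 'v) \<Rightarrow> bool" where
  "root_system_for G S \<Phi> \<alpha> \<longleftrightarrow>
     finite \<Phi> \<and> 0 \<notin> \<Phi> \<and>
     (\<forall>\<beta>\<in>\<Phi>. root_reflection \<beta> ` \<Phi> = \<Phi>) \<and>
     (\<forall>\<beta>\<in>\<Phi>. \<Phi> \<inter> span {\<beta>} = {\<beta>, - \<beta>}) \<and>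
     inj_on \<alpha> S \<and> \<alpha> ` S \<subseteq> \<Phi> \<and> independent (\<alpha> ` S) \<and>
     \<Phi> = positive_roots S \<Phi> \<alpha> \<union> uminus ` positive_roots S \<Phi> \<alpha> \<and>
     (\<exists>\<rho>. faithful_action G (UNIV :: 'v set) \<rho> \<and> (\<forall>s\<in>S. \<rho> s = root_reflection (\<alpha> s)))"

text \<open>The colored root \<open>\<beta>\<^sup>(\<^sup>k\<^sup>)\<close> is the pair \<open>(\<beta>, k)\<close>.\<close>

definition colored_act ::
    "('a \<Rightarrow> 'v::euclidean_space) \<Rightarrow> 'a \<Rightarrow> 'v \<times> nat \<Rightarrow> 'v \<times> nat" where
  "colored_act \<alpha> s = (\<lambda>(\<beta>, k).
     if \<beta> = \<alpha> s then (\<alpha> s, Suc k) else (root_reflection (\<alpha> s) \<beta>, k))"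

definition colored_inversion_sequence ::
    "('a \<Rightarrow> 'v::euclidean_space) \<Rightarrow> 'a list \<Rightarrow> ('v \<times> nat) list" where
  "colored_inversion_sequence \<alpha> ws =
     map (\<lambda>i. foldr (colored_act \<alpha>) (take i ws) (\<alpha> (ws ! i), 0)) [0..<length ws]"

text \<open>The braid relations only permute the entries of the sequence, so the choice of the
  word is immaterial.\<close>

definition colored_inv ::
    "('a \<Rightarrow> 'v::euclidean_space) \<Rightarrow> 'a list set \<Rightarrow> ('v \<times> nat) set" where
  "colored_inv \<alpha> w = set (colored_inversion_sequence \<alpha> (SOME ws. ws \<in> w))"

end

theory Submission
  imports Defs
begin

text \<open>Colored inversion sets are encoded by functions \<open>N\<close> counting the colors of each positive root.
  Both claims follow by recursion on an initial letter \<open>s\<close> of \<open>c\<close>: if \<open>s\<close> is a prefix of both \<open>w\<close> and \<open>u\<close>,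
  strip it and pass to \<open>s c s\<close>; if of neither, both lie in the parabolic submonoid without \<open>s\<close>. If \<open>s\<close>
  is a prefix of \<open>u\<close> only, replace \<open>u\<close> by its largest prefix \<open>u\<^sub>J\<close> without the letter \<open>s\<close>. This works because
  \<open>u\<^sub>J\<close> is again sortable and has all inversions of \<open>u\<close> in the parabolic subsystem. The inversions are right
  because the Garside factors of a sortable \<open>u\<close> are nested, each letter occurring after a factor being a
  descent of it. Sortability of \<open>u\<^sub>J\<close> follows letter by letter from an alignment property of \<open>N u\<close> on
  rank-two subsystems that is inherited by parabolic subsystems. Cancellation and greatest common
  prefixes in the positive Artin monoid come from Garside's argument, where the longest element of the
  Coxeter group replaces the usual case analysis in rank three.\<close>

text \<open>In the whole monoid, inclusion of colored inversion sets does not imply the weak order.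
  In type A2 the word \<open>[s, s, t]\<close> has the counts 2, 1, 0 at \<open>\<alpha> s\<close>,
  \<open>\<alpha> t\<close> and the third positive root, yet it is alone in its braid class, so
  \<open>t\<close>, with its single inversion at \<open>\<alpha> t\<close>, is not a prefix.
  Sortability has to exclude this: an inversion in a parabolic subsystem must be reachable by
  letters of that subsystem. The colors at each root fill an initial segment, so inclusion and
  intersection become order and minimum of counts, and a common prefix that realizes the minimum is
  forced to be the meet. A word without \<open>s\<close> has no inversion involving
  \<open>\<alpha> s\<close>, so only inversions of \<open>u\<close> in the smaller subsystem can
  enter the minimum. The geometric input is a play of signs: the Euler form of \<open>c\<close>
  paired with an initial or final simple root returns a positive multiple of the coefficient at that
  root, and coefficients of positive roots are nonnegative.\<close>

lemma root_reflection_linear: "linear (root_reflection b)"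
  unfolding root_reflection_def
  by (rule linearI) (auto simp: algebra_simps inner_add_left add_divide_distrib)

lemma root_reflection_self: "root_reflection b b = - b"
  by (cases "b = 0") (auto simp: root_reflection_def algebra_simps scaleR_2)

lemma root_reflection_involution [simp]: "root_reflection b (root_reflection b x) = x"
  by (cases "b = 0") (auto simp: root_reflection_def algebra_simps inner_diff_left)

lemma root_reflection_inner: "root_reflection b x \<bullet> root_reflection b y = x \<bullet> y"
  by (cases "b = 0") (auto simp: root_reflection_def algebra_simps inner_diff_left inner_diff_right inner_commute)

fun root_act :: "('a \<Rightarrow> 'v::euclidean_space) \<Rightarrow> 'a list \<Rightarrow> 'v \<Rightarrow> 'v" where
  "root_act \<alpha> [] x = x"
| "root_act \<alpha> (s # v) x = root_reflection (\<alpha> s) (root_act \<alpha> v x)"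

text \<open>\<open>co r\<close> extracts the coefficient of \<open>\<alpha> r\<close>; \<open>P\<close> is the set of positive roots.\<close>

locale positive_roots_datum =
  fixes S :: "'a set" and \<alpha> :: "'a \<Rightarrow> 'v::euclidean_space" and P :: "'v set"
    and co :: "'a \<Rightarrow> 'v \<Rightarrow> real" and m :: "'a \<Rightarrow> 'a \<Rightarrow> nat"
  assumes finS: "finite S" and finP: "finite P"
    and co_lin: "r \<in> S \<Longrightarrow> linear (co r)"
    and co_\<alpha>: "r \<in> S \<Longrightarrow> s \<in> S \<Longrightarrow> co r (\<alpha> s) = (if r = s then 1 else 0)"
    and P_exp: "\<beta> \<in> P \<Longrightarrow> \<beta> = (\<Sum>r\<in>S. co r \<beta> *\<^sub>R \<alpha> r)"
    and P_nn: "\<beta> \<in> P \<Longrightarrow> r \<in> S \<Longrightarrow> 0 \<le> co r \<beta>"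
    and zero_notin_P: "0 \<notin> P"
    and \<alpha>_P: "s \<in> S \<Longrightarrow> \<alpha> s \<in> P"
    and refl_P: "s \<in> S \<Longrightarrow> \<beta> \<in> P \<Longrightarrow> \<beta> \<noteq> \<alpha> s \<Longrightarrow> root_reflection (\<alpha> s) \<beta> \<in> P"
    and m_sym: "s \<in> S \<Longrightarrow> t \<in> S \<Longrightarrow> s \<noteq> t \<Longrightarrow> m s t = m t s"
    and m_ge2: "s \<in> S \<Longrightarrow> t \<in> S \<Longrightarrow> s \<noteq> t \<Longrightarrow> 2 \<le> m s t"
    and m_dvd: "s \<in> S \<Longrightarrow> t \<in> S \<Longrightarrow> s \<noteq> t \<Longrightarrow>
      root_act \<alpha> (alternating_word s t k) = root_act \<alpha> (alternating_word t s k) \<longleftrightarrow> m s t dvd k"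
begin

abbreviation sr :: "'a \<Rightarrow> 'v \<Rightarrow> 'v" where "sr s \<equiv> root_reflection (\<alpha> s)"
abbreviation act :: "'a list \<Rightarrow> 'v \<Rightarrow> 'v" where "act \<equiv> root_act \<alpha>"
abbreviation alt :: "'a \<Rightarrow> 'a \<Rightarrow> nat \<Rightarrow> 'a list" where "alt \<equiv> alternating_word"

lemmas sr_lin = root_reflection_linear[of "\<alpha> _"]
lemmas sr_self = root_reflection_self[of "\<alpha> _"]

lemma sr_add: "sr s (x + y) = sr s x + sr s y" and sr_scale: "sr s (c *\<^sub>R x) = c *\<^sub>R sr s x"
  and sr_neg: "sr s (- x) = - sr s x" and sr_diff: "sr s (x - y) = sr s x - sr s y"
  using sr_lin by (auto simp: linear_add linear_scale linear_neg linear_diff)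

lemma act_append: "act (u @ v) x = act u (act v x)"
  by (induction u) auto

lemma act_lin: "linear (act u)"
proof (induction u)
  case (Cons s u)
  have eq: "act (s # u) = sr s \<circ> act u" by auto
  show ?case unfolding eq by (rule linear_compose[OF Cons sr_lin])
qed (simp add: linear_iff)

lemma act_scale: "act u (c *\<^sub>R x) = c *\<^sub>R act u x"
  and act_neg: "act u (- x) = - act u x" and act_diff: "act u (x - y) = act u x - act u y"
  using act_lin[of u] by (auto simp: linear_scale linear_neg linear_diff)

lemma act_sum: "act u (\<Sum>i\<in>I. f i) = (\<Sum>i\<in>I. act u (f i))"
  using linear_sum[OF act_lin] .

lemma act_inner: "act u x \<bullet> act u y = x \<bullet> y"
  by (induction u) (auto simp: root_reflection_inner)

lemma act_rev [simp]: "act (rev u) (act u x) = x" "act u (act (rev u) x) = x"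
  by (induction u arbitrary: x) (auto simp: act_append)

lemma act_rev_cong: "act u = act v \<Longrightarrow> act (rev u) = act (rev v)"
  by (metis act_rev ext)

lemma co_add: "r \<in> S \<Longrightarrow> co r (x + y) = co r x + co r y"
  and co_scale: "r \<in> S \<Longrightarrow> co r (c *\<^sub>R x) = c * co r x"
  and co_neg: "r \<in> S \<Longrightarrow> co r (- x) = - co r x"
  and co_diff: "r \<in> S \<Longrightarrow> co r (x - y) = co r x - co r y"
  and co_zero: "r \<in> S \<Longrightarrow> co r 0 = 0"
  and co_sum: "r \<in> S \<Longrightarrow> co r (\<Sum>i\<in>I. f i) = (\<Sum>i\<in>I. co r (f i))"
  using co_lin[of r] by (auto simp: linear_add linear_scale linear_neg linear_diff linear_0 linear_sum)

section \<open>Coefficients and signs of roots\<close>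

definition cf :: "'a \<Rightarrow> 'v \<Rightarrow> real" where "cf s x = 2 * (x \<bullet> \<alpha> s) / (\<alpha> s \<bullet> \<alpha> s)"

lemma sr_eq: "sr s x = x - cf s x *\<^sub>R \<alpha> s"
  by (simp add: root_reflection_def cf_def)

lemma \<alpha>_nz: "s \<in> S \<Longrightarrow> \<alpha> s \<noteq> 0"
  using \<alpha>_P zero_notin_P by metis

lemma \<alpha>_norm: "s \<in> S \<Longrightarrow> \<alpha> s \<bullet> \<alpha> s > 0"
  using \<alpha>_nz by simp

lemma cf_inner: "s \<in> S \<Longrightarrow> cf s x * (\<alpha> s \<bullet> \<alpha> s) = 2 * (x \<bullet> \<alpha> s)"
  using \<alpha>_norm[of s] by (simp add: cf_def)

lemma co_sr: "r \<in> S \<Longrightarrow> s \<in> S \<Longrightarrow> co r (sr s x) = co r x - (if r = s then cf s x else 0)"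
  by (simp add: sr_eq co_diff co_scale co_\<alpha>)

lemma \<alpha>_inj: "s \<in> S \<Longrightarrow> t \<in> S \<Longrightarrow> \<alpha> s = \<alpha> t \<longleftrightarrow> s = t"
  using co_\<alpha>[of s s] co_\<alpha>[of s t] by (auto split: if_splits)

lemma P_neg: "\<beta> \<in> P \<Longrightarrow> - \<beta> \<notin> P"
proof
  assume b: "\<beta> \<in> P" "- \<beta> \<in> P"
  have "co r \<beta> = 0" if "r \<in> S" for r
    using P_nn[OF b(1) that] P_nn[OF b(2) that] co_neg[OF that, of \<beta>] by simp
  then have "\<beta> = 0" using P_exp[OF b(1)] by simp
  then show False using b zero_notin_P by simp
qed

lemma P_zero_iff: "\<beta> \<in> P \<Longrightarrow> \<exists>r\<in>S. co r \<beta> > 0"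
proof (rule ccontr)
  assume b: "\<beta> \<in> P" "\<not> (\<exists>r\<in>S. co r \<beta> > 0)"
  then have "co r \<beta> = 0" if "r \<in> S" for r
    using P_nn[OF b(1) that] that by force
  then have "\<beta> = 0" using P_exp[OF b(1)] by simp
  then show False using b zero_notin_P by simp
qed

text \<open>\<open>sr s\<close> negates every multiple of \<open>\<alpha> s\<close>, yet it keeps
  all positive roots other than \<open>\<alpha> s\<close> positive.\<close>

lemma P_simple: "\<beta> \<in> P \<Longrightarrow> s \<in> S \<Longrightarrow> (\<And>r. r \<in> S \<Longrightarrow> r \<noteq> s \<Longrightarrow> co r \<beta> = 0) \<Longrightarrow> \<beta> = \<alpha> s"
proof (rule ccontr)
  assume b: "\<beta> \<in> P" "s \<in> S" "\<And>r. r \<in> S \<Longrightarrow> r \<noteq> s \<Longrightarrow> co r \<beta> = 0" "\<beta> \<noteq> \<alpha> s"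
  have "\<beta> = (\<Sum>r\<in>S. co r \<beta> *\<^sub>R \<alpha> r)" using P_exp b by simp
  also have "\<dots> = (\<Sum>r\<in>S. if r = s then co s \<beta> *\<^sub>R \<alpha> s else 0)"
    by (rule sum.cong) (use b in auto)
  also have "\<dots> = co s \<beta> *\<^sub>R \<alpha> s" using finS b by simp
  finally have "sr s \<beta> = - \<beta>" using sr_scale[of s "co s \<beta>" "\<alpha> s"] sr_self[of s] by (metis scaleR_minus_right)
  then show False using refl_P b P_neg by metis
qed

text \<open>The coefficient at \<open>s\<close> of the positive root
  \<open>sr s (\<alpha> t)\<close> is \<open>- cf s (\<alpha> t)\<close>.\<close>

lemma \<alpha>_inner_le: assumes "s \<in> S" "t \<in> S" "s \<noteq> t" shows "\<alpha> s \<bullet> \<alpha> t \<le> 0"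
proof -
  have "sr s (\<alpha> t) \<in> P" using assms \<alpha>_P refl_P \<alpha>_inj by metis
  then have "co s (sr s (\<alpha> t)) \<ge> 0" using P_nn assms by simp
  then have "cf s (\<alpha> t) \<le> 0" using co_sr[of s s] co_\<alpha> assms by simp
  then have "cf s (\<alpha> t) * (\<alpha> s \<bullet> \<alpha> s) \<le> 0" by (intro mult_nonpos_nonneg) auto
  then show ?thesis using cf_inner[of s "\<alpha> t"] assms by (simp add: inner_commute)
qed

text \<open>The colored action of \<open>s\<close> with the colors forgotten:
  \<open>\<alpha> s\<close> is fixed because there only the color moves, which makes
  \<open>\<tau> s\<close> a permutation of \<open>P\<close>.\<close>

definition \<tau> :: "'a \<Rightarrow> 'v \<Rightarrow> 'v" where "\<tau> s \<beta> = (if \<beta> = \<alpha> s then \<beta> else sr s \<beta>)"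

lemma \<tau>_P: "s \<in> S \<Longrightarrow> \<beta> \<in> P \<Longrightarrow> \<tau> s \<beta> \<in> P"
  by (auto simp: \<tau>_def refl_P)

lemma \<tau>_inv: "s \<in> S \<Longrightarrow> \<beta> \<in> P \<Longrightarrow> \<tau> s (\<tau> s \<beta>) = \<beta>"
proof (cases "\<beta> = \<alpha> s")
  case False
  assume a: "s \<in> S" "\<beta> \<in> P"
  have "sr s \<beta> \<noteq> \<alpha> s"
  proof
    assume "sr s \<beta> = \<alpha> s"
    then have "\<beta> = - \<alpha> s" by (metis root_reflection_involution sr_self)
    then show False using a P_neg \<alpha>_P by metis
  qed
  then show ?thesis using False by (simp add: \<tau>_def)
qed (simp add: \<tau>_def)

text \<open>The colored root \<open>(\<beta>, k)\<close> is an inversion of \<open>u\<close> iff \<open>k < N u \<beta>\<close>.\<close>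

fun N :: "'a list \<Rightarrow> 'v \<Rightarrow> nat" where
  "N [] \<beta> = 0"
| "N (s # v) \<beta> = (if \<beta> = \<alpha> s then 1 else 0) + N v (\<tau> s \<beta>)"

lemma fold_\<tau>_P: "set u \<subseteq> S \<Longrightarrow> \<beta> \<in> P \<Longrightarrow> fold \<tau> u \<beta> \<in> P"
  by (induction u arbitrary: \<beta>) (auto simp: \<tau>_P)

lemma N_append: "N (u @ v) \<beta> = N u \<beta> + N v (fold \<tau> u \<beta>)"
  by (induction u arbitrary: \<beta>) auto

text \<open>\<open>\<tau>\<close> departs from the reflection only at the simple root of the letter
  being read, where it omits the sign; this is exactly where \<open>N\<close> grows by one.\<close>

lemma act_rev_fold: "act (rev u) \<beta> = (if even (N u \<beta>) then fold \<tau> u \<beta> else - fold \<tau> u \<beta>)"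
proof (induction u arbitrary: \<beta>)
  case (Cons s u)
  show ?case
  proof (cases "\<beta> = \<alpha> s")
    case True
    then have "act (rev (s # u)) \<beta> = act (rev u) (- \<beta>)" by (simp add: act_append sr_self)
    moreover have "\<tau> s \<beta> = \<beta>" using True by (simp add: \<tau>_def)
    ultimately show ?thesis using Cons[of \<beta>] True by (simp add: act_neg)
  next
    case False
    then have "\<tau> s \<beta> = sr s \<beta>" by (simp add: \<tau>_def)
    then show ?thesis using Cons[of "sr s \<beta>"] False by (simp add: act_append)
  qed
qed simp

lemma fold_rev_\<tau>: "set u \<subseteq> S \<Longrightarrow> \<beta> \<in> P \<Longrightarrow> fold \<tau> (rev u) (fold \<tau> u \<beta>) = \<beta>"
  by (induction u arbitrary: \<beta>) (auto simp: \<tau>_P \<tau>_inv)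

lemma fold_\<tau>_bij: "set u \<subseteq> S \<Longrightarrow> bij_betw (fold \<tau> u) P P"
  by (rule bij_betwI[where g = "fold \<tau> (rev u)"])
     (auto simp: fold_\<tau>_P fold_rev_\<tau> fold_rev_\<tau>[of "rev u", simplified])

lemma act_P: assumes "set u \<subseteq> S" "\<beta> \<in> P" shows "act u \<beta> \<in> P \<or> - act u \<beta> \<in> P"
  using act_rev_fold[of "rev u" \<beta>] fold_\<tau>_P[of "rev u" \<beta>] assms by (auto split: if_splits)

lemma parity: assumes "set u \<subseteq> S" "\<beta> \<in> P"
  shows "even (N u \<beta>) \<longleftrightarrow> act (rev u) \<beta> \<in> P"
  using act_rev_fold[of u \<beta>] fold_\<tau>_P[OF assms] P_neg by (auto split: if_splits)

lemma fold_\<tau>_act: assumes "set u \<subseteq> S" "\<beta> \<in> P"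
  shows "fold \<tau> u \<beta> = (if act (rev u) \<beta> \<in> P then act (rev u) \<beta> else - act (rev u) \<beta>)"
  using act_rev_fold[of u \<beta>] parity[OF assms] by auto

lemma fold_\<tau>_cong: assumes "set u \<subseteq> S" "set v \<subseteq> S" "\<beta> \<in> P" "act u = act v"
  shows "fold \<tau> u \<beta> = fold \<tau> v \<beta>"
  using fold_\<tau>_act assms act_rev_cong[OF assms(4)] by simp

text \<open>Each letter adds one inversion in total, since \<open>\<tau> s\<close> permutes
  \<open>P\<close>.\<close>

lemma sum_N: "set u \<subseteq> S \<Longrightarrow> (\<Sum>\<beta>\<in>P. N u \<beta>) = length u"
proof (induction u)
  case (Cons s u)
  have "(\<Sum>\<beta>\<in>P. N u (\<tau> s \<beta>)) = (\<Sum>\<beta>\<in>P. N u \<beta>)"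
    using sum.reindex_bij_betw[OF fold_\<tau>_bij[of "[s]"], of "N u"] Cons by simp
  then show ?case using Cons \<alpha>_P finP by (simp add: sum.distrib)
qed simp

section \<open>Reduced words of the Coxeter group and the exchange condition\<close>

definition red :: "'a list \<Rightarrow> bool" where "red u \<longleftrightarrow> (\<forall>\<beta>\<in>P. N u \<beta> \<le> 1)"

text \<open>By \<open>parity\<close> the transformation determines \<open>N\<close> modulo 2 at each
  root. A red word realizes these parities with the least values 0 and 1, so by \<open>sum_N\<close>
  it is shortest for its group element.\<close>

lemma red_length: assumes "set u \<subseteq> S" "set v \<subseteq> S" "act u = act v" "red u"
  shows "length u \<le> length v" and "red v \<longleftrightarrow> length v = length u"
    and "red v \<Longrightarrow> \<beta> \<in> P \<Longrightarrow> N u \<beta> = N v \<beta>"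
proof -
  have e: "even (N u \<beta>) \<longleftrightarrow> even (N v \<beta>)" if "\<beta> \<in> P" for \<beta>
    using parity[OF assms(1) that] parity[OF assms(2) that] act_rev_cong[OF assms(3)] by simp
  have le: "N u \<beta> \<le> N v \<beta>" if "\<beta> \<in> P" for \<beta>
  proof -
    have "N u \<beta> \<le> 1" using assms(4) that unfolding red_def by blast
    moreover have "N u \<beta> = 1 \<longrightarrow> N v \<beta> \<noteq> 0" using e[OF that] by (auto intro: odd_pos)
    ultimately show ?thesis by linarith
  qed
  note su = sum_N[OF assms(1)] and sv = sum_N[OF assms(2)]
  have "sum (N u) P \<le> sum (N v) P" by (rule sum_mono) (rule le)
  then show "length u \<le> length v" unfolding su sv .
  have eq: "N u \<beta> = N v \<beta>" if "\<beta> \<in> P" "red v" for \<beta>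
  proof -
    have "N v \<beta> \<le> 1" using that unfolding red_def by blast
    moreover have "N u \<beta> = 0 \<longrightarrow> N v \<beta> \<noteq> 1" using e[OF that(1)] by (metis even_zero odd_one)
    ultimately show ?thesis using le[OF that(1)] by linarith
  qed
  then show "red v \<Longrightarrow> \<beta> \<in> P \<Longrightarrow> N u \<beta> = N v \<beta>" by blast
  show "red v \<longleftrightarrow> length v = length u"
  proof
    assume "red v"
    then have "sum (N u) P = sum (N v) P" using eq by (intro sum.cong) auto
    then show "length v = length u" unfolding su sv by simp
  next
    assume l: "length v = length u"
    have "N v \<beta> = N u \<beta>" if "\<beta> \<in> P" for \<beta>
    proof (rule ccontr)
      assume "N v \<beta> \<noteq> N u \<beta>"
      then have "N u \<beta> < N v \<beta>" using le[OF that] by simp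
      then have "\<exists>a\<in>P. N u a < N v a" using that by blast
      moreover have "\<forall>a\<in>P. N u a \<le> N v a" using le by blast
      ultimately have "sum (N u) P < sum (N v) P"
        using finP by (intro sum_strict_mono_ex1)
      then show False unfolding su sv using l by simp
    qed
    then show "red v" using assms(4) by (simp add: red_def)
  qed
qed

lemma red_Nil [simp]: "red []" by (simp add: red_def)

lemma red_append: assumes "set u \<subseteq> S" "red (u @ v)" shows "red u" "red v"
proof -
  have le: "N u \<beta> + N v (fold \<tau> u \<beta>) \<le> 1" if "\<beta> \<in> P" for \<beta>
    using assms(2) that unfolding red_def N_append by blast
  show "red u" unfolding red_def
  proof
    fix \<beta> assume "\<beta> \<in> P"
    from le[OF this] show "N u \<beta> \<le> 1" by linarith
  qed
  show "red v" unfolding red_def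
  proof
    fix \<beta> assume "\<beta> \<in> P"
    then have "\<beta> \<in> fold \<tau> u ` P" using fold_\<tau>_bij[OF assms(1)] unfolding bij_betw_def by simp
    then obtain \<gamma> where g: "\<gamma> \<in> P" "\<beta> = fold \<tau> u \<gamma>" by (elim imageE)
    show "N v \<beta> \<le> 1" using le[OF g(1)] unfolding g(2) by linarith
  qed
qed

lemma red_Cons: assumes "s \<in> S" shows "red (s # v) \<longleftrightarrow> red v \<and> N v (\<alpha> s) = 0"
proof
  assume r: "red (s # v)"
  then have "red v" using red_append[of "[s]" v] assms by simp
  moreover have "N (s # v) (\<alpha> s) \<le> 1" using r \<alpha>_P assms unfolding red_def by blast
  ultimately show "red v \<and> N v (\<alpha> s) = 0" by (simp add: \<tau>_def)
next
  assume r: "red v \<and> N v (\<alpha> s) = 0"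
  show "red (s # v)" unfolding red_def
  proof
    fix \<beta> assume "\<beta> \<in> P"
    then show "N (s # v) \<beta> \<le> 1" using r \<tau>_P assms by (auto simp: red_def \<tau>_def refl_P)
  qed
qed

text \<open>Cuts the word at the first letter that inverts \<open>\<beta>\<close>.\<close>

lemma N_pos_split: "N u \<beta> > 0 \<Longrightarrow>
    \<exists>u1 r u2. u = u1 @ r # u2 \<and> N u1 \<beta> = 0 \<and> fold \<tau> u1 \<beta> = \<alpha> r"
proof (induction u arbitrary: \<beta>)
  case (Cons s u)
  show ?case
  proof (cases "\<beta> = \<alpha> s")
    case True
    then show ?thesis by (intro exI[of _ "[]"]) auto
  next
    case False
    then obtain u1 r u2 where "u = u1 @ r # u2 \<and> N u1 (\<tau> s \<beta>) = 0 \<and> fold \<tau> u1 (\<tau> s \<beta>) = \<alpha> r"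
      using Cons by force
    then show ?thesis using False by (intro exI[of _ "s # u1"]) auto
  qed
qed simp

lemma sr_conj: "act u (\<alpha> r) = \<alpha> s \<Longrightarrow> act (u @ [r]) = act (s # u)"
proof
  fix x assume a: "act u (\<alpha> r) = \<alpha> s"
  have "act (u @ [r]) x = act u x - cf r x *\<^sub>R \<alpha> s"
    using a by (simp add: act_append sr_eq act_diff act_scale)
  moreover have "cf s (act u x) = cf r x" unfolding cf_def a[symmetric] by (simp add: act_inner)
  ultimately show "act (u @ [r]) x = act (s # u) x" by (simp add: sr_eq)
qed

lemma N_zero_act: assumes "set u \<subseteq> S" "\<beta> \<in> P" "N u \<beta> = 0" shows "act u (fold \<tau> u \<beta>) = \<beta>"
  using act_rev_fold[of u \<beta>] assms by (metis act_rev(2) even_zero)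

lemma N_split_simple: assumes "set u \<subseteq> S" "s \<in> S" "N u (\<alpha> s) > 0"
  obtains u1 r u2 where "u = u1 @ r # u2" "N u1 (\<alpha> s) = 0" "act u1 (\<alpha> r) = \<alpha> s"
    "act (u1 @ [r]) = act (s # u1)"
proof -
  obtain u1 r u2 where u: "u = u1 @ r # u2" "N u1 (\<alpha> s) = 0" "fold \<tau> u1 (\<alpha> s) = \<alpha> r"
    using N_pos_split assms by blast
  then have "act u1 (\<alpha> r) = \<alpha> s" using N_zero_act[of u1 "\<alpha> s"] \<alpha>_P assms by auto
  then show ?thesis using that u sr_conj by blast
qed

lemma alt_set: "set (alt s t k) \<subseteq> {s, t}"
  by (induction s t k rule: alternating_word.induct) auto

lemma alt_length [simp]: "length (alt s t k) = k"
  by (induction s t k rule: alternating_word.induct) auto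

lemma alt_prefix: "alt s t k = u @ v \<Longrightarrow> u = alt s t (length u)"
proof (induction s t k arbitrary: u rule: alternating_word.induct)
  case (2 s t k)
  then show ?case by (cases u) auto
qed simp

text \<open>A root inverted twice would make the two alternating words of some positive length below
  \<open>m s t\<close> act alike, against \<open>m_dvd\<close>.\<close>

lemma red_alt: assumes "s \<in> S" "t \<in> S" "s \<noteq> t" "k \<le> m s t" shows "red (alt s t k)"
  using assms
proof (induction k arbitrary: s t)
  case (Suc k)
  have r: "red (alt t s k)" using Suc m_sym by (metis Suc_leD)
  have sub: "set (alt t s k) \<subseteq> S" using alt_set[of t s k] Suc by auto
  have "N (alt t s k) (\<alpha> s) = 0"
  proof (rule ccontr)
    assume "N (alt t s k) (\<alpha> s) \<noteq> 0"
    then obtain u1 r u2 where u: "alt t s k = u1 @ r # u2" "act (u1 @ [r]) = act (s # u1)"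
      using N_split_simple[OF sub Suc.prems(1)] by (metis gr0I)
    have 1: "u1 @ [r] = alt t s (Suc (length u1))" using alt_prefix[of t s k "u1 @ [r]" u2] u by simp
    have 2: "u1 = alt t s (length u1)" using alt_prefix[of t s k u1] u by simp
    have "act (alt s t (Suc (length u1))) = act (alt t s (Suc (length u1)))"
      using 1 2 u(2) by (metis alternating_word.simps(2))
    then have "m s t dvd Suc (length u1)" using m_dvd Suc.prems by blast
    moreover have "length u1 < k" using arg_cong[OF u(1), of length] by simp
    ultimately show False using Suc.prems dvd_imp_le[of "m s t" "Suc (length u1)"] by linarith
  qed
  then show ?case using red_Cons r Suc.prems by simp
qed simp

lemma act_alt_m: "s \<in> S \<Longrightarrow> t \<in> S \<Longrightarrow> s \<noteq> t \<Longrightarrow> act (alt s t (m s t)) = act (alt t s (m s t))"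
  using m_dvd by simp

lemma alt_m_split: assumes "s \<in> S" "t \<in> S" "s \<noteq> t"
  shows "alt s t (m s t) = s # alt t s (m s t - 1)"
  using m_ge2[OF assms] by (cases "m s t") auto

lemma set_alt_m: assumes "s \<in> S" "t \<in> S" "s \<noteq> t" shows "set (alt s t (m s t)) = {s, t}"
proof -
  obtain k where "m s t = Suc (Suc k)" using m_ge2[OF assms] by (metis add_2_eq_Suc le_Suc_ex)
  then show ?thesis using alt_set by force
qed

subsection \<open>Braid equivalence\<close>

definition brel :: "('a list \<times> 'a list) set" where
  "brel = {(alt s t (m s t), alt t s (m s t)) | s t. s \<in> S \<and> t \<in> S \<and> s \<noteq> t}"

definition beq :: "'a list \<Rightarrow> 'a list \<Rightarrow> bool" (infix "\<approx>\<^sub>b" 50) where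
  "u \<approx>\<^sub>b v \<longleftrightarrow> (u, v) \<in> (word_step brel \<union> (word_step brel)\<inverse>)\<^sup>*"

lemma brel_sym: "(l, r) \<in> brel \<Longrightarrow> (r, l) \<in> brel"
  unfolding brel_def using m_sym by fastforce

lemma word_step_sym: "(word_step brel)\<inverse> = word_step brel"
  unfolding word_step_def using brel_sym by blast

lemma beq_alt: "u \<approx>\<^sub>b v \<longleftrightarrow> (u, v) \<in> (word_step brel)\<^sup>*"
  by (simp add: beq_def word_step_sym)

lemma beq_refl [simp]: "u \<approx>\<^sub>b u" by (simp add: beq_alt)

lemma beq_trans [trans]: "u \<approx>\<^sub>b v \<Longrightarrow> v \<approx>\<^sub>b w \<Longrightarrow> u \<approx>\<^sub>b w" by (simp add: beq_alt)

lemma beq_sym: "u \<approx>\<^sub>b v \<Longrightarrow> v \<approx>\<^sub>b u"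
  unfolding beq_alt using word_step_sym by (metis rtrancl_converseI)

lemma word_step_ctx: "(u, v) \<in> word_step R \<Longrightarrow> (a @ u @ b, a @ v @ b) \<in> word_step R"
proof -
  assume "(u, v) \<in> word_step R"
  then obtain us l r vs where *: "u = us @ l @ vs" "v = us @ r @ vs" "(l, r) \<in> R"
    unfolding word_step_def by blast
  then have "a @ u @ b = (a @ us) @ l @ (vs @ b)" "a @ v @ b = (a @ us) @ r @ (vs @ b)" by simp_all
  then show ?thesis using *(3) unfolding word_step_def by blast
qed

lemma beq_ctx: "u \<approx>\<^sub>b v \<Longrightarrow> a @ u @ b \<approx>\<^sub>b a @ v @ b"
  unfolding beq_alt
proof (induction rule: rtrancl_induct)
  case (step y z)
  then show ?case using word_step_ctx by (meson rtrancl.rtrancl_into_rtrancl)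
qed simp

lemma beq_append: "u \<approx>\<^sub>b u' \<Longrightarrow> v \<approx>\<^sub>b v' \<Longrightarrow> u @ v \<approx>\<^sub>b u' @ v'"
  using beq_ctx[of u u' "[]" v] beq_ctx[of v v' u' "[]"] beq_trans by simp

lemma beq_Cons: "u \<approx>\<^sub>b v \<Longrightarrow> s # u \<approx>\<^sub>b s # v"
  using beq_append[of "[s]" "[s]"] by simp

lemma beq_braid: "s \<in> S \<Longrightarrow> t \<in> S \<Longrightarrow> s \<noteq> t \<Longrightarrow> alt s t (m s t) \<approx>\<^sub>b alt t s (m s t)"
proof -
  assume st: "s \<in> S" "t \<in> S" "s \<noteq> t"
  have "(alt s t (m s t), alt t s (m s t)) \<in> brel" using st unfolding brel_def by blast
  then have "([] @ alt s t (m s t) @ [], [] @ alt t s (m s t) @ []) \<in> word_step brel"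
    unfolding word_step_def by blast
  then show ?thesis unfolding beq_alt by auto
qed

text \<open>Preservation in one direction is enough, because \<open>brel\<close> is
  symmetric.\<close>

lemma beq_invariant: assumes "u \<approx>\<^sub>b v"
  and "\<And>us vs s t. s \<in> S \<Longrightarrow> t \<in> S \<Longrightarrow> s \<noteq> t \<Longrightarrow> Q (us @ alt s t (m s t) @ vs) \<Longrightarrow> Q (us @ alt t s (m s t) @ vs)"
  and "Q u"
  shows "Q v"
  using assms(1) unfolding beq_alt
proof (induction rule: rtrancl_induct)
  case base
  show ?case by fact
next
  case (step y z)
  then show ?case using assms(2) by (auto simp: word_step_def brel_def)
qed

lemma beq_length: "u \<approx>\<^sub>b v \<Longrightarrow> length u = length v"
  using beq_invariant[of u v "\<lambda>w. length u = length w"] by simp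

lemma beq_set: "u \<approx>\<^sub>b v \<Longrightarrow> set u = set v"
proof (rule beq_invariant[of u v "\<lambda>w. set u = set w"])
  fix us vs s t
  assume st: "s \<in> S" "t \<in> S" "s \<noteq> t" and h: "set u = set (us @ alt s t (m s t) @ vs)"
  have "set (alt s t (m s t)) = set (alt t s (m s t))"
    using set_alt_m[of s t] set_alt_m[of t s] m_sym[of s t] st by auto
  then show "set u = set (us @ alt t s (m s t) @ vs)" using h by simp
qed auto

lemma beq_act: "u \<approx>\<^sub>b v \<Longrightarrow> act u = act v"
proof (rule beq_invariant[of u v "\<lambda>w. act u = act w"])
  fix us vs s t
  assume st: "s \<in> S" "t \<in> S" "s \<noteq> t" and h: "act u = act (us @ alt s t (m s t) @ vs)"
  show "act u = act (us @ alt t s (m s t) @ vs)"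
    unfolding h using act_alt_m[OF st] by (simp add: act_append fun_eq_iff)
qed auto

text \<open>Both sides of a braid relation are red words with the same action, so
  \<open>red_length\<close> equates their counts.\<close>

lemma beq_N: assumes "u \<approx>\<^sub>b v" "set u \<subseteq> S" "\<beta> \<in> P" shows "N u \<beta> = N v \<beta>"
proof -
  have "N v \<beta> = N u \<beta> \<and> set v \<subseteq> S"
  proof (rule beq_invariant[OF assms(1)])
    fix us vs s t
    assume st: "s \<in> S" "t \<in> S" "s \<noteq> t"
      and h: "N (us @ alt s t (m s t) @ vs) \<beta> = N u \<beta> \<and> set (us @ alt s t (m s t) @ vs) \<subseteq> S"
    let ?g = "fold \<tau> us \<beta>"
    have us: "set us \<subseteq> S" "set vs \<subseteq> S" using h by auto
    have g: "?g \<in> P" using us fold_\<tau>_P assms by blast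
    have sa: "set (alt s t (m s t)) \<subseteq> S" "set (alt t s (m s t)) \<subseteq> S"
      using st alt_set[of s t] alt_set[of t s] by fast+
    have r: "red (alt s t (m s t))" "red (alt t s (m s t))"
      using red_alt[of s t "m s t"] red_alt[of t s "m s t"] st m_sym[of s t] by auto
    have "N (alt s t (m s t)) ?g = N (alt t s (m s t)) ?g"
      using red_length(3)[OF sa act_alt_m[OF st] r g] .
    moreover have "fold \<tau> (alt s t (m s t)) ?g = fold \<tau> (alt t s (m s t)) ?g"
      using fold_\<tau>_cong[OF sa g act_alt_m[OF st]] .
    ultimately show "N (us @ alt t s (m s t) @ vs) \<beta> = N u \<beta> \<and> set (us @ alt t s (m s t) @ vs) \<subseteq> S"
      using h us sa by (simp add: N_append)
  qed (use assms in auto)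
  then show ?thesis by simp
qed

lemma beq_red: "u \<approx>\<^sub>b v \<Longrightarrow> set u \<subseteq> S \<Longrightarrow> red u \<longleftrightarrow> red v"
  using beq_N by (simp add: red_def)

text \<open>The exchange condition relative to a prefix \<open>a\<close>: since \<open>a\<close>
  does not invert \<open>\<alpha> t\<close>, the letter that can be traded for an initial
  \<open>t\<close> lies in \<open>z\<close>, and \<open>a\<close> stays intact.\<close>

lemma exchange: assumes "set (a @ z) \<subseteq> S" "t \<in> S" "N a (\<alpha> t) = 0" "N (a @ z) (\<alpha> t) > 0"
  obtains z' where "act (a @ z) = act (t # a @ z')" "length z = Suc (length z')" "set z' \<subseteq> set z"
proof -
  have "N z (fold \<tau> a (\<alpha> t)) > 0" using assms(3,4) unfolding N_append by simp
  from N_pos_split[OF this] obtain u1 r u2 where u: "z = u1 @ r # u2" "N u1 (fold \<tau> a (\<alpha> t)) = 0"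
    "fold \<tau> u1 (fold \<tau> a (\<alpha> t)) = \<alpha> r" by blast
  have n: "N (a @ u1) (\<alpha> t) = 0" unfolding N_append using u(2) assms(3) by simp
  have f: "fold \<tau> (a @ u1) (\<alpha> t) = \<alpha> r" using u(3) by simp
  have "set (a @ u1) \<subseteq> S" using assms(1) u(1) by auto
  from N_zero_act[OF this \<alpha>_P[OF assms(2)] n] have "act (a @ u1) (\<alpha> r) = \<alpha> t" unfolding f .
  then have "act ((a @ u1) @ [r]) = act (t # a @ u1)" using sr_conj by blast
  then have "act (((a @ u1) @ [r]) @ u2) = act (t # a @ u1 @ u2)"
    unfolding fun_eq_iff by (simp add: act_append)
  then have "act (a @ z) = act (t # a @ u1 @ u2)" unfolding u by simp
  from that[OF this] show ?thesis unfolding u by auto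
qed

text \<open>Two alternating prefixes grow in parallel: from a word starting with
  \<open>alt a b k\<close>, exchanging \<open>b\<close> to the front gives one starting with
  \<open>alt b a (Suc k)\<close>.\<close>

lemma red_two_descents: assumes "set u \<subseteq> S" "red u" "s \<in> S" "t \<in> S" "s \<noteq> t"
  and Ns: "N u (\<alpha> s) > 0" and Nt: "N u (\<alpha> t) > 0"
  obtains z where "set z \<subseteq> S" "act u = act (alt s t (m s t) @ z)" "length u = m s t + length z"
proof -
  have "\<exists>z z'. set z \<subseteq> S \<and> set z' \<subseteq> S \<and> act u = act (alt s t k @ z) \<and> length u = k + length z
     \<and> act u = act (alt t s k @ z') \<and> length u = k + length z'" if "k \<le> m s t" for k
    using that
  proof (induction k)
    case 0
    then show ?case using assms by (intro exI[of _ u]) auto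
  next
    case (Suc k)
    then obtain z z' where z: "set z \<subseteq> S" "set z' \<subseteq> S" "act u = act (alt s t k @ z)" "length u = k + length z"
      "act u = act (alt t s k @ z')" "length u = k + length z'" by auto
    have step: "\<exists>y. set y \<subseteq> S \<and> act u = act (alt b a (Suc k) @ y) \<and> length u = Suc k + length y"
      if ab: "a \<in> S" "b \<in> S" "a \<noteq> b" "Suc k \<le> m a b" and x: "set x \<subseteq> S" "act u = act (alt a b k @ x)"
        "length u = k + length x" and Nb: "N u (\<alpha> b) > 0" for a b x
    proof -
      have sa: "set (alt a b k @ x) \<subseteq> S" using alt_set[of a b k] ab x by auto
      have r: "red (alt a b k @ x)" using red_length(2)[OF assms(1) sa x(2) assms(2)] x by simp
      have "N (alt a b k @ x) (\<alpha> b) > 0"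
        using red_length(3)[OF assms(1) sa x(2) assms(2) r \<alpha>_P] ab Nb by simp
      \<comment> \<open>\<open>b # alt a b k\<close> is the red word \<open>alt b a (Suc k)\<close>,
        so the alternating prefix does not invert \<open>\<alpha> b\<close>.\<close>
      moreover have "N (alt a b k) (\<alpha> b) = 0"
        using red_alt[of b a "Suc k"] ab m_sym[of a b] red_Cons[of b] by simp
      ultimately obtain y where "act (alt a b k @ x) = act (b # alt a b k @ y)"
        "length x = Suc (length y)" "set y \<subseteq> set x" using exchange[OF sa ab(2)] by blast
      then show ?thesis using x by (intro exI[of _ y]) auto
    qed
    show ?case
      using step[of t s z'] step[of s t z] z assms Suc.prems m_sym[of s t] by metis
  qed
  then show ?thesis using that by (metis order_refl)
qed

text \<open>If the first letters differ, the group element has both as descents, so it has words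
  starting with either side of their braid relation and the same remainder. These two words link
  \<open>u\<close> and \<open>v\<close>; words with a common first letter are handled by
  induction.\<close>

theorem matsumoto: assumes "set u \<subseteq> S" "set v \<subseteq> S" "red u" "red v" "act u = act v"
  shows "u \<approx>\<^sub>b v"
  using assms
proof (induction "length u" arbitrary: u v)
  case 0
  have "length v = length u"
    using red_length(2)[OF 0(2,3) 0(6) 0(4)] 0(5) by simp
  then show ?case using 0(1) by simp
next
  case (Suc n)
  note su = Suc.prems(1) and sv = Suc.prems(2) and ru = Suc.prems(3) and rv = Suc.prems(4) and uv = Suc.prems(5)
  have len: "length v = length u" using red_length(2)[OF su sv uv ru] rv by simp
  obtain s u' where u: "u = s # u'" using Suc.hyps by (cases u) auto
  obtain t v' where v: "v = t # v'" using Suc.hyps len by (cases v) auto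
  have tail: "a # x \<approx>\<^sub>b a # y" if "set (a # x) \<subseteq> S" "set (a # y) \<subseteq> S" "red (a # x)" "red (a # y)"
    "act (a # x) = act (a # y)" "length (a # x) = length u" for a x y
  proof -
    have xy: "act x = act y"
    proof
      fix z
      have "sr a (sr a (act x z)) = sr a (sr a (act y z))" using fun_cong[OF that(5), of z] by simp
      then show "act x z = act y z" by simp
    qed
    have a: "a \<in> S" using that(1) by simp
    have "x \<approx>\<^sub>b y"
      by (rule Suc.hyps(1)) (use that Suc.hyps(2) red_Cons[OF a] xy in auto)
    then show ?thesis by (rule beq_Cons)
  qed
  show ?case
  proof (cases "s = t")
    case True
    show ?thesis using tail[of s u' v'] su sv ru rv uv unfolding u v True by simp
  next
    case False
    have st: "s \<in> S" "t \<in> S" using u v su sv by auto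
    have "N u (\<alpha> s) > 0" "N v (\<alpha> t) > 0" using u v by auto
    then have Nst: "N u (\<alpha> s) > 0" "N u (\<alpha> t) > 0"
      using red_length(3)[OF su sv uv ru rv \<alpha>_P[OF st(2)]] by auto
    obtain z where z: "set z \<subseteq> S" "act u = act (alt s t (m s t) @ z)" "length u = m s t + length z"
      using red_two_descents[OF su ru st False Nst] .
    let ?a = "alt s t (m s t) @ z" and ?b = "alt t s (m s t) @ z"
    have sub: "set ?a \<subseteq> S" "set ?b \<subseteq> S" using z(1) st alt_set[of s t] alt_set[of t s] by fastforce+
    have ab: "act ?a = act ?b" unfolding fun_eq_iff by (simp add: act_append act_alt_m[OF st False])
    have ub: "act u = act ?b" using z(2) ab by simp
    have r: "red ?a" "red ?b"
      using red_length(2)[OF su sub(1) z(2) ru] red_length(2)[OF su sub(2) ub ru] z(3) by simp_all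
    have a: "?a = s # alt t s (m s t - 1) @ z" using alt_m_split[OF st False] by simp
    have b: "?b = t # alt s t (m s t - 1) @ z"
      using alt_m_split[OF st(2,1)] False m_sym[OF st False] by simp
    have 1: "u \<approx>\<^sub>b ?a"
      by (rule tail[of s u' "alt t s (m s t - 1) @ z", folded u a, OF su sub(1) ru r(1) z(2) refl])
    have 2: "?a \<approx>\<^sub>b ?b" using beq_append[OF beq_braid[OF st False] beq_refl] .
    have "length ?b = length u" using z(3) by simp
    then have 3: "?b \<approx>\<^sub>b v"
      by (rule tail[of t "alt s t (m s t - 1) @ z" v', folded v b, OF sub(2) sv r(2) rv trans[OF ub[symmetric] uv]])
    show ?thesis using beq_trans[OF 1 beq_trans[OF 2 3]] .
  qed
qed

lemma red_start: assumes "set b \<subseteq> S" "red b" "t \<in> S" "N b (\<alpha> t) > 0" obtains b' where "b \<approx>\<^sub>b t # b'"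
proof -
  obtain b1 a b2 where b: "b = b1 @ a # b2" "act (b1 @ [a]) = act (t # b1)"
    using N_split_simple[OF assms(1,3,4)] by metis
  have e: "act b = act (t # b1 @ b2)"
  proof
    fix z
    have "act b z = act (b1 @ [a]) (act b2 z)" by (simp add: b(1) act_append)
    then show "act b z = act (t # b1 @ b2) z" unfolding b(2) by (simp add: act_append)
  qed
  have s: "set (t # b1 @ b2) \<subseteq> S" using assms b(1) by auto
  have "red (t # b1 @ b2)" using red_length(2)[OF assms(1) s e assms(2)] b(1) by simp
  then show ?thesis using that matsumoto[OF assms(1) s assms(2) _ e] by blast
qed

lemma red_length_le: assumes "set e \<subseteq> S" "red e" shows "length e \<le> card P"
proof -
  have "sum (N e) P \<le> sum (\<lambda>_. 1) P" by (rule sum_mono) (use assms(2) in \<open>simp add: red_def\<close>)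
  then show ?thesis unfolding sum_N[OF assms(1)] by simp
qed

text \<open>A red word of maximal length inverts every simple root, as otherwise
  \<open>red_Cons\<close> would extend it. It represents the longest element.\<close>

lemma longest_word: obtains e where "set e \<subseteq> S" "red e" "\<And>s. s \<in> S \<Longrightarrow> N e (\<alpha> s) > 0"
proof -
  let ?R = "\<lambda>e. set e \<subseteq> S \<and> red e"
  have b: "\<forall>e. ?R e \<longrightarrow> length e < Suc (card P)"
    using red_length_le by (simp add: less_Suc_eq_le)
  have R0: "?R []" by simp
  obtain e where "?R e \<and> (\<forall>y. ?R y \<longrightarrow> length y \<le> length e)"
    using ex_has_greatest_nat[of ?R, OF R0 b] by (rule exE)
  then have e: "?R e" and mx: "\<And>y. ?R y \<Longrightarrow> length y \<le> length e" by blast+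
  have "N e (\<alpha> s) > 0" if s: "s \<in> S" for s
  proof (rule ccontr)
    assume "\<not> N e (\<alpha> s) > 0"
    then have "?R (s # e)" using red_Cons[OF s] e s by simp
    then have "length (s # e) \<le> length e" by (rule mx)
    then show False by simp
  qed
  then show ?thesis using that[of e] e by blast
qed

section \<open>Left divisibility in the positive Artin monoid\<close>

definition pre :: "'a list \<Rightarrow> 'a list \<Rightarrow> bool" (infix "\<preceq>" 50) where
  "x \<preceq> z \<longleftrightarrow> (\<exists>y. x @ y \<approx>\<^sub>b z)"

lemma pre_refl [simp]: "x \<preceq> x" unfolding pre_def by (rule exI[of _ "[]"]) simp

lemma pre_Nil [simp]: "[] \<preceq> x" unfolding pre_def by (rule exI[of _ x]) simp

lemma pre_append [simp]: "x \<preceq> x @ y" unfolding pre_def by (rule exI[of _ y]) simp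

lemma pre_beq: "x \<approx>\<^sub>b y \<Longrightarrow> x \<preceq> y" unfolding pre_def by (rule exI[of _ "[]"]) simp

lemma pre_trans: assumes "x \<preceq> y" "y \<preceq> z" shows "x \<preceq> z"
proof -
  obtain a b where "x @ a \<approx>\<^sub>b y" "y @ b \<approx>\<^sub>b z" using assms unfolding pre_def by blast
  then have "(x @ a) @ b \<approx>\<^sub>b z" using beq_append[of "x @ a" y b b] beq_trans by simp
  then show ?thesis unfolding pre_def by auto
qed

lemma pre_append_mono: assumes "x \<preceq> y" shows "a @ x \<preceq> a @ y"
proof -
  obtain b where "x @ b \<approx>\<^sub>b y" using assms unfolding pre_def by blast
  then have "a @ x @ b \<approx>\<^sub>b a @ y" using beq_append[of a a] by simp
  then show ?thesis unfolding pre_def by auto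
qed

lemma pre_Cons: "x \<preceq> y \<Longrightarrow> s # x \<preceq> s # y"
  using pre_append_mono[of x y "[s]"] by simp

lemma pre_set: assumes "x \<preceq> y" shows "set x \<subseteq> set y"
proof -
  obtain b where "x @ b \<approx>\<^sub>b y" using assms unfolding pre_def by blast
  then show ?thesis using beq_set[of "x @ b" y] by auto
qed

lemma pre_length: assumes "x \<preceq> y" shows "length x \<le> length y"
proof -
  obtain b where "x @ b \<approx>\<^sub>b y" using assms unfolding pre_def by blast
  then show ?thesis using beq_length[of "x @ b" y] by simp
qed

lemma pre_length_eq: assumes "x \<preceq> y" "length y \<le> length x" shows "x \<approx>\<^sub>b y"
proof -
  obtain b where b: "x @ b \<approx>\<^sub>b y" using assms unfolding pre_def by blast
  then have "length x + length b = length y" using beq_length[of "x @ b" y] by simp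
  then have "b = []" using assms(2) by (cases b) auto
  then show ?thesis using b by simp
qed

lemma pre_N: assumes "x \<preceq> y" "set y \<subseteq> S" "\<beta> \<in> P" shows "N x \<beta> \<le> N y \<beta>"
proof -
  obtain b where b: "x @ b \<approx>\<^sub>b y" using assms unfolding pre_def by blast
  have "set (x @ b) \<subseteq> S" unfolding beq_set[OF b] by (rule assms(2))
  from beq_N[OF b this assms(3)] show ?thesis by (simp add: N_append)
qed

text \<open>Garside's key property: a common first letter cancels, and words starting with distinct
  \<open>s\<close> and \<open>t\<close> factor through the braid word
  \<open>alt s t (m s t)\<close>, the least common multiple of \<open>s\<close> and
  \<open>t\<close>. Removing its first letter leaves length \<open>m s t - 1\<close>.\<close>

definition key :: "'a list \<Rightarrow> bool" where
  "key z \<longleftrightarrow> (\<forall>s t X Y. s # X \<approx>\<^sub>b z \<longrightarrow> t # Y \<approx>\<^sub>b z \<longrightarrow>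
     (if s = t then X \<approx>\<^sub>b Y
      else \<exists>Z. X \<approx>\<^sub>b alt t s (m s t - 1) @ Z \<and> Y \<approx>\<^sub>b alt s t (m s t - 1) @ Z))"

lemma key_eq: "key z \<Longrightarrow> s # X \<approx>\<^sub>b z \<Longrightarrow> s # Y \<approx>\<^sub>b z \<Longrightarrow> X \<approx>\<^sub>b Y"
  unfolding key_def by metis

lemma key_neq: assumes "key z" "s # X \<approx>\<^sub>b z" "t # Y \<approx>\<^sub>b z" "s \<noteq> t"
  obtains Z where "X \<approx>\<^sub>b alt t s (m s t - 1) @ Z" "Y \<approx>\<^sub>b alt s t (m s t - 1) @ Z"
  using assms unfolding key_def by metis

text \<open>Abstracts the classes where cancellation is available while \<open>key\<close> is still
  being proved: words shorter than a given one, by induction, and red words, by Matsumoto's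
  theorem.\<close>

definition hereditary :: "('a list \<Rightarrow> bool) \<Rightarrow> bool" where
  "hereditary Q \<longleftrightarrow> (\<forall>z. Q z \<longrightarrow> set z \<subseteq> S \<and> key z \<and> (\<forall>z'. z \<approx>\<^sub>b z' \<longrightarrow> Q z')) \<and>
     (\<forall>s X. Q (s # X) \<longrightarrow> Q X)"

lemma hereditaryD: assumes "hereditary Q" "Q z"
  shows "set z \<subseteq> S" "key z" "z \<approx>\<^sub>b z' \<Longrightarrow> Q z'" "z' \<approx>\<^sub>b z \<Longrightarrow> Q z'"
  using assms beq_sym unfolding hereditary_def by blast+

lemma hereditary_suffix: "hereditary Q \<Longrightarrow> Q (x @ y) \<Longrightarrow> Q y"
proof (induction x)
  case (Cons a x)
  then have "Q (x @ y)" unfolding hereditary_def by (metis append_Cons)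
  then show ?case using Cons by blast
qed simp

lemma hereditary_cancel: assumes "hereditary Q"
  shows "Q z \<Longrightarrow> A @ p \<approx>\<^sub>b z \<Longrightarrow> A @ q \<approx>\<^sub>b z \<Longrightarrow> p \<approx>\<^sub>b q"
proof (induction A arbitrary: z)
  case Nil
  then show ?case using beq_trans[OF Nil(2) beq_sym[OF Nil(3)]] by simp
next
  case (Cons a A)
  have pq: "a # A @ p \<approx>\<^sub>b z" "a # A @ q \<approx>\<^sub>b z" using Cons.prems by simp_all
  have 1: "A @ q \<approx>\<^sub>b A @ p"
    by (rule key_eq[OF hereditaryD(2)[OF assms Cons.prems(1)] pq(2,1)])
  have "Q (a # A @ p)" by (rule hereditaryD(4)[OF assms Cons.prems(1) pq(1)])
  then have "Q (A @ p)" using hereditary_suffix[OF assms, of "[a]" "A @ p"] by simp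
  from Cons.IH[OF this beq_refl 1] show ?case .
qed

lemma hereditary_pre_cancel: assumes "hereditary Q" "Q z" "A @ p \<preceq> z" "A @ W \<approx>\<^sub>b z"
  shows "p \<preceq> W"
proof -
  obtain y where "(A @ p) @ y \<approx>\<^sub>b z" using assms(3) unfolding pre_def by blast
  then have "p @ y \<approx>\<^sub>b W" using hereditary_cancel[OF assms(1,2)] assms(4) by simp
  then show ?thesis unfolding pre_def by blast
qed

lemma pre_ConsE: assumes "s # x \<preceq> z" obtains W where "s # W \<approx>\<^sub>b z" "x \<preceq> W"
  using assms unfolding pre_def by (metis append_Cons beq_refl)

text \<open>The usual construction of a least common multiple, run below \<open>z\<close> and
  \<open>e\<close> simultaneously. It takes the same steps under both, because the braid words to be
  inserted depend on the first letters of \<open>x\<close> and \<open>y\<close> alone; hence one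
  \<open>l\<close> serves both and uses no letters beyond \<open>J\<close>.\<close>

lemma common_upper_bound:
  assumes Q: "hereditary Q" and R: "hereditary R" and J: "J \<subseteq> S"
  shows "Q z \<Longrightarrow> R e \<Longrightarrow> x \<preceq> z \<Longrightarrow> x \<preceq> e \<Longrightarrow> y \<preceq> z \<Longrightarrow> y \<preceq> e \<Longrightarrow> set x \<subseteq> J \<Longrightarrow> set y \<subseteq> J \<Longrightarrow>
    \<exists>l. set l \<subseteq> J \<and> x \<preceq> l \<and> y \<preceq> l \<and> l \<preceq> z \<and> l \<preceq> e"
proof (induction "length z" arbitrary: z e x y rule: less_induct)
  case less
  show ?case
  proof (cases "x = [] \<or> y = []")
    case True
    then show ?thesis
    proof
      assume "x = []"
      then show ?thesis using less.prems by (intro exI[of _ y]) simp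
    next
      assume "y = []"
      then show ?thesis using less.prems by (intro exI[of _ x]) simp
    qed
  next
    case False
    then obtain s x1 t y1 where xy: "x = s # x1" "y = t # y1" by (meson neq_Nil_conv)
    obtain z1 where z1: "s # z1 \<approx>\<^sub>b z" "x1 \<preceq> z1" using pre_ConsE less.prems(3) xy by blast
    obtain e1 where e1: "s # e1 \<approx>\<^sub>b e" "x1 \<preceq> e1" using pre_ConsE less.prems(4) xy by blast
    obtain z2 where z2: "t # z2 \<approx>\<^sub>b z" "y1 \<preceq> z2" using pre_ConsE less.prems(5) xy by blast
    obtain e2 where e2: "t # e2 \<approx>\<^sub>b e" "y1 \<preceq> e2" using pre_ConsE less.prems(6) xy by blast
    have stJ: "s \<in> J" "t \<in> J" "set x1 \<subseteq> J" "set y1 \<subseteq> J" using less.prems xy by auto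
    have Qs: "Q z1" "Q z2" and Rs: "R e1" "R e2"
      using hereditary_suffix[OF Q, of "[s]" z1] hereditary_suffix[OF Q, of "[t]" z2]
        hereditary_suffix[OF R, of "[s]" e1] hereditary_suffix[OF R, of "[t]" e2]
        hereditaryD(4)[OF Q less.prems(1) z1(1)] hereditaryD(4)[OF R less.prems(2) e1(1)]
        hereditaryD(4)[OF Q less.prems(1) z2(1)] hereditaryD(4)[OF R less.prems(2) e2(1)] by simp_all
    have len: "length z1 < length z" "length z2 < length z"
      unfolding beq_length[OF z1(1), symmetric] beq_length[OF z2(1), symmetric]
      using beq_length[OF beq_trans[OF z1(1) beq_sym[OF z2(1)]]] by simp_all
    note kz = hereditaryD(2)[OF Q less.prems(1)] and ke = hereditaryD(2)[OF R less.prems(2)]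
    show ?thesis
    proof (cases "s = t")
      case True
      have y1: "y1 \<preceq> z1" "y1 \<preceq> e1"
        by (rule pre_trans[OF z2(2) pre_beq[OF key_eq[OF kz z2(1)]]], unfold True[symmetric], rule z1(1),
            rule pre_trans[OF e2(2) pre_beq[OF key_eq[OF ke e2(1)]]], unfold True[symmetric], rule e1(1))
      then obtain l where l: "set l \<subseteq> J" "x1 \<preceq> l" "y1 \<preceq> l" "l \<preceq> z1" "l \<preceq> e1"
        using less.hyps[OF len(1) Qs(1) Rs(1) z1(2) e1(2) y1 stJ(3,4)] by blast
      have "s # l \<preceq> z" "s # l \<preceq> e"
        using pre_trans[OF pre_Cons[OF l(4)] pre_beq[OF z1(1)]] pre_trans[OF pre_Cons[OF l(5)] pre_beq[OF e1(1)]] .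
      then show ?thesis using l xy True stJ pre_Cons by (intro exI[of _ "s # l"]) auto
    next
      case False
      let ?A = "alt t s (m s t - 1)" and ?B = "alt s t (m s t - 1)"
      have st: "s \<in> S" "t \<in> S" using stJ J by auto
      have AB: "set ?A \<subseteq> J" "set ?B \<subseteq> J" using alt_set[of s t] alt_set[of t s] stJ by fastforce+
      have D: "s # ?A \<approx>\<^sub>b t # ?B"
        using beq_braid[OF st False] alt_m_split[OF st False] alt_m_split[OF st(2,1)] False m_sym[OF st False] by simp
      obtain Z where Z: "z1 \<approx>\<^sub>b ?A @ Z" "z2 \<approx>\<^sub>b ?B @ Z" using key_neq[OF kz z1(1) z2(1) False] .
      obtain Y where Y: "e1 \<approx>\<^sub>b ?A @ Y" "e2 \<approx>\<^sub>b ?B @ Y" using key_neq[OF ke e1(1) e2(1) False] .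
      have A1: "?A \<preceq> z1" "?A \<preceq> e1" "?B \<preceq> z2" "?B \<preceq> e2"
        using beq_sym[OF Z(1)] beq_sym[OF Y(1)] beq_sym[OF Z(2)] beq_sym[OF Y(2)] unfolding pre_def by blast+
      obtain l1 where l1: "set l1 \<subseteq> J" "x1 \<preceq> l1" "?A \<preceq> l1" "l1 \<preceq> z1" "l1 \<preceq> e1"
        using less.hyps[OF len(1) Qs(1) Rs(1) z1(2) e1(2) A1(1,2) stJ(3) AB(1)] by blast
      obtain l2 where l2: "set l2 \<subseteq> J" "y1 \<preceq> l2" "?B \<preceq> l2" "l2 \<preceq> z2" "l2 \<preceq> e2"
        using less.hyps[OF len(2) Qs(2) Rs(2) z2(2) e2(2) A1(3,4) stJ(4) AB(2)] by blast
      \<comment> \<open>Beyond the braid word, \<open>l1\<close> and \<open>l2\<close> contribute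
        \<open>p\<close> and \<open>q\<close>; joining these below the remainders \<open>Z\<close>
        and \<open>Y\<close> completes the common multiple.\<close>
      obtain p where p: "?A @ p \<approx>\<^sub>b l1" using l1(3) unfolding pre_def by blast
      obtain q where q: "?B @ q \<approx>\<^sub>b l2" using l2(3) unfolding pre_def by blast
      have pq: "set p \<subseteq> J" "set q \<subseteq> J" using beq_set[OF p] beq_set[OF q] l1(1) l2(1) by auto
      have pZ: "p \<preceq> Z" "p \<preceq> Y" "q \<preceq> Z" "q \<preceq> Y"
        using hereditary_pre_cancel[OF Q Qs(1) pre_trans[OF pre_beq[OF p] l1(4)] beq_sym[OF Z(1)]]
          hereditary_pre_cancel[OF R Rs(1) pre_trans[OF pre_beq[OF p] l1(5)] beq_sym[OF Y(1)]]
          hereditary_pre_cancel[OF Q Qs(2) pre_trans[OF pre_beq[OF q] l2(4)] beq_sym[OF Z(2)]]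
          hereditary_pre_cancel[OF R Rs(2) pre_trans[OF pre_beq[OF q] l2(5)] beq_sym[OF Y(2)]] .
      have QZ: "Q Z" "R Y"
        using hereditary_suffix[OF Q hereditaryD(3)[OF Q Qs(1) Z(1)]]
          hereditary_suffix[OF R hereditaryD(3)[OF R Rs(1) Y(1)]] .
      have "length Z < length z" using beq_length[OF Z(1)] len by simp
      from less.hyps[OF this QZ pZ(1,2) pZ(3,4) pq] obtain l3
        where l3: "set l3 \<subseteq> J" "p \<preceq> l3" "q \<preceq> l3" "l3 \<preceq> Z" "l3 \<preceq> Y" by blast
      let ?l = "s # ?A @ l3"
      have tl: "t # ?B @ l3 \<approx>\<^sub>b ?l" using beq_append[OF beq_sym[OF D] beq_refl[of l3]] by simp
      have "x \<preceq> ?l" unfolding xy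
        by (rule pre_Cons[OF pre_trans[OF l1(2) pre_trans[OF pre_beq[OF beq_sym[OF p]] pre_append_mono[OF l3(2)]]]])
      moreover have "y \<preceq> t # ?B @ l3" unfolding xy
        by (rule pre_Cons[OF pre_trans[OF l2(2) pre_trans[OF pre_beq[OF beq_sym[OF q]] pre_append_mono[OF l3(3)]]]])
      then have "y \<preceq> ?l" by (rule pre_trans[OF _ pre_beq[OF tl]])
      moreover have "?l \<preceq> z"
        by (rule pre_trans[OF pre_Cons[OF pre_trans[OF pre_append_mono[OF l3(4)] pre_beq[OF beq_sym[OF Z(1)]]]] pre_beq[OF z1(1)]])
      moreover have "?l \<preceq> e"
        by (rule pre_trans[OF pre_Cons[OF pre_trans[OF pre_append_mono[OF l3(5)] pre_beq[OF beq_sym[OF Y(1)]]]] pre_beq[OF e1(1)]])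
      moreover have "set ?l \<subseteq> J" using l3(1) AB stJ by simp
      ultimately show ?thesis by blast
    qed
  qed
qed

text \<open>\<open>red_two_descents\<close> factors at the level of actions, and
  \<open>matsumoto\<close> turns equal actions of red words into braid equivalence.\<close>

lemma red_key: assumes "set z \<subseteq> S" "red z" shows "key z"
  unfolding key_def
proof (intro allI impI)
  fix s t X Y assume X: "s # X \<approx>\<^sub>b z" and Y: "t # Y \<approx>\<^sub>b z"
  have sX: "set (s # X) \<subseteq> S" and sY: "set (t # Y) \<subseteq> S" using beq_set[OF X] beq_set[OF Y] assms by auto
  have rX: "red (s # X)" and rY: "red (t # Y)" using beq_red[OF X sX] beq_red[OF Y sY] assms by auto
  have st: "s \<in> S" "t \<in> S" using sX sY by auto
  have strip: "X' \<approx>\<^sub>b Z'" if "set (a # X') \<subseteq> S" "set (a # Z') \<subseteq> S" "red (a # X')" "red (a # Z')"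
    "act (a # X') = act (a # Z')" for a X' Z'
  proof -
    have "act X' = act Z'"
    proof
      fix x
      have "sr a (sr a (act X' x)) = sr a (sr a (act Z' x))" using fun_cong[OF that(5), of x] by simp
      then show "act X' x = act Z' x" by simp
    qed
    moreover have "red X'" "red Z'" using that red_Cons[of a] by auto
    ultimately show ?thesis using matsumoto that by simp
  qed
  show "if s = t then X \<approx>\<^sub>b Y
      else \<exists>Z. X \<approx>\<^sub>b alt t s (m s t - 1) @ Z \<and> Y \<approx>\<^sub>b alt s t (m s t - 1) @ Z"
  proof (cases "s = t")
    case True
    have "act (s # X) = act (s # Y)" using beq_act[OF X] beq_act[OF Y] True by simp
    then show ?thesis using strip[of s X Y] sX sY rX rY True by simp
  next
    case False
    have "N z (\<alpha> s) > 0" "N z (\<alpha> t) > 0"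
      using beq_N[OF X sX \<alpha>_P[OF st(1)]] beq_N[OF Y sY \<alpha>_P[OF st(2)]] by auto
    then obtain Z where Z: "set Z \<subseteq> S" "act z = act (alt s t (m s t) @ Z)" "length z = m s t + length Z"
      using red_two_descents[OF assms st False] by blast
    let ?a = "alt s t (m s t) @ Z" and ?b = "alt t s (m s t) @ Z"
    have sub: "set ?a \<subseteq> S" "set ?b \<subseteq> S" using Z(1) st alt_set[of s t] alt_set[of t s] by fastforce+
    have ab: "act z = act ?b" unfolding Z(2) fun_eq_iff by (simp add: act_append act_alt_m[OF st False])
    have r: "red ?a" "red ?b"
      using red_length(2)[OF assms(1) sub(1) Z(2) assms(2)] red_length(2)[OF assms(1) sub(2) ab assms(2)] Z(3) by simp_all
    have a: "?a = s # alt t s (m s t - 1) @ Z" using alt_m_split[OF st False] by simp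
    have b: "?b = t # alt s t (m s t - 1) @ Z"
      using alt_m_split[OF st(2,1)] False m_sym[OF st False] by simp
    have "X \<approx>\<^sub>b alt t s (m s t - 1) @ Z"
      by (rule strip[of s X "alt t s (m s t - 1) @ Z", folded a, OF sX sub(1) rX r(1)]) (simp add: beq_act[OF X] Z(2))
    moreover have "Y \<approx>\<^sub>b alt s t (m s t - 1) @ Z"
      by (rule strip[of t Y "alt s t (m s t - 1) @ Z", folded b, OF sY sub(2) rY r(2)]) (simp add: beq_act[OF Y] ab)
    ultimately show ?thesis using False by auto
  qed
qed

lemma hereditary_red: "hereditary (\<lambda>z. set z \<subseteq> S \<and> red z)"
  unfolding hereditary_def using red_key beq_set beq_red red_Cons by auto

text \<open>For the transitivity of the relation between the two decompositions along a chain of braid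
  moves, the case of three distinct first letters \<open>s\<close>, \<open>u\<close>, \<open>t\<close> is resolved by comparing with the
  longest element.\<close>

lemma key_all: "set z \<subseteq> S \<Longrightarrow> key z"
proof (induction "length z" arbitrary: z rule: less_induct)
  case less
  define Q where "Q = (\<lambda>y. set y \<subseteq> S \<and> length y < length z)"
  have Q: "hereditary Q"
    unfolding hereditary_def Q_def using less.hyps beq_set beq_length by auto
  \<comment> \<open>The conclusion of \<open>key\<close> as a relation between two words. A single
    braid move satisfies it, so transitivity carries it along a chain of moves.\<close>
  define rel where "rel = (\<lambda>x y. case (x, y) of (s # X, t # Y) \<Rightarrow>
     (if s = t then X \<approx>\<^sub>b Y else \<exists>Z. X \<approx>\<^sub>b alt t s (m s t - 1) @ Z \<and> Y \<approx>\<^sub>b alt s t (m s t - 1) @ Z) | _ \<Rightarrow> x = y)"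
  have rel_trans: "rel x w" if xy: "rel x y" and yw: "rel y w"
    and sub: "set x \<subseteq> S" "set y \<subseteq> S" "set w \<subseteq> S" and len: "length x = length z" "length y = length z" "length w = length z"
    for x y w
  proof (cases "z = []")
    case True
    then show ?thesis using len by (simp add: rel_def)
  next
    case False
    then obtain s X u V t Y where w: "x = s # X" "y = u # V" "w = t # Y"
      using len by (metis length_0_conv neq_Nil_conv)
    have S: "s \<in> S" "u \<in> S" "t \<in> S" using sub w by auto
    have QX: "Q X" "Q V" "Q Y" using w sub len unfolding Q_def by auto
    have m1: "m s u = m u s" if "s \<noteq> u" using m_sym S that by simp
    have m2: "m u t = m t u" if "u \<noteq> t" using m_sym S that by simp
    consider "s = u" | "u = t" "s \<noteq> u" | "s = t" "s \<noteq> u" | "s \<noteq> u" "u \<noteq> t" "s \<noteq> t" by blast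
    then show ?thesis
    proof cases
      case 1
      then have "X \<approx>\<^sub>b V" using xy w by (simp add: rel_def)
      note XV = this
      have yw': "if u = t then V \<approx>\<^sub>b Y else \<exists>Z. V \<approx>\<^sub>b alt t u (m u t - 1) @ Z \<and> Y \<approx>\<^sub>b alt u t (m u t - 1) @ Z"
        using yw by (simp add: w rel_def)
      show ?thesis
      proof (cases "u = t")
        case True
        then show ?thesis using beq_trans[OF XV, of Y] yw' 1 by (simp add: w rel_def)
      next
        case False
        then obtain Z where "V \<approx>\<^sub>b alt t u (m u t - 1) @ Z" "Y \<approx>\<^sub>b alt u t (m u t - 1) @ Z" using yw' by auto
        then show ?thesis using beq_trans[OF XV, of "alt t u (m u t - 1) @ Z"] False 1 by (auto simp: w rel_def)
      qed
    next
      case 2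
      then have "V \<approx>\<^sub>b Y" using yw w by (simp add: rel_def)
      obtain Z1 where Z1: "X \<approx>\<^sub>b alt u s (m s u - 1) @ Z1" "V \<approx>\<^sub>b alt s u (m s u - 1) @ Z1"
        using xy w 2 by (auto simp: rel_def)
      have "Y \<approx>\<^sub>b alt s u (m s u - 1) @ Z1" by (rule beq_trans[OF beq_sym[OF \<open>V \<approx>\<^sub>b Y\<close>] Z1(2)])
      then show ?thesis using Z1(1) 2 by (auto simp: rel_def w)
    next
      case 3
      obtain Z1 where Z1: "X \<approx>\<^sub>b alt u s (m s u - 1) @ Z1" "V \<approx>\<^sub>b alt s u (m s u - 1) @ Z1"
        using xy w 3 by (auto simp: rel_def)
      obtain Z2 where Z2: "V \<approx>\<^sub>b alt s u (m s u - 1) @ Z2" "Y \<approx>\<^sub>b alt u s (m s u - 1) @ Z2"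
        using yw w 3 m1 by (auto simp: rel_def)
      have "Z1 \<approx>\<^sub>b Z2" by (rule hereditary_cancel[OF Q QX(2) beq_sym[OF Z1(2)] beq_sym[OF Z2(1)]])
      then have "X \<approx>\<^sub>b Y"
        by (rule beq_trans[OF Z1(1) beq_trans[OF beq_append[OF beq_refl] beq_sym[OF Z2(2)]]])
      then show ?thesis using w 3 by (simp add: rel_def)
    next
      case 4
      obtain Z1 where Z1: "X \<approx>\<^sub>b alt u s (m s u - 1) @ Z1" "V \<approx>\<^sub>b alt s u (m s u - 1) @ Z1"
        using xy w 4 by (auto simp: rel_def)
      obtain Z2 where Z2: "V \<approx>\<^sub>b alt t u (m u t - 1) @ Z2" "Y \<approx>\<^sub>b alt u t (m u t - 1) @ Z2"
        using yw w 4 by (auto simp: rel_def)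
      let ?p = "alt s u (m s u - 1)" and ?q = "alt t u (m u t - 1)"
      obtain e where e: "set e \<subseteq> S" "red e" "\<And>r. r \<in> S \<Longrightarrow> N e (\<alpha> r) > 0" using longest_word by blast
      define R where "R = (\<lambda>z. set z \<subseteq> S \<and> red z)"
      have R: "hereditary R" unfolding R_def by (rule hereditary_red)
      have Re: "R e" using e by (simp add: R_def)
      have start: "\<exists>e'. r # e' \<approx>\<^sub>b e" if r: "r \<in> S" for r
        using red_start[OF e(1,2) r e(3)[OF r]] beq_sym by metis
      obtain E where E: "u # E \<approx>\<^sub>b e" using start S by blast
      have RE: "R E" using hereditary_suffix[OF R, of "[u]" E] hereditaryD(4)[OF R Re E] by simp
      have pE: "?p \<preceq> E"
      proof -
        obtain E' where E': "s # E' \<approx>\<^sub>b e" using start S by blast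
        obtain Z where "E \<approx>\<^sub>b alt s u (m u s - 1) @ Z"
          using key_neq[OF hereditaryD(2)[OF R Re] E E'] 4 by metis
        then have "?p @ Z \<approx>\<^sub>b E" using m1 4 by (metis beq_sym)
        then show ?thesis unfolding pre_def by blast
      qed
      have qE: "?q \<preceq> E"
      proof -
        obtain E' where E': "t # E' \<approx>\<^sub>b e" using start S by blast
        obtain Z where "E \<approx>\<^sub>b alt t u (m u t - 1) @ Z"
          using key_neq[OF hereditaryD(2)[OF R Re] E E'] 4 by metis
        then show ?thesis using beq_sym[of E] unfolding pre_def by blast
      qed
      have pV: "?p \<preceq> V" "?q \<preceq> V" using beq_sym[OF Z1(2)] beq_sym[OF Z2(1)] unfolding pre_def by blast+
      have "set ?p \<subseteq> S" "set ?q \<subseteq> S" using alt_set[of s u] alt_set[of t u] S by fastforce+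
      \<comment> \<open>Asking that \<open>l\<close> divide \<open>E\<close> as well as
        \<open>V\<close> makes \<open>u # l\<close> a divisor of the longest word, hence red. Its
        key property is then known although \<open>u # l\<close> need not be shorter than
        \<open>z\<close>.\<close>
      from common_upper_bound[OF Q R subset_refl QX(2) RE pV(1) pE pV(2) qE this]
      obtain l where l: "set l \<subseteq> S" "?p \<preceq> l" "?q \<preceq> l" "l \<preceq> V" "l \<preceq> E" by blast
      have ule: "u # l \<preceq> e" using pre_trans[OF pre_Cons[OF l(5)] pre_beq[OF E]] .
      have Rl: "R (u # l)"
      proof -
        obtain y where y: "(u # l) @ y \<approx>\<^sub>b e" using ule unfolding pre_def by blast
        then have "R ((u # l) @ y)" using hereditaryD(4)[OF R Re] by blast
        then show ?thesis unfolding R_def using red_append(1)[of "u # l" y] by auto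
      qed
      obtain D1 where D1: "?p @ D1 \<approx>\<^sub>b l" using l(2) unfolding pre_def by blast
      obtain D2 where D2: "?q @ D2 \<approx>\<^sub>b l" using l(3) unfolding pre_def by blast
      obtain Z where Z: "l @ Z \<approx>\<^sub>b V" using l(4) unfolding pre_def by blast
      have us: "u # ?p \<approx>\<^sub>b s # alt u s (m s u - 1)"
        using beq_braid[of u s] alt_m_split[of u s] alt_m_split[of s u] S 4 m1 by auto
      have ut: "u # ?q \<approx>\<^sub>b t # alt u t (m u t - 1)"
        using beq_braid[of u t] alt_m_split[of u t] alt_m_split[of t u] S 4 m2 by auto
      have sD: "s # alt u s (m s u - 1) @ D1 \<approx>\<^sub>b u # l"
        using beq_trans[OF beq_append[OF beq_sym[OF us] beq_refl[of D1]], of "u # l"] beq_Cons[OF D1, of u] by simp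
      have tD: "t # alt u t (m u t - 1) @ D2 \<approx>\<^sub>b u # l"
        using beq_trans[OF beq_append[OF beq_sym[OF ut] beq_refl[of D2]], of "u # l"] beq_Cons[OF D2, of u] by simp
      \<comment> \<open>The decomposition of the red word \<open>u # l\<close> with respect to
        \<open>s\<close> and \<open>t\<close>; appending \<open>Z\<close> on the right yields the
        one required for \<open>X\<close> and \<open>Y\<close>.\<close>
      obtain D3 where D3: "alt u s (m s u - 1) @ D1 \<approx>\<^sub>b alt t s (m s t - 1) @ D3"
        "alt u t (m u t - 1) @ D2 \<approx>\<^sub>b alt s t (m s t - 1) @ D3"
        using key_neq[OF hereditaryD(2)[OF R Rl] sD tD] 4 by blast
      have "?p @ D1 @ Z \<approx>\<^sub>b V" using beq_trans[OF beq_append[OF D1 beq_refl[of Z]] Z] by simp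
      from hereditary_cancel[OF Q QX(2) beq_sym[OF Z1(2)] this] have c1: "Z1 \<approx>\<^sub>b D1 @ Z" .
      have "alt u s (m s u - 1) @ D1 @ Z \<approx>\<^sub>b alt t s (m s t - 1) @ D3 @ Z"
        using beq_append[OF D3(1) beq_refl[of Z]] by simp
      from beq_trans[OF Z1(1) beq_trans[OF beq_append[OF beq_refl c1] this]]
      have X: "X \<approx>\<^sub>b alt t s (m s t - 1) @ D3 @ Z" .
      have "?q @ D2 @ Z \<approx>\<^sub>b V" using beq_trans[OF beq_append[OF D2 beq_refl[of Z]] Z] by simp
      from hereditary_cancel[OF Q QX(2) beq_sym[OF Z2(1)] this] have c2: "Z2 \<approx>\<^sub>b D2 @ Z" .
      have "alt u t (m u t - 1) @ D2 @ Z \<approx>\<^sub>b alt s t (m s t - 1) @ D3 @ Z"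
        using beq_append[OF D3(2) beq_refl[of Z]] by simp
      from beq_trans[OF Z2(2) beq_trans[OF beq_append[OF beq_refl c2] this]]
      have Y: "Y \<approx>\<^sub>b alt s t (m s t - 1) @ D3 @ Z" .
      show ?thesis using X Y w 4 by (auto simp: rel_def)
    qed
  qed
  have rel_refl: "rel x x" for x by (cases x) (auto simp: rel_def)
  have rel_step: "rel (us @ alt s t (m s t) @ vs) (us @ alt t s (m s t) @ vs)"
    if st: "s \<in> S" "t \<in> S" "s \<noteq> t" for us vs s t
  proof (cases us)
    case Nil
    have "m t s = m s t" using m_sym st by simp
    then have e: "us @ alt s t (m s t) @ vs = s # alt t s (m s t - 1) @ vs"
      "us @ alt t s (m s t) @ vs = t # alt s t (m s t - 1) @ vs"
      using Nil st alt_m_split[of s t] alt_m_split[of t s] by simp_all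
    show ?thesis unfolding e rel_def prod.case list.case using st(3) beq_refl by (simp only: if_False) blast
  next
    case (Cons a us')
    then show ?thesis using beq_ctx[OF beq_braid[OF st]] by (simp add: rel_def)
  qed
  have rel_beq: "rel x y" if xy: "x \<approx>\<^sub>b y" and x: "set x \<subseteq> S" "length x = length z" for x y
  proof -
    have "rel x y \<and> set y \<subseteq> S \<and> length y = length z"
    proof (rule beq_invariant[OF xy])
      fix us vs s t
      let ?l = "us @ alt s t (m s t) @ vs" and ?r = "us @ alt t s (m s t) @ vs"
      assume st: "s \<in> S" "t \<in> S" "s \<noteq> t" and h: "rel x ?l \<and> set ?l \<subseteq> S \<and> length ?l = length z"
      have rs: "set ?r \<subseteq> S" using beq_set[OF beq_ctx[OF beq_braid[OF st]], of us vs] h by simp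
      have rl: "length ?r = length z" using h by simp
      have "rel x ?r" by (rule rel_trans[OF _ rel_step[OF st] x(1) _ rs x(2) _ rl]) (use h in simp_all)
      then show "rel x ?r \<and> set ?r \<subseteq> S \<and> length ?r = length z" using rs rl by simp
    qed (use rel_refl x in auto)
    then show ?thesis by simp
  qed
  show ?case unfolding key_def
  proof (intro allI impI)
    fix s t X Y assume X: "s # X \<approx>\<^sub>b z" and Y: "t # Y \<approx>\<^sub>b z"
    have "rel (s # X) (t # Y)"
      by (rule rel_beq[OF beq_trans[OF X beq_sym[OF Y]]]) (simp_all only: beq_set[OF X] beq_length[OF X] less.prems)
    then show "if s = t then X \<approx>\<^sub>b Y
      else \<exists>Z. X \<approx>\<^sub>b alt t s (m s t - 1) @ Z \<and> Y \<approx>\<^sub>b alt s t (m s t - 1) @ Z"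
      by (simp add: rel_def)
  qed
qed

lemma hereditary_all: "hereditary (\<lambda>z. set z \<subseteq> S)"
  unfolding hereditary_def using key_all beq_set by auto

lemma upper_bound_in: assumes "J \<subseteq> S" "set z \<subseteq> S" "x \<preceq> z" "y \<preceq> z" "set x \<subseteq> J" "set y \<subseteq> J"
  obtains l where "set l \<subseteq> J" "x \<preceq> l" "y \<preceq> l" "l \<preceq> z"
  using common_upper_bound[OF hereditary_all hereditary_all assms(1,2,2,3,3,4,4,5,6)] by blast

text \<open>A longest common prefix is the greatest one: its upper bound with any other common
  prefix is again a common prefix.\<close>

lemma gcd_exists: assumes "set z \<subseteq> S" "set e \<subseteq> S"
  obtains g where "g \<preceq> z" "g \<preceq> e" "\<And>x. x \<preceq> z \<Longrightarrow> x \<preceq> e \<Longrightarrow> x \<preceq> g"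
proof -
  let ?R = "\<lambda>g. g \<preceq> z \<and> g \<preceq> e"
  have b: "\<forall>g. ?R g \<longrightarrow> length g < Suc (length z)" using pre_length by (simp add: less_Suc_eq_le)
  have R0: "?R []" by simp
  obtain g where "?R g \<and> (\<forall>y. ?R y \<longrightarrow> length y \<le> length g)"
    using ex_has_greatest_nat[of ?R, OF R0 b] by (rule exE)
  then have g: "?R g" and mx: "\<And>y. ?R y \<Longrightarrow> length y \<le> length g" by blast+
  have "x \<preceq> g" if x: "x \<preceq> z" "x \<preceq> e" for x
  proof -
    have s: "set g \<subseteq> S" "set x \<subseteq> S" using pre_set g x assms by blast+
    obtain l where l: "g \<preceq> l" "x \<preceq> l" "l \<preceq> z" "l \<preceq> e"
      using common_upper_bound[OF hereditary_all hereditary_all subset_refl assms _ _ _ _ s] g x by blast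
    have "g \<approx>\<^sub>b l" by (rule pre_length_eq[OF l(1)]) (use mx l in blast)
    then show ?thesis by (rule pre_trans[OF l(2) pre_beq[OF beq_sym]])
  qed
  then show ?thesis using that g by blast
qed

subsection \<open>Parabolic subsystems\<close>

definition VK :: "'a set \<Rightarrow> 'v set" where "VK K = span (\<alpha> ` K)"

definition PK :: "'a set \<Rightarrow> 'v set" where "PK K = {\<beta>\<in>P. \<forall>r\<in>S - K. co r \<beta> = 0}"

lemma PK_P: "\<beta> \<in> PK K \<Longrightarrow> \<beta> \<in> P" by (simp add: PK_def)

lemma PK_mono: "K \<subseteq> K' \<Longrightarrow> PK K \<subseteq> PK K'" by (auto simp: PK_def)

lemma \<alpha>_PK: "s \<in> K \<Longrightarrow> K \<subseteq> S \<Longrightarrow> \<alpha> s \<in> PK K"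
  using \<alpha>_P by (auto simp: PK_def co_\<alpha>)

lemma \<alpha>_VK: "s \<in> K \<Longrightarrow> \<alpha> s \<in> VK K" by (simp add: VK_def span_base)

lemma VK_add: "x \<in> VK K \<Longrightarrow> y \<in> VK K \<Longrightarrow> x + y \<in> VK K"
  and VK_diff: "x \<in> VK K \<Longrightarrow> y \<in> VK K \<Longrightarrow> x - y \<in> VK K"
  and VK_scale: "x \<in> VK K \<Longrightarrow> c *\<^sub>R x \<in> VK K"
  and VK_neg: "x \<in> VK K \<Longrightarrow> - x \<in> VK K"
  and VK_zero: "0 \<in> VK K"
  by (simp_all add: VK_def span_add span_diff span_scale span_neg span_zero)

lemma VK_mono: "K \<subseteq> K' \<Longrightarrow> VK K \<subseteq> VK K'" by (simp add: VK_def span_mono image_mono)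

lemma VK_co: assumes "K \<subseteq> S" "x \<in> VK K" "r \<in> S - K" shows "co r x = 0"
  using assms(2) unfolding VK_def
proof (induction rule: span_induct_alt)
  case base
  show ?case using co_zero assms by auto
next
  case (step c x y)
  then obtain s where s: "s \<in> K" "x = \<alpha> s" by blast
  then have "s \<in> S" "r \<in> S" "r \<noteq> s" using assms by auto
  then show ?case using step s by (simp add: co_add co_scale co_\<alpha>)
qed

lemma VK_expand: assumes "K \<subseteq> S" "x \<in> VK K" shows "x = (\<Sum>r\<in>K. co r x *\<^sub>R \<alpha> r)"
  using assms(2) unfolding VK_def
proof (induction rule: span_induct_alt)
  case base
  have "(\<Sum>r\<in>K. co r 0 *\<^sub>R \<alpha> r) = (\<Sum>r\<in>K. 0)" using assms(1) co_zero by (intro sum.cong) auto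
  then show ?case by simp
next
  case (step c x y)
  then obtain s where s: "s \<in> K" "x = \<alpha> s" by blast
  have fK: "finite K" using finS assms(1) finite_subset by blast
  have "(\<Sum>r\<in>K. co r (c *\<^sub>R x + y) *\<^sub>R \<alpha> r)
      = (\<Sum>r\<in>K. (if r = s then c *\<^sub>R \<alpha> s else 0) + co r y *\<^sub>R \<alpha> r)"
    using assms(1) s by (intro sum.cong) (auto simp: co_add co_scale co_\<alpha> subset_iff scaleR_add_left)
  also have "\<dots> = c *\<^sub>R x + y" using fK s step by (simp add: sum.distrib)
  finally show ?case by simp
qed

lemma PK_VK: assumes "K \<subseteq> S" "\<beta> \<in> PK K" shows "\<beta> \<in> VK K"
proof -
  have "\<beta> = (\<Sum>r\<in>S. co r \<beta> *\<^sub>R \<alpha> r)" using assms P_exp by (simp add: PK_def)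
  also have "\<dots> = (\<Sum>r\<in>K. co r \<beta> *\<^sub>R \<alpha> r)"
    using assms finS by (intro sum.mono_neutral_right) (auto simp: PK_def)
  finally have e: "\<beta> = (\<Sum>r\<in>K. co r \<beta> *\<^sub>R \<alpha> r)" .
  have "(\<Sum>r\<in>K. co r \<beta> *\<^sub>R \<alpha> r) \<in> VK K"
    unfolding VK_def by (intro span_sum span_scale span_base) auto
  then show ?thesis using e by simp
qed

lemma P_VK_PK: "K \<subseteq> S \<Longrightarrow> \<beta> \<in> P \<Longrightarrow> \<beta> \<in> VK K \<Longrightarrow> \<beta> \<in> PK K"
  using VK_co by (auto simp: PK_def)

lemma sr_VK: "s \<in> K \<Longrightarrow> x \<in> VK K \<Longrightarrow> sr s x \<in> VK K"
  by (simp add: sr_eq VK_diff VK_scale \<alpha>_VK)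

lemma act_VK: "set u \<subseteq> K \<Longrightarrow> x \<in> VK K \<Longrightarrow> act u x \<in> VK K"
  by (induction u) (auto simp: sr_VK)

lemma act_diff_VK: "set u \<subseteq> K \<Longrightarrow> act u x - x \<in> VK K"
proof (induction u)
  case (Cons s u)
  have "act (s # u) x - x = (act u x - x) - cf s (act u x) *\<^sub>R \<alpha> s" by (simp add: sr_eq)
  moreover have "act u x - x \<in> VK K" "s \<in> K" using Cons by auto
  ultimately show ?case by (simp only: VK_diff VK_scale \<alpha>_VK)
qed (simp add: VK_zero)

lemma refl_PK: assumes "K \<subseteq> S" "s \<in> K" "\<beta> \<in> PK K" "\<beta> \<noteq> \<alpha> s" shows "sr s \<beta> \<in> PK K"
proof (rule P_VK_PK[OF assms(1)])
  show "sr s \<beta> \<in> P" using assms refl_P PK_P by blast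
  show "sr s \<beta> \<in> VK K" using assms sr_VK PK_VK by blast
qed

lemma \<tau>_PK: "K \<subseteq> S \<Longrightarrow> s \<in> K \<Longrightarrow> \<beta> \<in> PK K \<Longrightarrow> \<tau> s \<beta> \<in> PK K"
  by (auto simp: \<tau>_def refl_PK)

lemma N_support: "set u \<subseteq> K \<Longrightarrow> K \<subseteq> S \<Longrightarrow> \<gamma> \<in> P \<Longrightarrow> N u \<gamma> > 0 \<Longrightarrow> \<gamma> \<in> PK K"
proof (induction u arbitrary: \<gamma>)
  case (Cons s u)
  then have s: "s \<in> K" "s \<in> S" by auto
  show ?case
  proof (cases "\<gamma> = \<alpha> s")
    case True
    then show ?thesis using \<alpha>_PK s Cons.prems by simp
  next
    case False
    then have "N u (\<tau> s \<gamma>) > 0" using Cons.prems by simp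
    then have "\<tau> s \<gamma> \<in> PK K" using Cons \<tau>_P s by simp
    from \<tau>_PK[OF Cons.prems(2) s(1) this] show ?thesis using \<tau>_inv[OF s(2) Cons.prems(3)] by simp
  qed
qed simp

lemma N_notin_PK: "set u \<subseteq> K \<Longrightarrow> K \<subseteq> S \<Longrightarrow> \<gamma> \<in> P \<Longrightarrow> \<gamma> \<notin> PK K \<Longrightarrow> N u \<gamma> = 0"
  using N_support[of u K \<gamma>] by (cases "N u \<gamma>") auto

text \<open>The root inverted by the last letter of a red word was not inverted before, so it is
  reached without a change of sign.\<close>

lemma act_red_P: assumes "set (u @ [q]) \<subseteq> S" "red (u @ [q])" shows "act u (\<alpha> q) \<in> P"
proof -
  have S: "set (rev u) \<subseteq> S" "\<alpha> q \<in> P" using assms(1) \<alpha>_P by auto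
  let ?\<beta> = "fold \<tau> (rev u) (\<alpha> q)"
  have bP: "?\<beta> \<in> P" using fold_\<tau>_P[OF S] .
  have f: "fold \<tau> u ?\<beta> = \<alpha> q" using fold_rev_\<tau>[OF S] by simp
  have "N (u @ [q]) ?\<beta> \<le> 1" using assms(2) bP unfolding red_def by blast
  then have "N u ?\<beta> = 0" unfolding N_append f by simp
  then have "act u (fold \<tau> u ?\<beta>) = ?\<beta>" using N_zero_act bP assms(1) by simp
  then show ?thesis using bP f by simp
qed

lemma orth_commute: assumes "s \<in> S" "t \<in> S" "s \<noteq> t" "\<alpha> s \<bullet> \<alpha> t = 0"
  shows "[s, t] \<approx>\<^sub>b [t, s]" "sr s (sr t x) = sr t (sr s x)" "sr s (\<alpha> t) = \<alpha> t" "sr t (\<alpha> s) = \<alpha> s"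
proof -
  have c: "cf s (\<alpha> t) = 0" "cf t (\<alpha> s) = 0" using assms(4) by (auto simp: cf_def inner_commute)
  then show f: "sr s (\<alpha> t) = \<alpha> t" "sr t (\<alpha> s) = \<alpha> s" by (auto simp: sr_eq)
  have cc: "cf s (\<alpha> t) = 0 \<Longrightarrow> cf s (x - a *\<^sub>R \<alpha> t) = cf s x" for s t a x
    by (simp add: cf_def inner_diff_left diff_divide_distrib)
  have co: "sr s (sr t x) = sr t (sr s x)" for x
    using c cc by (simp add: sr_eq)
  then show "sr s (sr t x) = sr t (sr s x)" .
  have "act (alt s t 2) = act (alt t s 2)" using co by (auto simp: numeral_2_eq_2)
  then have "m s t dvd 2" using m_dvd assms by blast
  then have "m s t = 2" using m_ge2[OF assms(1-3)] dvd_imp_le[of "m s t" 2] by simp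
  then show "[s, t] \<approx>\<^sub>b [t, s]" using beq_braid[OF assms(1-3)] by (simp add: numeral_2_eq_2)
qed

subsection \<open>Euler forms and sortable words\<close>

text \<open>The symmetrization is prescribed on the span of the simple roots, which need not be the
  whole space.\<close>

definition form :: "('v \<Rightarrow> 'v \<Rightarrow> real) \<Rightarrow> bool" where
  "form E \<longleftrightarrow> bilinear E \<and> (\<forall>x\<in>VK S. \<forall>y\<in>VK S. E x y + E y x = x \<bullet> y)"

text \<open>A Coxeter element \<open>c\<close> of the parabolic subgroup on \<open>K\<close> is encoded by its Euler form \<open>E\<close>: for
  \<open>a\<close> before \<open>b\<close> in \<open>c\<close>, \<open>E (\<alpha> a) (\<alpha> b) = 0\<close> and \<open>E (\<alpha> b) (\<alpha> a) = \<alpha> a \<bullet> \<alpha> b\<close>. Passing from \<open>c\<close> to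
  \<open>s c s\<close> is then just transport of \<open>E\<close> along \<open>s\<close>, and restriction to a parabolic subgroup does not
  change \<open>E\<close>.\<close>

definition rots :: "'a list \<Rightarrow> ('v \<Rightarrow> 'v \<Rightarrow> real) \<Rightarrow> ('v \<Rightarrow> 'v \<Rightarrow> real)" where
  "rots u E = (\<lambda>x y. E (act u x) (act u y))"

abbreviation rot :: "'a \<Rightarrow> ('v \<Rightarrow> 'v \<Rightarrow> real) \<Rightarrow> ('v \<Rightarrow> 'v \<Rightarrow> real)" where
  "rot s \<equiv> rots [s]"

lemma rot_eq: "rot s E x y = E (sr s x) (sr s y)" by (simp add: rots_def)

lemma rots_rots: "rots v (rots u E) = rots (u @ v) E"
  by (simp add: rots_def act_append)

lemma rots_Nil: "rots [] E = E" by (simp add: rots_def)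

lemma rots_cong: "act u = act v \<Longrightarrow> rots u E = rots v E" by (simp add: rots_def)

lemma form_rots: assumes "form E" "set u \<subseteq> S" shows "form (rots u E)"
  unfolding form_def
proof
  have b: "bilinear E" using assms by (simp add: form_def)
  show "bilinear (rots u E)"
    unfolding bilinear_def rots_def
  proof (intro conjI allI)
    fix x show "linear (\<lambda>y. E (act u x) (act u y))"
      using linear_compose[OF act_lin[of u], of "E (act u x)"] b by (simp add: bilinear_def o_def)
  next
    fix y show "linear (\<lambda>x. E (act u x) (act u y))"
      using linear_compose[OF act_lin[of u], of "\<lambda>x. E x (act u y)"] b by (simp add: bilinear_def o_def)
  qed
  show "\<forall>x\<in>VK S. \<forall>y\<in>VK S. rots u E x y + rots u E y x = x \<bullet> y"
    using assms act_VK[of u S] by (simp add: form_def rots_def act_inner)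
qed

lemma form_rot: "form E \<Longrightarrow> s \<in> S \<Longrightarrow> form (rot s E)"
  using form_rots by simp

lemma form_sym: "form E \<Longrightarrow> x \<in> VK S \<Longrightarrow> y \<in> VK S \<Longrightarrow> E x y + E y x = x \<bullet> y"
  by (simp add: form_def)

lemma form_lin: assumes "form E"
  shows "E (x + y) z = E x z + E y z" "E z (x + y) = E z x + E z y"
    "E (x - y) z = E x z - E y z" "E z (x - y) = E z x - E z y"
    "E (c *\<^sub>R x) z = c * E x z" "E z (c *\<^sub>R x) = c * E z x"
    "E (- x) z = - E x z" "E z (- x) = - E z x" "E 0 z = 0" "E z 0 = 0"
  using assms unfolding form_def
  by (auto simp: bilinear_ladd bilinear_radd bilinear_lsub bilinear_rsub bilinear_lmul bilinear_rmul
      bilinear_lneg bilinear_rneg bilinear_lzero bilinear_rzero)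

lemma form_self: "form E \<Longrightarrow> s \<in> S \<Longrightarrow> E (\<alpha> s) (\<alpha> s) = (\<alpha> s \<bullet> \<alpha> s) / 2"
  using form_sym[of E "\<alpha> s" "\<alpha> s"] \<alpha>_VK by auto

text \<open>In terms of \<open>c\<close>: the letter \<open>s\<close> comes before all letters of
  \<open>K\<close> that are not orthogonal to it, so commutations bring it to the front.\<close>

definition init :: "'a \<Rightarrow> 'a set \<Rightarrow> ('v \<Rightarrow> 'v \<Rightarrow> real) \<Rightarrow> bool" where
  "init s K E \<longleftrightarrow> s \<in> K \<and> (\<forall>r\<in>K - {s}. E (\<alpha> s) (\<alpha> r) = 0)"

definition final :: "'a \<Rightarrow> 'a set \<Rightarrow> ('v \<Rightarrow> 'v \<Rightarrow> real) \<Rightarrow> bool" where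
  "final s K E \<longleftrightarrow> s \<in> K \<and> (\<forall>r\<in>K - {s}. E (\<alpha> r) (\<alpha> s) = 0)"

lemma init_subset: "init s K E \<Longrightarrow> s \<in> K' \<Longrightarrow> K' \<subseteq> K \<Longrightarrow> init s K' E"
  by (auto simp: init_def)

text \<open>The values of \<open>E (\<alpha> s)\<close> on simple roots, extended linearly. Its use
  is the sign: on positive roots of the subsystem this functional is nonnegative.\<close>

lemma init_form: assumes "form E" "K \<subseteq> S" "init s K E" "b \<in> VK K"
  shows "E (\<alpha> s) b = co s b * (\<alpha> s \<bullet> \<alpha> s) / 2"
  using assms(4) unfolding VK_def
proof (induction rule: span_induct_alt)
  case base
  then show ?case using assms co_zero by (auto simp: form_lin init_def)
next
  case (step c x y)
  then obtain r where r: "r \<in> K" "x = \<alpha> r" by blast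
  have sS: "s \<in> S" "r \<in> S" using assms r by (auto simp: init_def)
  show ?case
  proof (cases "r = s")
    case True
    then show ?thesis using step r assms sS form_self[OF assms(1), of s]
      by (simp add: form_lin co_add co_scale co_\<alpha> field_simps)
  next
    case False
    then have "E (\<alpha> s) (\<alpha> r) = 0" using assms r by (auto simp: init_def)
    then show ?thesis using step r assms sS False
      by (simp add: form_lin co_add co_scale co_\<alpha> field_simps)
  qed
qed

lemma final_form: assumes "form E" "K \<subseteq> S" "final s K E" "b \<in> VK K"
  shows "E b (\<alpha> s) = co s b * (\<alpha> s \<bullet> \<alpha> s) / 2"
proof -
  have sS: "s \<in> S" using assms by (auto simp: final_def)
  have i: "init s K (\<lambda>x y. E y x)" using assms by (auto simp: init_def final_def)
  have f: "form (\<lambda>x y. E y x)" using assms(1) unfolding form_def bilinear_def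
    by (simp add: inner_commute)
  show ?thesis using init_form[OF f assms(2) i assms(4)] .
qed

text \<open>As \<open>s\<close> is initial, \<open>E (\<alpha> a) (\<alpha> s)\<close> is the full
  inner product, and the two correction terms of the reflection cancel. In terms of
  \<open>c\<close>: the order of the other letters is unchanged.\<close>

lemma rot_pair: assumes "form E" "K \<subseteq> S" "init s K E" "a \<in> K - {s}" "b \<in> K - {s}"
  shows "rot s E (\<alpha> a) (\<alpha> b) = E (\<alpha> a) (\<alpha> b)"
proof -
  have S: "s \<in> S" "a \<in> S" "b \<in> S" using assms by (auto simp: init_def)
  have sb: "E (\<alpha> s) (\<alpha> b) = 0" using assms by (auto simp: init_def)
  have sa: "E (\<alpha> s) (\<alpha> a) = 0" using assms by (auto simp: init_def)
  have as: "E (\<alpha> a) (\<alpha> s) = \<alpha> a \<bullet> \<alpha> s"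
    using form_sym[OF assms(1), of "\<alpha> a" "\<alpha> s"] S \<alpha>_VK sa by simp
  have "rot s E (\<alpha> a) (\<alpha> b) = E (\<alpha> a) (\<alpha> b) - cf s (\<alpha> b) * (\<alpha> a \<bullet> \<alpha> s)
      + cf s (\<alpha> b) * (cf s (\<alpha> a) * (\<alpha> s \<bullet> \<alpha> s)) / 2"
    by (simp add: rot_eq sr_eq form_lin[OF assms(1)] sb as form_self[OF assms(1) S(1)] algebra_simps)
  then show ?thesis using cf_inner[OF S(1), of "\<alpha> a"] by simp
qed

text \<open>Passing from \<open>c\<close> to \<open>s c s\<close> moves \<open>s\<close> from the
  front to the end.\<close>

lemma rot_final: assumes "form E" "K \<subseteq> S" "init s K E" shows "final s K (rot s E)"
  unfolding final_def
proof (intro conjI ballI)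
  show "s \<in> K" using assms by (simp add: init_def)
  fix r assume r: "r \<in> K - {s}"
  have S: "s \<in> S" "r \<in> S" using assms r by (auto simp: init_def)
  have "E (\<alpha> s) (\<alpha> r) = 0" using assms r by (auto simp: init_def)
  then have rs: "E (\<alpha> r) (\<alpha> s) = \<alpha> r \<bullet> \<alpha> s"
    using form_sym[OF assms(1), of "\<alpha> r" "\<alpha> s"] S \<alpha>_VK by simp
  have "rot s E (\<alpha> r) (\<alpha> s) = - (\<alpha> r \<bullet> \<alpha> s) + cf s (\<alpha> r) * (\<alpha> s \<bullet> \<alpha> s) / 2"
    unfolding rot_eq sr_self unfolding sr_eq
    by (simp add: form_lin[OF assms(1)] rs form_self[OF assms(1) S(1)])
  then show "rot s E (\<alpha> r) (\<alpha> s) = 0" using cf_inner[OF S(1), of "\<alpha> r"] by simp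
qed

text \<open>Acyclicity of the orientation given by \<open>E\<close>: repeatedly choosing an initial
  letter orders \<open>K\<close>. Quantifying over subsets builds in restriction to parabolic
  subgroups.\<close>

definition Cox :: "'a set \<Rightarrow> ('v \<Rightarrow> 'v \<Rightarrow> real) \<Rightarrow> bool" where
  "Cox K E \<longleftrightarrow> (\<forall>K'\<subseteq>K. K' \<noteq> {} \<longrightarrow> (\<exists>s. init s K' E))"

lemma Cox_subset: "Cox K E \<Longrightarrow> K' \<subseteq> K \<Longrightarrow> Cox K' E"
  unfolding Cox_def by (meson subset_trans)

lemma Cox_rot: assumes "form E" "K \<subseteq> S" "init s K E" shows "Cox K (rot s E) \<longleftrightarrow> Cox K E"
proof
  assume c: "Cox K E"
  show "Cox K (rot s E)" unfolding Cox_def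
  proof (intro allI impI)
    fix K' assume K': "K' \<subseteq> K" "K' \<noteq> {}"
    show "\<exists>t. init t K' (rot s E)"
    proof (cases "K' = {s}")
      case True
      then show ?thesis by (auto simp: init_def)
    next
      case False
      then have "K' - {s} \<noteq> {}" using K' by auto
      then obtain t where t: "init t (K' - {s}) E" using c K' unfolding Cox_def by blast
      have "init t K' (rot s E)" unfolding init_def
      proof (intro conjI ballI)
        show "t \<in> K'" using t by (auto simp: init_def)
        fix r assume r: "r \<in> K' - {t}"
        show "rot s E (\<alpha> t) (\<alpha> r) = 0"
        proof (cases "r = s")
          case True
          then show ?thesis using rot_final[OF assms] t K' by (auto simp: final_def init_def)
        next
          case False
          then show ?thesis using rot_pair[OF assms, of t r] t r K' by (auto simp: init_def)
        qed
      qed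
      then show ?thesis by blast
    qed
  qed
next
  assume c: "Cox K (rot s E)"
  show "Cox K E" unfolding Cox_def
  proof (intro allI impI)
    fix K' assume K': "K' \<subseteq> K" "K' \<noteq> {}"
    show "\<exists>t. init t K' E"
    proof (cases "s \<in> K'")
      case True
      then show ?thesis using init_subset[OF assms(3)] K' by blast
    next
      case False
      obtain t where t: "init t K' (rot s E)" using c K' unfolding Cox_def by blast
      have "init t K' E" unfolding init_def
      proof (intro conjI ballI)
        show "t \<in> K'" using t by (auto simp: init_def)
        fix r assume r: "r \<in> K' - {t}"
        show "E (\<alpha> t) (\<alpha> r) = 0"
          using rot_pair[OF assms, of t r] t r K' False by (auto simp: init_def)
      qed
      then show ?thesis by blast
    qed
  qed
qed

text \<open>A skipped letter is never used again: this is the decrease of the blocks of the sorting word.\<close>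

inductive Srt :: "'a set \<Rightarrow> ('v \<Rightarrow> 'v \<Rightarrow> real) \<Rightarrow> 'a list \<Rightarrow> bool" where
  nil: "Cox K E \<Longrightarrow> Srt K E []"
| "use": "init s K E \<Longrightarrow> Srt K (rot s E) w \<Longrightarrow> Srt K E (s # w)"
| skip: "init s K E \<Longrightarrow> Srt (K - {s}) E w \<Longrightarrow> Srt K E w"

lemma Srt_set: "Srt K E w \<Longrightarrow> set w \<subseteq> K"
  by (induction rule: Srt.induct) (auto simp: init_def)

lemma init_in: "init s K E \<Longrightarrow> K \<subseteq> S \<Longrightarrow> s \<in> S" by (auto simp: init_def)

lemma Srt_Cox: "Srt K E w \<Longrightarrow> form E \<Longrightarrow> K \<subseteq> S \<Longrightarrow> Cox K E"
proof (induction rule: Srt.induct)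
  case (use s K E w)
  then show ?case using Cox_rot[of E K s] form_rot init_in by blast
next
  case (skip s K E w)
  then have c: "Cox (K - {s}) E" by blast
  show ?case unfolding Cox_def
  proof (intro allI impI)
    fix K' assume K': "K' \<subseteq> K" "K' \<noteq> {}"
    show "\<exists>t. init t K' E"
    proof (cases "s \<in> K'")
      case True
      then show ?thesis using init_subset[OF skip.hyps(1)] K' by blast
    next
      case False
      then have "K' \<subseteq> K - {s}" using K' by blast
      then show ?thesis using c K' unfolding Cox_def by blast
    qed
  qed
qed

lemma Srt_prefix: "Srt K E z \<Longrightarrow> form E \<Longrightarrow> K \<subseteq> S \<Longrightarrow> z = w @ v \<Longrightarrow> Srt K E w"
proof (induction arbitrary: w v rule: Srt.induct)
  case (nil K E)
  then show ?case using Srt.nil by simp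
next
  case (use s K E z)
  have Srt: "Srt K E (s # z)" using Srt.use use by blast
  show ?case
  proof (cases w)
    case Nil
    then show ?thesis using Srt.nil Srt_Cox[OF Srt] use by blast
  next
    case (Cons a w')
    have "Srt K (rot s E) w'"
      by (rule use.IH[of w' v]) (use use.prems use.hyps Cons form_rot init_in in auto)
    then show ?thesis using Srt.use[OF use.hyps(1)] use.prems Cons by simp
  qed
next
  case (skip s K E z)
  have "K - {s} \<subseteq> S" using skip.prems by blast
  from skip.IH[OF skip.prems(1) this skip.prems(3)] show ?case by (rule Srt.skip[OF skip.hyps(1)])
qed

lemma Srt_restrict: "Srt K E w \<Longrightarrow> form E \<Longrightarrow> K \<subseteq> S \<Longrightarrow> set w \<subseteq> K' \<Longrightarrow> K' \<subseteq> K \<Longrightarrow> Srt K' E w"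
proof (induction arbitrary: K' rule: Srt.induct)
  case (nil K E)
  then show ?case using Srt.nil Cox_subset by blast
next
  case (use s K E w)
  have "Srt K' (rot s E) w"
    by (rule use.IH) (use use.prems use.hyps form_rot init_in in auto)
  moreover have "init s K' E" using init_subset[OF use.hyps(1)] use.prems by auto
  ultimately show ?case using Srt.use by blast
next
  case (skip s K E w)
  have w: "set w \<subseteq> K - {s}" using Srt_set skip.hyps(2) by blast
  have "Srt (K' - {s}) E w"
    by (rule skip.IH) (use skip.prems w in auto)
  then show ?case using Srt.skip[of s K' E w] init_subset[OF skip.hyps(1), of K'] skip.prems by (cases "s \<in> K'") auto
qed

definition agree :: "'a set \<Rightarrow> ('v \<Rightarrow> 'v \<Rightarrow> real) \<Rightarrow> ('v \<Rightarrow> 'v \<Rightarrow> real) \<Rightarrow> bool" where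
  "agree K E F \<longleftrightarrow> (\<forall>a\<in>K. \<forall>b\<in>K. E (\<alpha> a) (\<alpha> b) = F (\<alpha> a) (\<alpha> b))"

lemma agree_VK: assumes "form E" "form F" "agree K E F" "x \<in> VK K" "y \<in> VK K" shows "E x y = F x y"
proof (rule bilinear_eq[of E F "VK K" "\<alpha> ` K" "VK K" "\<alpha> ` K"])
  show "bilinear E" "bilinear F" using assms by (auto simp: form_def)
  fix x y assume "x \<in> \<alpha> ` K" "y \<in> \<alpha> ` K"
  then show "E x y = F x y" using assms(3) by (auto simp: agree_def)
qed (use assms in \<open>auto simp: VK_def\<close>)

lemma agree_rot: assumes "form E" "form F" "agree K E F" "s \<in> K" shows "agree K (rot s E) (rot s F)"
  unfolding agree_def rot_eq
proof (intro ballI)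
  fix a b assume "a \<in> K" "b \<in> K"
  then have "sr s (\<alpha> a) \<in> VK K" "sr s (\<alpha> b) \<in> VK K" using assms(4) sr_VK \<alpha>_VK by blast+
  then show "E (sr s (\<alpha> a)) (sr s (\<alpha> b)) = F (sr s (\<alpha> a)) (sr s (\<alpha> b))" using agree_VK[OF assms(1-3)] by blast
qed

lemma init_agree: "agree K E F \<Longrightarrow> init s K E \<Longrightarrow> init s K F"
  by (auto simp: agree_def init_def)

lemma agree_subset: "agree K E F \<Longrightarrow> K' \<subseteq> K \<Longrightarrow> agree K' E F"
  unfolding agree_def by blast

text \<open>Lets \<open>E\<close> and \<open>rot s E\<close> be interchanged once \<open>s\<close>
  has left the set of letters, as they agree on the remaining simple roots.\<close>

lemma Srt_cong: "Srt K E w \<Longrightarrow> form E \<Longrightarrow> form F \<Longrightarrow> K \<subseteq> S \<Longrightarrow> agree K E F \<Longrightarrow> Srt K F w"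
proof (induction arbitrary: F rule: Srt.induct)
  case (nil K E)
  have "Cox K F" unfolding Cox_def
  proof (intro allI impI)
    fix K' assume K': "K' \<subseteq> K" "K' \<noteq> {}"
    then obtain s where "init s K' E" using nil unfolding Cox_def by blast
    then show "\<exists>s. init s K' F" using init_agree agree_subset nil K' by blast
  qed
  then show ?case by (rule Srt.nil)
next
  case (use s K E w)
  have s: "s \<in> K" "s \<in> S" using use by (auto simp: init_def)
  have "Srt K (rot s F) w"
    by (rule use.IH) (use use.prems form_rot s agree_rot in auto)
  then show ?case using Srt.use init_agree use by blast
next
  case (skip s K E w)
  have "Srt (K - {s}) F w"
    by (rule skip.IH) (use skip.prems agree_subset in auto)
  then show ?case using Srt.skip init_agree skip by blast
qed

text \<open>For two initial letters \<open>E\<close> vanishes in both orders, so by symmetrization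
  their roots are orthogonal.\<close>

lemma init_orth: assumes "form E" "K \<subseteq> S" "init s K E" "init t K E" "s \<noteq> t"
  shows "\<alpha> s \<bullet> \<alpha> t = 0" "init s K (rot t E)" "rot s (rot t E) = rot t (rot s E)"
proof -
  have S: "s \<in> S" "t \<in> S" "s \<in> K" "t \<in> K" using assms by (auto simp: init_def)
  have E0: "E (\<alpha> s) (\<alpha> t) = 0" "E (\<alpha> t) (\<alpha> s) = 0" using assms by (auto simp: init_def)
  then show o: "\<alpha> s \<bullet> \<alpha> t = 0"
    using form_sym[OF assms(1), of "\<alpha> s" "\<alpha> t"] S \<alpha>_VK by simp
  note oc = orth_commute[OF S(1,2) assms(5) o]
  show "init s K (rot t E)" unfolding init_def
  proof (intro conjI ballI)
    fix r assume r: "r \<in> K - {s}"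
    show "rot t E (\<alpha> s) (\<alpha> r) = 0"
    proof (cases "r = t")
      case True
      then show ?thesis using E0 by (simp add: rot_eq oc sr_self form_lin[OF assms(1)])
    next
      case False
      then show ?thesis using rot_pair[OF assms(1,2,4), of s r] r assms S by (auto simp: init_def)
    qed
  qed (use S in simp)
  show "rot s (rot t E) = rot t (rot s E)" by (simp add: fun_eq_iff rot_eq oc(2))
qed

text \<open>Any other initial letter is orthogonal to \<open>s\<close>, so the decision about
  \<open>s\<close> can be made first at the cost of commutations. This frees later recursions to
  choose the initial letter.\<close>

lemma Srt_canonical: "Srt K E w \<Longrightarrow> form E \<Longrightarrow> K \<subseteq> S \<Longrightarrow> init s K E \<Longrightarrow>
    (\<exists>w'. w \<approx>\<^sub>b s # w' \<and> Srt K (rot s E) w') \<or> Srt (K - {s}) E w"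
proof (induction rule: Srt.induct)
  case (nil K E)
  then show ?case using Srt.nil Cox_subset[of K E "K - {s}"] by auto
next
  case (use t K E w)
  show ?case
  proof (cases "t = s")
    case True
    then show ?thesis using use beq_refl by blast
  next
    case False
    have t: "t \<in> S" "s \<in> S" using use init_in by blast+
    note io = init_orth[OF use.prems(1,2,3) use.hyps(1) False[symmetric]]
    note io' = init_orth[OF use.prems(1,2) use.hyps(1) use.prems(3) False]
    from use.IH[OF form_rot[OF use.prems(1) t(1)] use.prems(2) io(2)]
    show ?thesis
    proof
      assume "\<exists>w'. w \<approx>\<^sub>b s # w' \<and> Srt K (rot s (rot t E)) w'"
      then obtain w' where w': "w \<approx>\<^sub>b s # w'" "Srt K (rot t (rot s E)) w'" using io(3) by auto
      have "Srt K (rot s E) (t # w')" using Srt.use[OF io'(2) w'(2)] .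
      moreover have "t # s # w' \<approx>\<^sub>b s # t # w'"
        using beq_append[OF orth_commute(1)[OF t(1,2) False io'(1)] beq_refl[of w']] by simp
      then have "t # w \<approx>\<^sub>b s # t # w'" using beq_trans[OF beq_Cons[OF w'(1)]] by blast
      ultimately show ?thesis by blast
    next
      assume "Srt (K - {s}) (rot t E) w"
      moreover have "init t (K - {s}) E" using init_subset[OF use.hyps(1)] use.hyps(1) False by (auto simp: init_def)
      ultimately show ?thesis using Srt.use by blast
    qed
  qed
next
  case (skip t K E w)
  show ?case
  proof (cases "t = s")
    case True
    then show ?thesis using skip by blast
  next
    case False
    note io' = init_orth[OF skip.prems(1,2) skip.hyps(1) skip.prems(3) False]
    have i1: "init s (K - {t}) E" using init_subset[OF skip.prems(3)] skip.prems(3) False by (auto simp: init_def)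
    have i2: "init t (K - {s}) E" using init_subset[OF skip.hyps(1)] skip.hyps(1) False by (auto simp: init_def)
    have "K - {t} \<subseteq> S" using skip by blast
    from skip.IH[OF skip.prems(1) this i1] show ?thesis
    proof
      assume "\<exists>w'. w \<approx>\<^sub>b s # w' \<and> Srt (K - {t}) (rot s E) w'"
      then show ?thesis using Srt.skip[OF io'(2)] by blast
    next
      assume "Srt (K - {t} - {s}) E w"
      moreover have "K - {t} - {s} = K - {s} - {t}" by blast
      ultimately show ?thesis using Srt.skip[OF i2] by auto
    qed
  qed
qed

text \<open>The additional letters are skipped as they become initial. The word may change by
  commutations, since the derivation over \<open>K'\<close> need not meet its letters in the order
  used for \<open>K\<close>.\<close>

lemma Srt_weaken: "form E \<Longrightarrow> K \<subseteq> S \<Longrightarrow> Cox K E \<Longrightarrow> K' \<subseteq> K \<Longrightarrow> Srt K' E w \<Longrightarrow>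
    \<exists>w'. w' \<approx>\<^sub>b w \<and> Srt K E w'"
proof (induction "length w + card K" arbitrary: w K K' E rule: less_induct)
  case less
  show ?case
  proof (cases "K = {}")
    case True
    then have "K' = K" using less.prems(4) by simp
    then show ?thesis using less.prems(5) by (intro exI[of _ w]) simp
  next
    case False
    then obtain s where s: "init s K E" using less.prems(3) unfolding Cox_def by blast
    have sS: "s \<in> S" "s \<in> K" using s less.prems by (auto simp: init_def)
    have fK: "finite K" using finite_subset[OF less.prems(2) finS] .
    have lc: "length w + card (K - {s}) < length w + card K"
      using card_Diff1_less[OF fK sS(2)] by simp
    have sk: "\<exists>w'. w' \<approx>\<^sub>b w \<and> Srt K E w'" if "Srt K'' E w" "K'' \<subseteq> K - {s}" for K''
    proof -
      have "K - {s} \<subseteq> S" using less.prems by blast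
      from less.hyps[OF lc less.prems(1) this Cox_subset[OF less.prems(3) Diff_subset] that(2,1)]
      show ?thesis using Srt.skip[OF s] by blast
    qed
    show ?thesis
    proof (cases "s \<in> K'")
      case True
      have i: "init s K' E" using init_subset[OF s True less.prems(4)] .
      have "K' \<subseteq> S" using less.prems by blast
      from Srt_canonical[OF less.prems(5,1) this i] show ?thesis
      proof
        assume "\<exists>w'. w \<approx>\<^sub>b s # w' \<and> Srt K' (rot s E) w'"
        then obtain w1 where w1: "w \<approx>\<^sub>b s # w1" "Srt K' (rot s E) w1" by blast
        have "length w1 + card K < length w + card K" using beq_length[OF w1(1)] by simp
        from less.hyps[OF this form_rot[OF less.prems(1) sS(1)] less.prems(2) _ less.prems(4) w1(2)]
        obtain w2 where w2: "w2 \<approx>\<^sub>b w1" "Srt K (rot s E) w2"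
          using Cox_rot[OF less.prems(1,2) s] less.prems(3) by blast
        have "s # w2 \<approx>\<^sub>b w" using beq_trans[OF beq_Cons[OF w2(1)] beq_sym[OF w1(1)]] .
        then show ?thesis using Srt.use[OF s w2(2)] by blast
      next
        assume "Srt (K' - {s}) E w"
        then show ?thesis using sk less.prems(4) by blast
      qed
    next
      case False
      then show ?thesis using sk[OF less.prems(5)] less.prems(4) by blast
    qed
  qed
qed

subsection \<open>Aligned functions\<close>

text \<open>The skew part of the Euler form; its sign tells which of two roots comes first in the
  order given by \<open>c\<close>.\<close>

definition om :: "('v \<Rightarrow> 'v \<Rightarrow> real) \<Rightarrow> 'v \<Rightarrow> 'v \<Rightarrow> real" where
  "om E x y = E x y - E y x"

text \<open>In a rank-two subsystem whose roots are listed in the order given by \<open>c\<close>, the inversion function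
  of a sortable element is \<open>q+1, ..., q+1, x, q, ..., q\<close> with \<open>x > q\<close>, or \<open>0, ..., 0, x\<close>; \<open>T\<close> is what
  remains of this pattern at three of the roots. Reading an initial letter rotates the pattern.\<close>

definition T :: "nat \<Rightarrow> nat \<Rightarrow> nat \<Rightarrow> bool" where
  "T a b d \<longleftrightarrow> a = b \<and> b \<le> d \<or> a = d + 1 \<and> a \<le> b \<or> b = d \<and> d \<le> a"

text \<open>Reading an initial \<open>s\<close> lowers the count at \<open>\<alpha> s\<close> by one
  and sends this root from the first to the last place.\<close>

lemma T_rotate: "T (Suc a) b d \<longleftrightarrow> T b d a"
  unfolding T_def by linarith

lemma T_zero: "T 0 b d \<Longrightarrow> b = 0" and T_mid: "T a 0 d \<Longrightarrow> a = 0 \<or> d = 0"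
  unfolding T_def by linarith+

text \<open>The pattern is tested on triples with the middle root a positive combination of the
  outer two, not on whole rank-two subsystems, so that it restricts to smaller \<open>K\<close> at
  once. If \<open>om\<close> vanishes, both orders of the outer roots are tested.\<close>

definition AL :: "'a set \<Rightarrow> ('v \<Rightarrow> 'v \<Rightarrow> real) \<Rightarrow> ('v \<Rightarrow> nat) \<Rightarrow> bool" where
  "AL K E f \<longleftrightarrow> (\<forall>d1\<in>PK K. \<forall>d2\<in>PK K. \<forall>p>0. \<forall>q>0. p *\<^sub>R d1 + q *\<^sub>R d2 \<in> PK K \<longrightarrow> om E d1 d2 \<ge> 0 \<longrightarrow>
     T (f d1) (f (p *\<^sub>R d1 + q *\<^sub>R d2)) (f d2))"

lemma ALD: "AL K E f \<Longrightarrow> d1 \<in> PK K \<Longrightarrow> d2 \<in> PK K \<Longrightarrow> p > 0 \<Longrightarrow> q > 0 \<Longrightarrow>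
    p *\<^sub>R d1 + q *\<^sub>R d2 \<in> PK K \<Longrightarrow> om E d1 d2 \<ge> 0 \<Longrightarrow> T (f d1) (f (p *\<^sub>R d1 + q *\<^sub>R d2)) (f d2)"
  unfolding AL_def by blast

lemma AL_subset: "AL K E f \<Longrightarrow> K' \<subseteq> K \<Longrightarrow> AL K' E f"
  unfolding AL_def using PK_mono by (meson subsetD)

lemma AL_cong: "AL K E f \<Longrightarrow> (\<And>\<beta>. \<beta> \<in> PK K \<Longrightarrow> f \<beta> = g \<beta>) \<Longrightarrow> AL K E g"
  unfolding AL_def by metis

text \<open>By symmetrization \<open>om E (\<alpha> s) d\<close> is
  \<open>2 * E (\<alpha> s) d - \<alpha> s \<bullet> d\<close>. The term at \<open>s\<close>
  cancels, and the others are nonnegative as distinct simple roots have nonpositive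
  products.\<close>

lemma om_init_nonneg: assumes "form E" "K \<subseteq> S" "init s K E" "d \<in> PK K"
  shows "om E (\<alpha> s) d \<ge> 0"
proof -
  have S: "s \<in> S" "s \<in> K" using assms by (auto simp: init_def)
  have dV: "d \<in> VK K" using PK_VK assms by blast
  then have dS: "d \<in> VK S" using VK_mono[OF assms(2)] by blast
  have "om E (\<alpha> s) d = 2 * E (\<alpha> s) d - \<alpha> s \<bullet> d"
    using form_sym[OF assms(1) \<alpha>_VK[OF S(1)] dS] by (simp add: om_def)
  also have "\<dots> = co s d * (\<alpha> s \<bullet> \<alpha> s) - \<alpha> s \<bullet> d" using init_form[OF assms(1-3) dV] by simp
  also have "\<alpha> s \<bullet> d = (\<Sum>r\<in>K. co r d * (\<alpha> s \<bullet> \<alpha> r))"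
    using VK_expand[OF assms(2) dV] by (metis (no_types, lifting) inner_scaleR_right inner_sum_right sum.cong)
  also have "\<dots> = co s d * (\<alpha> s \<bullet> \<alpha> s) + (\<Sum>r\<in>K - {s}. co r d * (\<alpha> s \<bullet> \<alpha> r))"
    using S finite_subset[OF assms(2) finS] by (simp add: sum.remove)
  finally have e: "om E (\<alpha> s) d = - (\<Sum>r\<in>K - {s}. co r d * (\<alpha> s \<bullet> \<alpha> r))" by simp
  have "(\<Sum>r\<in>K - {s}. co r d * (\<alpha> s \<bullet> \<alpha> r)) \<le> 0"
  proof (rule sum_nonpos)
    fix r assume "r \<in> K - {s}"
    then have "r \<in> S" "s \<noteq> r" using assms(2) by auto
    then show "co r d * (\<alpha> s \<bullet> \<alpha> r) \<le> 0"
      using \<alpha>_inner_le[OF S(1)] P_nn[OF PK_P[OF assms(4)]] by (simp add: mult_nonneg_nonpos)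
  qed
  then show ?thesis using e by simp
qed

text \<open>If \<open>om\<close> vanished, the \<open>s\<close>-coefficients of \<open>d\<close> and
  \<open>sr s d\<close> would be opposite, hence both zero, and \<open>d\<close> would be orthogonal
  to \<open>\<alpha> s\<close>. Reflecting the root in between would then give the coefficient
  \<open>- p\<close>.\<close>

lemma om_init_pos: assumes "form E" "K \<subseteq> S" "init s K E" "d \<in> PK K" "d \<noteq> \<alpha> s"
  and "p > 0" "q > 0" "p *\<^sub>R \<alpha> s + q *\<^sub>R d \<in> PK K"
  shows "om E (\<alpha> s) d > 0"
proof (rule ccontr)
  assume "\<not> om E (\<alpha> s) d > 0"
  then have o: "om E (\<alpha> s) d = 0" using om_init_nonneg[OF assms(1-4)] by simp
  have S: "s \<in> S" "s \<in> K" using assms by (auto simp: init_def)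
  have dV: "d \<in> VK K" using PK_VK assms by blast
  then have dS: "d \<in> VK S" using VK_mono[OF assms(2)] by blast
  have "2 * E (\<alpha> s) d = \<alpha> s \<bullet> d"
    using form_sym[OF assms(1) \<alpha>_VK[OF S(1)] dS] o by (simp add: om_def)
  then have "co s d * (\<alpha> s \<bullet> \<alpha> s) = \<alpha> s \<bullet> d" using init_form[OF assms(1-3) dV] by simp
  then have c: "cf s d = 2 * co s d" using cf_inner[OF S(1), of d] \<alpha>_norm[OF S(1)]
    by (metis inner_commute less_irrefl mult.assoc mult_right_cancel)
  have "sr s d \<in> P" using refl_PK[OF assms(2) S(2) assms(4,5)] PK_P by blast
  then have "co s (sr s d) \<ge> 0" using P_nn S by blast
  moreover have "co s (sr s d) = - co s d" using co_sr[OF S(1) S(1)] c by simp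
  ultimately have z: "co s d = 0" using P_nn[OF PK_P[OF assms(4)] S(1)] by simp
  then have c0: "cf s d = 0" using c by simp
  let ?b = "p *\<^sub>R \<alpha> s + q *\<^sub>R d"
  have "?b \<noteq> \<alpha> s"
  proof
    assume e: "?b = \<alpha> s"
    have "d = \<alpha> s"
    proof (rule P_simple[OF PK_P[OF assms(4)] S(1)])
      fix r assume r: "r \<in> S" "r \<noteq> s"
      have "co r ?b = co r (\<alpha> s)" using e by simp
      then show "co r d = 0" using r S assms(7) by (simp add: co_add co_scale co_\<alpha>)
    qed
    then show False using assms(5) by simp
  qed
  then have "sr s ?b \<in> P" using refl_PK[OF assms(2) S(2) assms(8)] PK_P by blast
  then have "co s (sr s ?b) \<ge> 0" using P_nn S by blast
  moreover have "sr s ?b = - p *\<^sub>R \<alpha> s + q *\<^sub>R d"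
    unfolding sr_add sr_scale sr_self using c0 by (simp add: sr_eq)
  then have "co s (sr s ?b) = - p" using z S by (simp add: co_add co_scale co_\<alpha> co_diff co_neg)
  ultimately show False using assms(6) by simp
qed

lemma om_rot: "om (rot s E) x y = om E (sr s x) (sr s y)"
  by (simp add: om_def rot_eq)

lemma om_swap: "om E y x = - om E x y" by (simp add: om_def)

lemma om_lin: assumes "form E"
  shows "om E x (a *\<^sub>R y + b *\<^sub>R z) = a * om E x y + b * om E x z" "om E x x = 0" "om E (- x) y = - om E x y"
    "om E x (- y) = - om E x y"
  by (simp_all add: om_def form_lin[OF assms] algebra_simps)

lemma N_Cons_ne: "\<beta> \<noteq> \<alpha> s \<Longrightarrow> N (s # v) \<beta> = N v (sr s \<beta>)"
  by (simp add: \<tau>_def)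

lemma N_Cons_self: "N (s # v) (\<alpha> s) = Suc (N v (\<alpha> s))"
  by (simp add: \<tau>_def)

text \<open>\<open>sr s\<close> carries triples to triples with the same order. If
  \<open>\<alpha> s\<close> is an outer root, it changes sign instead and moves from first to last
  place, which is \<open>T_rotate\<close>; it is a middle root only in the trivial triple.\<close>

lemma AL_rot: assumes "form E" "K \<subseteq> S" "init s K E"
  shows "AL K E (N (s # v)) \<longleftrightarrow> AL K (rot s E) (N v)"
proof
  have S: "s \<in> S" "s \<in> K" using assms by (auto simp: init_def)
  have mult: "d1 = \<alpha> s \<and> d2 = \<alpha> s" if "d1 \<in> PK K" "d2 \<in> PK K" "p > 0" "q > 0" "p *\<^sub>R d1 + q *\<^sub>R d2 = \<alpha> s" for d1 d2 p q
  proof -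
    have "co r d1 = 0 \<and> co r d2 = 0" if r: "r \<in> S" "r \<noteq> s" for r
    proof -
      have "co r (p *\<^sub>R d1 + q *\<^sub>R d2) = co r (\<alpha> s)" using that \<open>p *\<^sub>R d1 + q *\<^sub>R d2 = \<alpha> s\<close> by simp
      then have "p * co r d1 + q * co r d2 = 0" using r S by (simp add: co_add co_scale co_\<alpha>)
      moreover have "co r d1 \<ge> 0" "co r d2 \<ge> 0" using P_nn PK_P \<open>d1 \<in> PK K\<close> \<open>d2 \<in> PK K\<close> r by blast+
      ultimately show ?thesis using \<open>p > 0\<close> \<open>q > 0\<close>
        by (metis add_nonneg_eq_0_iff less_eq_real_def mult_eq_0_iff mult_nonneg_nonneg less_irrefl)
    qed
    then show ?thesis using P_simple[OF PK_P S(1)] that by blast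
  qed
  have both: "p *\<^sub>R \<alpha> s + q *\<^sub>R \<alpha> s = \<alpha> s" if "p > 0" "q > 0" "p *\<^sub>R \<alpha> s + q *\<^sub>R \<alpha> s \<in> PK K" for p q
  proof (rule P_simple[OF PK_P[OF that(3)] S(1)])
    fix r assume "r \<in> S" "r \<noteq> s"
    then show "co r (p *\<^sub>R \<alpha> s + q *\<^sub>R \<alpha> s) = 0" using S by (simp add: co_add co_scale co_\<alpha>)
  qed
  have Taa: "T a a a" for a by (simp add: T_def)
  {
    assume A: "AL K (rot s E) (N v)"
    show "AL K E (N (s # v))" unfolding AL_def
    proof (intro ballI allI impI)
      fix d1 d2 :: 'v and p q :: real
      let ?b = "p *\<^sub>R d1 + q *\<^sub>R d2"
      assume d: "d1 \<in> PK K" "d2 \<in> PK K" "0 < p" "0 < q" "?b \<in> PK K" "0 \<le> om E d1 d2"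
      have sb: "sr s ?b = p *\<^sub>R sr s d1 + q *\<^sub>R sr s d2" by (simp add: sr_add sr_scale)
      consider "d1 = \<alpha> s" "d2 = \<alpha> s" | "d1 = \<alpha> s" "d2 \<noteq> \<alpha> s" | "d1 \<noteq> \<alpha> s" "d2 = \<alpha> s" | "d1 \<noteq> \<alpha> s" "d2 \<noteq> \<alpha> s" by blast
      then show "T (N (s # v) d1) (N (s # v) ?b) (N (s # v) d2)"
      proof cases
        case 1
        then have "?b = \<alpha> s" using both d by simp
        then show ?thesis using 1 Taa by simp
      next
        case 2
        have b: "?b \<noteq> \<alpha> s" using mult[OF d(1-4)] 2 by blast
        have s1: "sr s ?b \<in> PK K" "sr s d2 \<in> PK K" using refl_PK[OF assms(2) S(2)] b 2 d by blast+
        \<comment> \<open>After the reflection the middle root is \<open>sr s d2\<close>, between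
          \<open>sr s ?b\<close> and \<open>\<alpha> s\<close>.\<close>
        have e: "(1/q) *\<^sub>R sr s ?b + (p/q) *\<^sub>R \<alpha> s = sr s d2"
          unfolding sb using 2 d(4) by (simp add: sr_self scaleR_add_right scaleR_diff_right)
        have "om (rot s E) (sr s ?b) (\<alpha> s) = om E (\<alpha> s) ?b"
          by (simp add: om_rot sr_self om_lin[OF assms(1)] om_swap[of E ?b])
        then have "om (rot s E) (sr s ?b) (\<alpha> s) \<ge> 0" using om_init_nonneg[OF assms d(5)] by simp
        from ALD[OF A s1(1) \<alpha>_PK[OF S(2) assms(2)] _ _ _ this, of "1/q" "p/q"]
        have "T (N v (sr s ?b)) (N v (sr s d2)) (N v (\<alpha> s))" unfolding e using d s1 by simp
        then show ?thesis unfolding 2(1) using 2(2) b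
          by (simp add: N_Cons_self N_Cons_ne 2(1) T_rotate del: N.simps)
      next
        case 3
        \<comment> \<open>An impossible case: \<open>om_init_pos\<close> keeps the initial simple
          root out of the last place.\<close>
        have "om E d1 (\<alpha> s) \<le> 0" using om_init_nonneg[OF assms d(1)] om_swap[of E d1 "\<alpha> s"] by simp
        then have "om E (\<alpha> s) d1 = 0" using d(6) 3 om_swap[of E d1 "\<alpha> s"] by simp
        moreover have "om E (\<alpha> s) d1 > 0"
          using om_init_pos[OF assms d(1) 3(1) d(4,3)] d(5) 3 by (simp add: add.commute)
        ultimately show ?thesis by simp
      next
        case 4
        have b: "?b \<noteq> \<alpha> s" using mult[OF d(1-4)] 4 by blast
        have s1: "sr s ?b \<in> PK K" "sr s d1 \<in> PK K" "sr s d2 \<in> PK K" using refl_PK[OF assms(2) S(2)] b 4 d by blast+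
        have "om (rot s E) (sr s d1) (sr s d2) \<ge> 0" using d by (simp add: om_rot)
        from ALD[OF A s1(2,3) d(3,4) _ this] have "T (N v (sr s d1)) (N v (sr s ?b)) (N v (sr s d2))"
          using s1(1) unfolding sb by simp
        then show ?thesis using 4 b by (simp add: N_Cons_ne del: N.simps)
      qed
    qed
  }
  {
    assume A: "AL K E (N (s # v))"
    show "AL K (rot s E) (N v)" unfolding AL_def
    proof (intro ballI allI impI)
      fix d1 d2 :: 'v and p q :: real
      let ?b = "p *\<^sub>R d1 + q *\<^sub>R d2"
      assume d: "d1 \<in> PK K" "d2 \<in> PK K" "0 < p" "0 < q" "?b \<in> PK K" "0 \<le> om (rot s E) d1 d2"
      have o: "om E (sr s d1) (sr s d2) \<ge> 0" using d(6) by (simp add: om_rot)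
      have sb: "sr s ?b = p *\<^sub>R sr s d1 + q *\<^sub>R sr s d2" by (simp add: sr_add sr_scale)
      have NS: "N (s # v) (sr s d) = N v d" if "d \<in> PK K" "d \<noteq> \<alpha> s" for d
      proof -
        have "sr s d \<noteq> \<alpha> s"
        proof
          assume "sr s d = \<alpha> s"
          then have "d = - \<alpha> s" by (metis root_reflection_involution sr_self)
          then show False using P_neg \<alpha>_P S PK_P that by metis
        qed
        then show ?thesis by (simp add: N_Cons_ne del: N.simps)
      qed
      consider "d1 = \<alpha> s" "d2 = \<alpha> s" | "d1 = \<alpha> s" "d2 \<noteq> \<alpha> s" | "d1 \<noteq> \<alpha> s" "d2 = \<alpha> s" | "d1 \<noteq> \<alpha> s" "d2 \<noteq> \<alpha> s" by blast
      then show "T (N v d1) (N v ?b) (N v d2)"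
      proof cases
        case 1
        then have "?b = \<alpha> s" using both d by simp
        then show ?thesis using 1 Taa by simp
      next
        case 2
        have b: "?b \<noteq> \<alpha> s" using mult[OF d(1-4)] 2 by blast
        have s1: "sr s ?b \<in> PK K" "sr s d2 \<in> PK K" using refl_PK[OF assms(2) S(2)] b 2 d by blast+
        have e: "(p/q) *\<^sub>R \<alpha> s + (1/q) *\<^sub>R sr s ?b = sr s d2"
          unfolding sb using 2 d(4) by (simp add: sr_self scaleR_add_right scaleR_diff_right)
        \<comment> \<open>Impossible as well: after the rotation \<open>\<alpha> s\<close> cannot
          come first.\<close>
        have "om E (\<alpha> s) (sr s d2) \<le> 0" using o 2 by (simp add: sr_self om_lin[OF assms(1)])
        moreover have sbb: "sr s ?b = (- p) *\<^sub>R \<alpha> s + q *\<^sub>R sr s d2" unfolding sb using 2 by (simp add: sr_self)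
        then have "om E (\<alpha> s) (sr s ?b) = q * om E (\<alpha> s) (sr s d2)"
          by (simp only: om_lin(1)[OF assms(1)] om_lin(2)[OF assms(1)])
        moreover have "sr s ?b \<noteq> \<alpha> s"
        proof
          assume "sr s ?b = \<alpha> s"
          then have "?b = - \<alpha> s" by (metis root_reflection_involution sr_self)
          then show False using P_neg \<alpha>_P S PK_P d by metis
        qed
        then have "om E (\<alpha> s) (sr s ?b) > 0"
          by (rule om_init_pos[OF assms s1(1), of "p/q" "1/q"]) (use e s1 d in simp_all)
        ultimately have False using d(4) by (simp add: zero_less_mult_iff)
        then show ?thesis ..
      next
        case 3
        have b: "?b \<noteq> \<alpha> s" using mult[OF d(1-4)] 3 by blast
        have s1: "sr s ?b \<in> PK K" "sr s d1 \<in> PK K" using refl_PK[OF assms(2) S(2)] b 3 d by blast+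
        have e: "(q/p) *\<^sub>R \<alpha> s + (1/p) *\<^sub>R sr s ?b = sr s d1"
          unfolding sb using 3 d(3) by (simp add: sr_self scaleR_add_right scaleR_diff_right)
        from ALD[OF A \<alpha>_PK[OF S(2) assms(2)] s1(1) _ _ _ om_init_nonneg[OF assms s1(1)], of "q/p" "1/p"]
        have "T (N (s # v) (\<alpha> s)) (N (s # v) (sr s d1)) (N (s # v) (sr s ?b))"
          unfolding e using d s1 by simp
        then show ?thesis using NS[OF d(1) 3(1)] NS[OF d(5) b] 3(2)
          by (simp add: N_Cons_self T_rotate del: N.simps)
      next
        case 4
        have b: "?b \<noteq> \<alpha> s" using mult[OF d(1-4)] 4 by blast
        have s1: "sr s ?b \<in> PK K" "sr s d1 \<in> PK K" "sr s d2 \<in> PK K" using refl_PK[OF assms(2) S(2)] b 4 d by blast+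
        from ALD[OF A s1(2,3) d(3,4) _ o]
        have "T (N (s # v) (sr s d1)) (N (s # v) (sr s ?b)) (N (s # v) (sr s d2))"
          using s1(1) unfolding sb by simp
        then show ?thesis using NS[OF d(1) 4(1)] NS[OF d(2) 4(2)] NS[OF d(5) b] by simp
      qed
    qed
  }
qed

text \<open>A middle root in the subsystem on \<open>K'\<close> has both outer roots there.
  Otherwise the middle value and one outer value are zero, which \<open>T\<close> admits.\<close>

lemma AL_zero_outside: assumes "K' \<subseteq> K" "K \<subseteq> S" "AL K' E f" "\<And>\<beta>. \<beta> \<in> P \<Longrightarrow> \<beta> \<notin> PK K' \<Longrightarrow> f \<beta> = 0"
  shows "AL K E f"
  unfolding AL_def
proof (intro ballI allI impI)
  fix d1 d2 :: 'v and p q :: real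
  let ?b = "p *\<^sub>R d1 + q *\<^sub>R d2"
  assume d: "d1 \<in> PK K" "d2 \<in> PK K" "0 < p" "0 < q" "?b \<in> PK K" "0 \<le> om E d1 d2"
  have K': "K' \<subseteq> S" using assms by blast
  show "T (f d1) (f ?b) (f d2)"
  proof (cases "?b \<in> PK K'")
    case True
    have "co r d1 = 0 \<and> co r d2 = 0" if r: "r \<in> S - K'" for r
    proof -
      have "co r ?b = 0" using True r by (simp add: PK_def)
      then have "p * co r d1 + q * co r d2 = 0" using r by (simp add: co_add co_scale)
      moreover have "co r d1 \<ge> 0" "co r d2 \<ge> 0" using P_nn PK_P d r by blast+
      ultimately show ?thesis using \<open>p > 0\<close> \<open>q > 0\<close>
        by (metis add_nonneg_eq_0_iff less_eq_real_def mult_eq_0_iff mult_nonneg_nonneg less_irrefl)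
    qed
    then have "d1 \<in> PK K'" "d2 \<in> PK K'" using d by (auto simp: PK_def)
    then show ?thesis using ALD[OF assms(3) _ _ d(3,4) True d(6)] by blast
  next
    case False
    then have fb: "f ?b = 0" using assms(4) d PK_P by blast
    have "\<not> (d1 \<in> PK K' \<and> d2 \<in> PK K')"
    proof
      assume "d1 \<in> PK K' \<and> d2 \<in> PK K'"
      then have "?b \<in> VK K'" using PK_VK[OF K'] VK_add VK_scale by blast
      then show False using False P_VK_PK[OF K' PK_P[OF d(5)]] by blast
    qed
    then have "f d1 = 0 \<or> f d2 = 0"
      using assms(4)[OF PK_P[OF d(1)]] assms(4)[OF PK_P[OF d(2)]] by auto
    then show ?thesis using fb by (auto simp: T_def)
  qed
qed

lemma Srt_AL: "Srt K E w \<Longrightarrow> form E \<Longrightarrow> K \<subseteq> S \<Longrightarrow> AL K E (N w)"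
proof (induction rule: Srt.induct)
  case (nil K E)
  then show ?case by (simp add: AL_def T_def)
next
  case (use s K E w)
  then show ?case
    using AL_rot[OF use.prems use.hyps(1)] form_rot[OF use.prems(1) init_in[OF use.hyps(1) use.prems(2)]] by blast
next
  case (skip s K E w)
  have K: "K - {s} \<subseteq> S" using skip by blast
  show ?case
    by (rule AL_zero_outside[OF Diff_subset skip.prems(2) skip.IH[OF skip.prems(1) K]])
      (rule N_notin_PK[OF Srt_set[OF skip.hyps(2)] K])
qed

subsection \<open>Heads of sortable words\<close>

definition orth :: "'a list \<Rightarrow> 'a \<Rightarrow> bool" where
  "orth u q \<longleftrightarrow> (\<forall>r\<in>set u. r \<noteq> q \<and> \<alpha> r \<bullet> \<alpha> q = 0)"

lemma orth_act: assumes "set u \<subseteq> S" "q \<in> S" "orth u q"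
  shows "act u (\<alpha> q) = \<alpha> q" "act u (sr q x) = sr q (act u x)" "q # u \<approx>\<^sub>b u @ [q]"
proof -
  have "act u (\<alpha> q) = \<alpha> q \<and> act u (sr q x) = sr q (act u x) \<and> q # u \<approx>\<^sub>b u @ [q]"
    using assms
  proof (induction u)
    case (Cons r u)
    have r: "r \<in> S" "r \<noteq> q" "\<alpha> r \<bullet> \<alpha> q = 0" "orth u q" "set u \<subseteq> S" using Cons.prems by (auto simp: orth_def)
    note c = orth_commute[OF r(1) Cons.prems(2) r(2,3)]
    have "[q, r] @ u \<approx>\<^sub>b [r, q] @ u" by (rule beq_append[OF beq_sym[OF c(1)] beq_refl])
    then have 1: "q # r # u \<approx>\<^sub>b r # q # u" by simp
    have 2: "r # q # u \<approx>\<^sub>b r # u @ [q]" using Cons.IH[OF r(5) Cons.prems(2) r(4)] by (intro beq_Cons) blast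
    have "q # r # u \<approx>\<^sub>b (r # u) @ [q]" using beq_trans[OF 1 2] by simp
    then show ?case using Cons.IH[OF r(5) Cons.prems(2) r(4)] c by simp
  qed simp
  then show "act u (\<alpha> q) = \<alpha> q" "act u (sr q x) = sr q (act u x)" "q # u \<approx>\<^sub>b u @ [q]" by blast+
qed

text \<open>Recovers the state of the sorting recursion when this \<open>q\<close> is read: the
  letters not yet skipped and the transported form.\<close>

lemma Srt_split: "Srt K E z \<Longrightarrow> form E \<Longrightarrow> K \<subseteq> S \<Longrightarrow> z = x @ q # v \<Longrightarrow>
    \<exists>K'\<subseteq>K. init q K' (rots x E) \<and> Srt K' (rots (x @ [q]) E) v"
proof (induction arbitrary: x rule: Srt.induct)
  case (use s K E z)
  have s: "s \<in> S" using use init_in by blast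
  show ?case
  proof (cases x)
    case Nil
    then show ?thesis using use.hyps use.prems by (intro exI[of _ K]) (simp add: rots_Nil)
  next
    case (Cons a x')
    then have a: "a = s" "z = x' @ q # v" using use.prems by auto
    from use.IH[OF form_rot[OF use.prems(1) s] use.prems(2) a(2)]
    show ?thesis unfolding Cons a(1) rots_rots by simp
  qed
next
  case (skip s K E z)
  have "K - {s} \<subseteq> S" using skip.prems by blast
  from skip.IH[OF skip.prems(1) this skip.prems(3)] show ?case by blast
qed simp

text \<open>At its last use \<open>q\<close> can be skipped instead; by \<open>rot_pair\<close> the
  remaining letters see the same form.\<close>

lemma Srt_delete: "Srt K E z \<Longrightarrow> form E \<Longrightarrow> K \<subseteq> S \<Longrightarrow> z = x @ q # v \<Longrightarrow> q \<notin> set v \<Longrightarrow> Srt K E (x @ v)"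
proof (induction arbitrary: x rule: Srt.induct)
  case (use s K E z)
  have s: "s \<in> S" "s \<in> K" using use init_in by (auto simp: init_def)
  have fr: "form (rot s E)" using form_rot[OF use.prems(1) s(1)] .
  show ?case
  proof (cases x)
    case Nil
    then have q: "s = q" "z = v" using use.prems by auto
    have K': "K - {q} \<subseteq> S" using use.prems by blast
    have "set v \<subseteq> K - {q}" using Srt_set[OF use.hyps(2)] use.prems q by auto
    then have "Srt (K - {q}) (rot s E) v"
      using Srt_restrict[OF use.hyps(2) fr use.prems(2), of "K - {q}"] q by auto
    moreover have "agree (K - {q}) (rot s E) E"
      unfolding agree_def using rot_pair[OF use.prems(1,2) use.hyps(1)] q by blast
    ultimately have "Srt (K - {s}) E v" using Srt_cong[OF _ fr use.prems(1) K'] q by blast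
    then show ?thesis using Srt.skip[OF use.hyps(1)] Nil by simp
  next
    case (Cons a x')
    then have a: "a = s" "z = x' @ q # v" using use.prems by auto
    from use.IH[OF fr use.prems(2) a(2) use.prems(4)]
    show ?thesis unfolding Cons a(1) using Srt.use[OF use.hyps(1)] by simp
  qed
next
  case (skip s K E z)
  have "K - {s} \<subseteq> S" using skip.prems by blast
  from skip.IH[OF skip.prems(1) this skip.prems(3,4)] show ?case by (rule Srt.skip[OF skip.hyps(1)])
qed simp

lemma act_co: assumes "set u \<subseteq> K" "K \<subseteq> S" "r \<in> S - K" shows "co r (act u x) = co r x"
  using VK_co[OF assms(2) act_diff_VK[OF assms(1)] assms(3), of x] assms(3) by (simp add: co_diff)

lemma act_red_PK: assumes "set (u @ [q]) \<subseteq> K" "K \<subseteq> S" "red (u @ [q] @ v)" shows "act u (\<alpha> q) \<in> PK K"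
proof -
  have s: "set (u @ [q]) \<subseteq> S" using assms by blast
  have "red (u @ [q])" using red_append(1)[OF s, of v] assms(3) by simp
  then have "act u (\<alpha> q) \<in> P" by (rule act_red_P[OF s])
  moreover have "act u (\<alpha> q) \<in> VK K" using assms(1) by (intro act_VK \<alpha>_VK) auto
  ultimately show ?thesis by (rule P_VK_PK[OF assms(2)])
qed

lemma final_nonneg: assumes "form E" "K \<subseteq> S" "final s K E" "\<theta> \<in> PK K"
  shows "E \<theta> (\<alpha> s) \<ge> 0" "E \<theta> (\<alpha> s) = 0 \<longleftrightarrow> co s \<theta> = 0"
proof -
  have s: "s \<in> S" using assms by (auto simp: final_def)
  have e: "E \<theta> (\<alpha> s) = co s \<theta> * (\<alpha> s \<bullet> \<alpha> s) / 2" using final_form[OF assms(1-3) PK_VK[OF assms(2,4)]] .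
  show "E \<theta> (\<alpha> s) \<ge> 0" "E \<theta> (\<alpha> s) = 0 \<longleftrightarrow> co s \<theta> = 0"
    unfolding e using P_nn[OF PK_P[OF assms(4)] s] \<alpha>_nz[OF s] by simp_all
qed

text \<open>After the letter \<open>q\<close> that inverts \<open>\<alpha> s\<close>, the functional \<open>E (_) (\<alpha> s)\<close> becomes a negative
  multiple of the \<open>q\<close>-coefficient; positivity of the later inversions then forces all later letters
  to be orthogonal to \<open>q\<close>.\<close>

lemma final_inversion: assumes fE: "form E" and KS: "K \<subseteq> S" and sx: "Srt K E x" and rx: "red x"
  and fs: "final s K E" and Ns: "N x (\<alpha> s) > 0"
  obtains x' q v where "x = x' @ q # v" "act x' (\<alpha> q) = \<alpha> s" "orth v q"
    "act (x' @ [q]) = act (s # x')"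
proof -
  have xK: "set x \<subseteq> K" using Srt_set[OF sx] .
  then have xS: "set x \<subseteq> S" using KS by blast
  have s: "s \<in> S" "s \<in> K" using fs KS by (auto simp: final_def)
  obtain x' q v where x: "x = x' @ q # v" "act x' (\<alpha> q) = \<alpha> s" "act (x' @ [q]) = act (s # x')"
    using N_split_simple[OF xS s(1) Ns] by metis
  have q: "q \<in> K" "q \<in> S" "set x' \<subseteq> K" "set x' \<subseteq> S" using xK KS unfolding x(1) by auto
  obtain K' where K': "K' \<subseteq> K" "init q K' (rots x' E)" "Srt K' (rots (x' @ [q]) E) v"
    using Srt_split[OF sx fE KS x(1)] by blast
  have K'S: "K' \<subseteq> S" using K' KS by blast
  have vK': "set v \<subseteq> K'" using Srt_set[OF K'(3)] .
  let ?F = "rots x' E" and ?x = "x' @ [q]"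
  have fF: "form ?F" using form_rots[OF fE q(4)] .
  have fin: "final q K' (rot q ?F)" using rot_final[OF fF K'S K'(2)] .
  have fR: "form (rot q ?F)" using form_rot[OF fF q(2)] .
  have as: "\<alpha> s = act ?x (- \<alpha> q)" using x(2) by (simp add: act_append sr_neg sr_self)
  have key: "E (act ?x y) (\<alpha> s) = - (co q y * (\<alpha> q \<bullet> \<alpha> q) / 2)" if "y \<in> VK K'" for y
  proof -
    have "E (act ?x y) (\<alpha> s) = rot q ?F y (- \<alpha> q)" unfolding as rots_rots by (simp add: rots_def)
    also have "\<dots> = - rot q ?F y (\<alpha> q)" by (rule form_lin(8)[OF fR])
    finally show ?thesis unfolding final_form[OF fR K'S fin that] .
  qed
  have qv: "q \<notin> set v"
  proof
    assume "q \<in> set v"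
    then obtain v1 v2 where v: "v = v1 @ q # v2" "q \<notin> set v1" by (meson split_list_first)
    have v1: "set v1 \<subseteq> K' - {q}" using v vK' by auto
    let ?y = "act v1 (\<alpha> q)"
    have yV: "?y \<in> VK K'" using v1 K'(2) by (intro act_VK \<alpha>_VK) (auto simp: init_def)
    \<comment> \<open>The letters of \<open>v1\<close> differ from \<open>q\<close> and preserve the
      \<open>q\<close>-coefficient 1, which would make the functional negative on a positive
      root.\<close>
    have cy: "co q ?y = 1" using act_co[OF v1, of q "\<alpha> q"] K'S q by (auto simp: co_\<alpha>)
    have "act (?x @ v1) (\<alpha> q) \<in> PK K"
      by (rule act_red_PK[OF _ KS, of _ _ v2]) (use rx xK x v in auto)
    then have "E (act (?x @ v1) (\<alpha> q)) (\<alpha> s) \<ge> 0" by (rule final_nonneg(1)[OF fE KS fs])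
    then have "0 \<le> - ((\<alpha> q \<bullet> \<alpha> q) / 2)" unfolding act_append[of ?x v1] key[OF yV] cy by simp
    then show False using \<alpha>_norm[OF q(2)] by simp
  qed
  have "orth v q"
  proof (rule ccontr)
    assume "\<not> orth v q"
    then have ex: "\<exists>r\<in>set v. \<alpha> r \<bullet> \<alpha> q \<noteq> 0" using qv unfolding orth_def by blast
    obtain v1 r v2 where v: "v = v1 @ r # v2" "\<alpha> r \<bullet> \<alpha> q \<noteq> 0" "\<forall>y\<in>set v1. \<not> \<alpha> y \<bullet> \<alpha> q \<noteq> 0"
      using split_list_first_prop[OF ex] by metis
    have r: "r \<in> K'" "r \<noteq> q" "r \<in> S" "r \<in> K" using v qv vK' K'S K'(1) by auto
    have v1: "set v1 \<subseteq> K' - {q}" "set v1 \<subseteq> S" using v qv vK' K'S by auto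
    have o1: "orth v1 q" using v v1 unfolding orth_def by auto
    note oa = orth_act[OF v1(2) q(2) o1]
    let ?y = "act v1 (\<alpha> r)"
    let ?\<theta> = "act (?x @ v1) (\<alpha> r)" and ?\<rho> = "act (x' @ v1) (\<alpha> r)"
    have yV: "?y \<in> VK K'" using v1 r by (intro act_VK \<alpha>_VK) auto
    have cy: "co q ?y = 0" using act_co[OF v1(1), of q "\<alpha> r"] K'S q r by (auto simp: co_\<alpha>)
    have tP: "?\<theta> \<in> PK K"
      by (rule act_red_PK[OF _ KS, of _ _ v2]) (use rx xK x v in auto)
    have "E ?\<theta> (\<alpha> s) = 0" unfolding act_append[of ?x v1] key[OF yV] cy by simp
    then have cs: "co s ?\<theta> = 0" using final_nonneg(2)[OF fE KS fs tP] by blast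
    have "?\<theta> = act x' (act v1 (sr q (\<alpha> r)))" by (simp add: act_append oa(2))
    also have "\<dots> = ?\<rho> - cf q (\<alpha> r) *\<^sub>R \<alpha> s"
      by (simp add: sr_eq act_diff act_scale act_append oa(1) x(2))
    finally have te: "?\<theta> = ?\<rho> - cf q (\<alpha> r) *\<^sub>R \<alpha> s" .
    have "\<alpha> r \<bullet> \<alpha> q < 0" using \<alpha>_inner_le[OF r(3) q(2) r(2)] v(2) by simp
    then have cneg: "cf q (\<alpha> r) < 0"
      unfolding cf_def using \<alpha>_norm[OF q(2)] by (simp add: divide_neg_pos)
    have cr: "co b ?\<theta> = co b ?\<rho> - (if b = s then cf q (\<alpha> r) else 0)" if "b \<in> S" for b
      unfolding te using that s by (simp add: co_diff co_scale co_\<alpha>)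
    have "co s ?\<rho> < 0" using cr[OF s(1)] cs cneg by simp
    then have "?\<rho> \<notin> P" using P_nn[of ?\<rho> s] s by force
    moreover have "set (x' @ v1) \<subseteq> S" using q v1 by auto
    ultimately have mP: "- ?\<rho> \<in> P" using act_P[OF _ \<alpha>_P[OF r(3)]] by blast
    \<comment> \<open>Away from \<open>s\<close> the positive roots \<open>?\<theta>\<close> and
      \<open>- ?\<rho>\<close> have opposite coefficients, so these vanish; by \<open>cs\<close>
      nothing is left of \<open>?\<theta>\<close>.\<close>
    have "co b ?\<theta> = 0" if b: "b \<in> S" for b
    proof (cases "b = s")
      case False
      then have "co b ?\<theta> = co b ?\<rho>" using cr[OF b] by simp
      moreover have "co b (- ?\<rho>) \<ge> 0" using P_nn[OF mP b] .
      moreover have "co b ?\<theta> \<ge> 0" using P_nn[OF PK_P[OF tP] b] .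
      ultimately show ?thesis using co_neg[OF b, of ?\<rho>] by simp
    qed (use cs in simp)
    then show False using P_zero_iff[OF PK_P[OF tP]] by force
  qed
  then show ?thesis using that x by blast
qed

text \<open>Meant for a letter \<open>p\<close> skipped earlier, where \<open>E\<close> is not
  controlled at \<open>\<alpha> p\<close>; the difference lies in the span of \<open>K\<close>. Each
  letter \<open>s\<close> up to the last \<open>q\<close> contributes
  \<open>- cf s (\<alpha> p)\<close>, which is nonnegative, times a nonnegative value of
  \<open>E (\<alpha> s)\<close>. The letters after \<open>q\<close> contribute nothing, having no
  \<open>q\<close>-coefficient.\<close>

lemma dropped_letter_nonneg: "Srt K E z \<Longrightarrow> form E \<Longrightarrow> K \<subseteq> S \<Longrightarrow> z = x @ q # v \<Longrightarrow> red z \<Longrightarrow> q \<notin> set v \<Longrightarrow>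
    p \<in> S - K \<Longrightarrow> E (act z (\<alpha> p) - \<alpha> p) (act x (\<alpha> q)) \<ge> 0"
proof (induction arbitrary: x rule: Srt.induct)
  case (use s K E z)
  have s: "s \<in> S" "s \<in> K" using use init_in by (auto simp: init_def)
  have fr: "form (rot s E)" using form_rot[OF use.prems(1) s(1)] .
  have zK: "set z \<subseteq> K" using Srt_set[OF use.hyps(2)] .
  have p: "p \<in> S" "p \<noteq> s" using use.prems s by auto
  let ?w = "act z (\<alpha> p) - \<alpha> p"
  have e: "act (s # z) (\<alpha> p) - \<alpha> p = sr s ?w - cf s (\<alpha> p) *\<^sub>R \<alpha> s"
    by (simp add: sr_diff) (simp add: sr_eq)
  have "\<alpha> p \<bullet> \<alpha> s \<le> 0" using \<alpha>_inner_le p s by blast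
  then have k: "cf s (\<alpha> p) \<le> 0" unfolding cf_def using \<alpha>_norm[OF s(1)] by (simp add: divide_nonpos_pos)
  show ?case
  proof (cases x)
    case Nil
    then have q: "s = q" "z = v" using use.prems by auto
    have "set v \<subseteq> K - {s}" using zK q use.prems by auto
    then have "?w \<in> VK (K - {s})" unfolding q by (rule act_diff_VK)
    then have wV: "?w \<in> VK K" "co s ?w = 0" using VK_mono[of "K - {s}" K] VK_co[of "K - {s}" ?w s] use.prems s by auto
    have "E (sr s ?w) (\<alpha> s) = - rot s E ?w (\<alpha> s)"
      by (simp add: rot_eq sr_self form_lin[OF use.prems(1)])
    then have "E (sr s ?w) (\<alpha> s) = 0"
      using final_form[OF fr use.prems(2) rot_final[OF use.prems(1,2) use.hyps(1)] wV(1)] wV(2) by simp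
    then have "E (sr s ?w - cf s (\<alpha> p) *\<^sub>R \<alpha> s) (\<alpha> s) = - cf s (\<alpha> p) * ((\<alpha> s \<bullet> \<alpha> s) / 2)"
      by (simp add: form_lin[OF use.prems(1)] form_self[OF use.prems(1) s(1)])
    then show ?thesis unfolding e Nil using q k \<alpha>_norm[OF s(1)] by (simp add: mult_nonpos_nonneg)
  next
    case (Cons a x')
    then have a: "a = s" "z = x' @ q # v" using use.prems by auto
    have rz: "red z" using iffD1[OF red_Cons[OF s(1)] use.prems(4)] by blast
    have 1: "rot s E ?w (act x' (\<alpha> q)) \<ge> 0"
      by (rule use.IH[OF fr use.prems(2) a(2) rz use.prems(5,6)])
    have zP: "act x (\<alpha> q) \<in> PK K"
      by (rule act_red_PK[OF _ use.prems(2), of _ _ v]) (use use.prems Cons a zK s in auto)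
    have 2: "E (\<alpha> s) (act x (\<alpha> q)) \<ge> 0"
      unfolding init_form[OF use.prems(1,2) use.hyps(1) PK_VK[OF use.prems(2) zP]]
      using P_nn[OF PK_P[OF zP] s(1)] by simp
    have "E (sr s ?w - cf s (\<alpha> p) *\<^sub>R \<alpha> s) (act x (\<alpha> q))
        = rot s E ?w (act x' (\<alpha> q)) - cf s (\<alpha> p) * E (\<alpha> s) (act x (\<alpha> q))"
      unfolding form_lin(3)[OF use.prems(1)] form_lin(5)[OF use.prems(1)] by (simp add: Cons a rot_eq)
    moreover have "cf s (\<alpha> p) * E (\<alpha> s) (act x (\<alpha> q)) \<le> 0" using k 2 by (rule mult_nonpos_nonneg)
    ultimately show ?thesis unfolding e using 1 by linarith
  qed
next
  case (skip s K E z)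
  show ?case by (rule skip.IH) (use skip.prems in auto)
qed simp

text \<open>Against \<open>final_nonneg\<close> this will force a coefficient to vanish in
  \<open>sortable_head\<close>. When \<open>r\<close> is skipped,
  \<open>dropped_letter_nonneg\<close> takes over, since \<open>E (\<alpha> r)\<close> is zero on
  roots of the smaller subsystem.\<close>

lemma later_letter_nonneg: "Srt K E z \<Longrightarrow> form E \<Longrightarrow> K \<subseteq> S \<Longrightarrow> z = x @ q # v \<Longrightarrow> red z \<Longrightarrow> q \<notin> set v \<Longrightarrow>
    r \<in> K \<Longrightarrow> r \<noteq> q \<Longrightarrow> E (act z (\<alpha> r)) (act x (\<alpha> q)) \<ge> 0"
proof (induction arbitrary: x rule: Srt.induct)
  case (use s K E z)
  have s: "s \<in> S" "s \<in> K" using use init_in by (auto simp: init_def)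
  have fr: "form (rot s E)" using form_rot[OF use.prems(1) s(1)] .
  have zK: "set z \<subseteq> K" using Srt_set[OF use.hyps(2)] .
  show ?case
  proof (cases x)
    case Nil
    then have q: "s = q" "z = v" using use.prems by auto
    have v: "set v \<subseteq> K - {s}" using zK q use.prems by auto
    then have y: "act v (\<alpha> r) \<in> VK (K - {s})" by (rule act_VK) (use use.prems q \<alpha>_VK in auto)
    then have wV: "act v (\<alpha> r) \<in> VK K" "co s (act v (\<alpha> r)) = 0"
      using VK_mono[of "K - {s}" K] VK_co[of "K - {s}" "act v (\<alpha> r)" s] use.prems s by auto
    have "E (act (s # z) (\<alpha> r)) (\<alpha> s) = - rot s E (act v (\<alpha> r)) (\<alpha> s)"
      by (simp add: rot_eq sr_self form_lin[OF use.prems(1)] q)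
    then show ?thesis
      using final_form[OF fr use.prems(2) rot_final[OF use.prems(1,2) use.hyps(1)] wV(1)] wV(2) Nil q by simp
  next
    case (Cons a x')
    then have a: "a = s" "z = x' @ q # v" using use.prems by auto
    have rz: "red z" using iffD1[OF red_Cons[OF s(1)] use.prems(4)] by blast
    have "rot s E (act z (\<alpha> r)) (act x' (\<alpha> q)) \<ge> 0"
      by (rule use.IH[OF fr use.prems(2) a(2) rz use.prems(5,6,7)])
    then show ?thesis by (simp add: Cons a rot_eq)
  qed
next
  case (skip s K E z)
  have s: "s \<in> S" "s \<in> K" using skip init_in by (auto simp: init_def)
  have K': "K - {s} \<subseteq> S" using skip by blast
  show ?case
  proof (cases "r = s")
    case False
    show ?thesis by (rule skip.IH) (use skip.prems False in auto)
  next
    case True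
    have 1: "E (act z (\<alpha> s) - \<alpha> s) (act x (\<alpha> q)) \<ge> 0"
      by (rule dropped_letter_nonneg[OF skip.hyps(2) skip.prems(1) K' skip.prems(3-5)]) (use s in simp)
    have zP: "act x (\<alpha> q) \<in> PK (K - {s})"
      by (rule act_red_PK[OF _ K', of _ _ v]) (use skip.prems Srt_set[OF skip.hyps(2)] in auto)
    then have zV: "act x (\<alpha> q) \<in> VK K" "co s (act x (\<alpha> q)) = 0"
      using PK_VK[OF K'] VK_mono[of "K - {s}" K] s by (auto simp: PK_def)
    have "E (\<alpha> s) (act x (\<alpha> q)) = 0" using init_form[OF skip.prems(1,2) skip.hyps(1) zV(1)] zV(2) by simp
    then show ?thesis using 1 True by (simp add: form_lin[OF skip.prems(1)])
  qed
qed simp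

lemma Cox_insert_final: assumes "Cox K E" "\<And>r. r \<in> K - {q} \<Longrightarrow> E (\<alpha> r) (\<alpha> q) = 0"
  shows "Cox (insert q K) E"
  unfolding Cox_def
proof (intro allI impI)
  fix K' assume K': "K' \<subseteq> insert q K" "K' \<noteq> {}"
  show "\<exists>s. init s K' E"
  proof (cases "K' = {q}")
    case True
    then show ?thesis by (auto simp: init_def)
  next
    case False
    then have "K' - {q} \<noteq> {}" "K' - {q} \<subseteq> K" using K' by auto
    then obtain t where t: "init t (K' - {q}) E" using assms(1) unfolding Cox_def by blast
    have "init t K' E" unfolding init_def
    proof (intro conjI ballI)
      show "t \<in> K'" using t by (auto simp: init_def)
      fix r assume "r \<in> K' - {t}"
      then show "E (\<alpha> t) (\<alpha> r) = 0" using t assms(2)[of t] K' by (cases "r = q") (auto simp: init_def)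
    qed
    then show ?thesis by blast
  qed
qed

text \<open>\<open>x1\<close> is the first Garside factor. All letters of the rest \<open>u2\<close> are descents of \<open>x1\<close>, and \<open>u2\<close>
  is sortable for the form transported along \<open>x1\<close>. If \<open>s u\<close> is not \<open>x1\<close> extended by \<open>s\<close>, then
  \<open>s x1 = x1 q\<close> in the Coxeter group and \<open>q\<close> moves to the front of the rest.\<close>

lemma sortable_head: "Srt K E u \<Longrightarrow> form E \<Longrightarrow> K \<subseteq> S \<Longrightarrow>
    \<exists>x1 u2 K2. u \<approx>\<^sub>b x1 @ u2 \<and> Srt K E x1 \<and> red x1 \<and> K2 \<subseteq> K \<and> (\<forall>r\<in>K2. - act x1 (\<alpha> r) \<in> P) \<and>
      Srt K2 (rots x1 E) u2 \<and> (x1 = [] \<longrightarrow> u = [])"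
proof (induction rule: Srt.induct)
  case (nil K E)
  have "Srt {} (rots [] E) []" by (rule Srt.nil) (simp add: Cox_def)
  then show ?case using Srt.nil[OF nil(1)] by (intro exI[of _ "[]"] exI[of _ "{}"]) simp
next
  case (skip s K E u)
  have "K - {s} \<subseteq> S" using skip by blast
  from skip.IH[OF skip.prems(1) this] obtain x1 u2 K2 where IH: "u \<approx>\<^sub>b x1 @ u2" "Srt (K - {s}) E x1" "red x1"
    "K2 \<subseteq> K - {s}" "\<forall>r\<in>K2. - act x1 (\<alpha> r) \<in> P" "Srt K2 (rots x1 E) u2" "x1 = [] \<longrightarrow> u = []"
    by (elim exE conjE)
  have "K2 \<subseteq> K" using IH(4) by blast
  then show ?case using IH Srt.skip[OF skip.hyps(1) IH(2)]
    by (intro exI[of _ x1] exI[of _ u2] exI[of _ K2] conjI)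
next
  case (use s K E u)
  have s: "s \<in> S" "s \<in> K" using use init_in by (auto simp: init_def)
  note fE = use.prems(1) and KS = use.prems(2) and ini = use.hyps(1)
  have fr: "form (rot s E)" using form_rot[OF fE s(1)] .
  have fin: "final s K (rot s E)" using rot_final[OF fE KS ini] .
  from use.IH[OF fr KS] obtain x1 u2 K2 where IH: "u \<approx>\<^sub>b x1 @ u2" "Srt K (rot s E) x1" "red x1" "K2 \<subseteq> K"
    "\<forall>r\<in>K2. - act x1 (\<alpha> r) \<in> P" "Srt K2 (rots x1 (rot s E)) u2" by (elim exE conjE)
  have xK: "set x1 \<subseteq> K" "set x1 \<subseteq> S" using Srt_set[OF IH(2)] KS by auto
  have K2S: "K2 \<subseteq> S" using IH(4) KS by blast
  show ?case
  proof (cases "N x1 (\<alpha> s) = 0")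
    case True
    have "red (s # x1)" using red_Cons[OF s(1)] IH(3) True by simp
    moreover have "Srt K E (s # x1)" using Srt.use[OF ini IH(2)] .
    moreover have "s # u \<approx>\<^sub>b (s # x1) @ u2" using beq_Cons[OF IH(1)] by simp
    moreover have "Srt K2 (rots (s # x1) E) u2" using IH(6) by (simp add: rots_rots)
    moreover have "\<forall>r\<in>K2. - act (s # x1) (\<alpha> r) \<in> P"
    proof
      fix r assume r: "r \<in> K2"
      let ?d = "- act x1 (\<alpha> r)"
      have d: "?d \<in> P" using IH(5) r by blast
      have "?d \<noteq> \<alpha> s"
      proof
        assume "?d = \<alpha> s"
        then have "act (rev x1) (\<alpha> s) = act (rev x1) (- act x1 (\<alpha> r))" by simp
        then have "act (rev x1) (\<alpha> s) = - \<alpha> r" by (simp add: act_neg)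
        moreover have "act (rev x1) (\<alpha> s) \<in> P" using parity[OF xK(2) \<alpha>_P[OF s(1)]] True by simp
        ultimately show False using P_neg \<alpha>_P r K2S by (metis subsetD)
      qed
      then have "sr s ?d \<in> P" using refl_P s d by blast
      then show "- act (s # x1) (\<alpha> r) \<in> P" by (simp add: sr_neg)
    qed
    moreover have "s # x1 = [] \<longrightarrow> s # u = []" by simp
    ultimately show ?thesis using IH(4) by (intro exI[of _ "s # x1"] exI[of _ u2] exI[of _ K2] conjI)
  next
    case False
    then have "N x1 (\<alpha> s) > 0" by simp
    from final_inversion[OF fr KS IH(2,3) fin this] obtain x' q v where
      x: "x1 = x' @ q # v" "act x' (\<alpha> q) = \<alpha> s" "orth v q" "act (x' @ [q]) = act (s # x')" .
    have q: "q \<in> K" "q \<in> S" "set v \<subseteq> S" "q \<notin> set v" using xK x unfolding orth_def by auto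
    note oa = orth_act[OF q(3,2) x(3)]
    \<comment> \<open>\<open>?y\<close> is the same group element as \<open>x1\<close>, while
      \<open>s # x1\<close> equals \<open>?y @ [q]\<close> in the monoid because \<open>q\<close>
      commutes with \<open>v\<close>.\<close>
    let ?y = "s # x' @ v"
    have ay: "act x1 = act ?y"
    proof
      fix z
      have "act x1 z = act (x' @ [q]) (act v z)" by (simp add: x(1) act_append)
      then show "act x1 z = act ?y z" unfolding x(4) by (simp add: act_append)
    qed
    have yS: "set ?y \<subseteq> S" using xK x s by auto
    have ry: "red ?y" using red_length(2)[OF xK(2) yS ay IH(3)] x(1) by simp
    have Sy: "Srt K E ?y" using Srt.use[OF ini Srt_delete[OF IH(2) fr KS x(1) q(4)]] .
    let ?F = "rots ?y E" and ?K = "insert q K2"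
    have KK: "?K \<subseteq> K" "?K \<subseteq> S" using IH(4) q K2S by auto
    have aq: "act ?y (\<alpha> q) = - \<alpha> s"
      unfolding ay[symmetric] using x(2) by (simp add: x(1) act_append oa(1) sr_self act_neg)
    have neg: "\<forall>r\<in>?K. - act ?y (\<alpha> r) \<in> P"
      using IH(5) aq \<alpha>_P[OF s(1)] unfolding ay by simp
    have fF: "form ?F" using form_rots[OF fE yS] .
    have iq: "init q ?K ?F"
      unfolding init_def
    proof (intro conjI ballI)
      fix r assume r: "r \<in> ?K - {q}"
      let ?d = "- act x1 (\<alpha> r)"
      have rK: "r \<in> K" using r KK by blast
      have d: "?d \<in> P" using IH(5) r by blast
      have "?d \<in> VK K" using xK(1) rK by (intro VK_neg act_VK \<alpha>_VK)
      then have dK: "?d \<in> PK K" by (rule P_VK_PK[OF KS d])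
      \<comment> \<open>As \<open>?d\<close> is a positive root, \<open>final_nonneg\<close> gives
        the reverse inequality. So \<open>?d\<close> has no \<open>s\<close>-coefficient, which is
        what makes \<open>q\<close> initial.\<close>
      have "rot s E (act x1 (\<alpha> r)) (\<alpha> s) \<ge> 0"
        using later_letter_nonneg[OF IH(2) fr KS x(1) IH(3) q(4) rK] r x(2) by simp
      moreover have "rot s E (act x1 (\<alpha> r)) (\<alpha> s) = - rot s E ?d (\<alpha> s)"
        by (simp add: form_lin[OF fr])
      moreover have "rot s E ?d (\<alpha> s) \<ge> 0" using final_nonneg(1)[OF fr KS fin dK] .
      ultimately have "rot s E ?d (\<alpha> s) = 0" by simp
      then have c0: "co s ?d = 0" using final_nonneg(2)[OF fr KS fin dK] by blast
      have "?F (\<alpha> q) (\<alpha> r) = E (- \<alpha> s) (- ?d)" by (simp only: rots_def aq ay minus_minus)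
      also have "\<dots> = E (\<alpha> s) ?d" by (simp add: form_lin[OF fE])
      also have "\<dots> = 0" using init_form[OF fE KS ini PK_VK[OF KS dK]] c0 by simp
      finally show "?F (\<alpha> q) (\<alpha> r) = 0" .
    qed simp
    have Feq: "rots x1 (rot s E) = rot q ?F"
      unfolding rots_rots
    proof (rule rots_cong, rule ext)
      fix z
      have "act ([s] @ x1) z = sr s (act ?y z)" using ay by simp
      also have "\<dots> = act x' (act v z)" by (simp add: act_append)
      also have "\<dots> = act x1 (sr q z)" by (simp add: x(1) act_append oa(2))
      finally show "act ([s] @ x1) z = act (?y @ [q]) z" unfolding ay by (simp add: act_append)
    qed
    have fq: "form (rot q ?F)" using form_rot[OF fF q(2)] .
    have S2: "Srt K2 (rot q ?F) u2" using IH(6) unfolding Feq .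
    \<comment> \<open>After its use \<open>q\<close> is final, so allowing it as a letter for
      \<open>u2\<close> creates no cycle.\<close>
    have "Cox ?K (rot q ?F)"
      by (rule Cox_insert_final[OF Srt_Cox[OF S2 fq K2S]])
        (use rot_final[OF fF KK(2) iq] in \<open>auto simp: final_def\<close>)
    from Srt_weaken[OF fq KK(2) this _ S2] obtain u3 where u3: "u3 \<approx>\<^sub>b u2" "Srt ?K (rot q ?F) u3" by blast
    have S3: "Srt ?K ?F (q # u3)" using Srt.use[OF iq u3(2)] .
    have "(q # v) @ u2 \<approx>\<^sub>b (v @ [q]) @ u3" by (rule beq_append[OF oa(3) beq_sym[OF u3(1)]])
    then have "(s # x') @ ((q # v) @ u2) \<approx>\<^sub>b (s # x') @ ((v @ [q]) @ u3)" by (rule beq_append[OF beq_refl])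
    then have "s # x1 @ u2 \<approx>\<^sub>b ?y @ (q # u3)" by (simp add: x(1))
    then have "s # u \<approx>\<^sub>b ?y @ (q # u3)" by (rule beq_trans[OF beq_Cons[OF IH(1)]])
    moreover have "?y = [] \<longrightarrow> s # u = []" by simp
    ultimately show ?thesis using Sy ry KK(1) neg S3
      by (intro exI[of _ ?y] exI[of _ "q # u3"] exI[of _ ?K] conjI)
  qed
qed

subsection \<open>Parabolic prefixes\<close>

text \<open>Quantified over all \<open>J\<close> because \<open>JP_append\<close> turns the question
  for \<open>J\<close> into one for another set \<open>L\<close>.\<close>

definition JP :: "'a list \<Rightarrow> bool" where
  "JP u \<longleftrightarrow> (\<forall>J\<subseteq>S. \<exists>a. set a \<subseteq> J \<and> a \<preceq> u \<and> (\<forall>\<gamma>\<in>PK J. N a \<gamma> = N u \<gamma>))"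

text \<open>\<open>j\<close> is a longest prefix with letters in \<open>J\<close>; a letter of
  \<open>J\<close> that could start \<open>b\<close> would lengthen it.\<close>

lemma coset_decomposition: assumes "J \<subseteq> S" "set x \<subseteq> S" "red x"
  obtains j b where "set j \<subseteq> J" "x \<approx>\<^sub>b j @ b" "set b \<subseteq> S" "red b" "\<forall>t\<in>J. N b (\<alpha> t) = 0"
proof -
  let ?R = "\<lambda>g. set g \<subseteq> J \<and> g \<preceq> x"
  have b: "\<forall>g. ?R g \<longrightarrow> length g < Suc (length x)" using pre_length by (simp add: less_Suc_eq_le)
  have R0: "?R []" by simp
  obtain j where "?R j \<and> (\<forall>y. ?R y \<longrightarrow> length y \<le> length j)"
    using ex_has_greatest_nat[of ?R, OF R0 b] by (rule exE)
  then have j: "?R j" and mx: "\<And>y. ?R y \<Longrightarrow> length y \<le> length j" by blast+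
  obtain b where b: "j @ b \<approx>\<^sub>b x" using j unfolding pre_def by blast
  have jbS: "set (j @ b) \<subseteq> S" using beq_set[OF b] assms by simp
  then have bS: "set b \<subseteq> S" "set j \<subseteq> S" by auto
  have rb: "red b" using red_append(2)[OF bS(2)] beq_red[OF b jbS] assms by blast
  have "N b (\<alpha> t) = 0" if t: "t \<in> J" for t
  proof (rule ccontr)
    assume "N b (\<alpha> t) \<noteq> 0"
    then have "N b (\<alpha> t) > 0" by simp
    then obtain b' where b': "b \<approx>\<^sub>b t # b'" using red_start[OF bS(1) rb] t assms(1) by blast
    have "j @ b \<approx>\<^sub>b (j @ [t]) @ b'" using beq_append[OF beq_refl[of j] b'] by simp
    from beq_trans[OF beq_sym[OF this] b] have "j @ [t] \<preceq> x" unfolding pre_def by blast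
    then have "?R (j @ [t])" using j t by simp
    then have "length (j @ [t]) \<le> length j" by (rule mx)
    then show False by simp
  qed
  then show ?thesis using that[of j b] j beq_sym[OF b] bS rb by blast
qed

text \<open>Write \<open>x = j b\<close> with \<open>b\<close> of minimal length in its coset. As all letters of \<open>u\<close> are descents of \<open>x\<close>,
  the roots that \<open>b\<close> maps from the support of \<open>u\<close> into the parabolic subsystem on \<open>J\<close> form a standard
  parabolic subsystem \<open>L\<close>, and the \<open>L\<close>-prefix of \<open>u\<close> can be moved through \<open>b\<close>.\<close>

lemma JP_append: assumes xS: "set x \<subseteq> S" and rx: "red x" and uK: "set u \<subseteq> K2" and K2S: "K2 \<subseteq> S"
  and neg: "\<And>r. r \<in> K2 \<Longrightarrow> - act x (\<alpha> r) \<in> P" and JPu: "JP u"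
  shows "JP (x @ u)"
  unfolding JP_def
proof (intro allI impI)
  fix J assume J: "J \<subseteq> S"
  obtain j b where jb: "set j \<subseteq> J" "x \<approx>\<^sub>b j @ b" "set b \<subseteq> S" "red b" "\<forall>t\<in>J. N b (\<alpha> t) = 0"
    using coset_decomposition[OF J xS rx] .
  have jS: "set j \<subseteq> S" and uS: "set u \<subseteq> S" using jb J uK K2S by auto
  have bt: "act (rev b) (\<alpha> t) \<in> P" if "t \<in> J" for t
    using parity[OF jb(3) \<alpha>_P, of t] jb(5) that J by auto
  \<comment> \<open>The inverse of \<open>b\<close> keeps the simple roots of \<open>J\<close>
    positive, hence also their nonnegative combinations.\<close>
  have bJ: "N b \<gamma> = 0 \<and> act (rev b) \<gamma> \<in> P" if g: "\<gamma> \<in> PK J" for \<gamma>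
  proof -
    have gP: "\<gamma> \<in> P" using PK_P[OF g] .
    have e: "act (rev b) \<gamma> = (\<Sum>t\<in>J. co t \<gamma> *\<^sub>R act (rev b) (\<alpha> t))"
      using arg_cong[OF VK_expand[OF J PK_VK[OF J g]], of "act (rev b)"] by (simp add: act_sum act_scale)
    have nn: "co i (act (rev b) \<gamma>) \<ge> 0" if i: "i \<in> S" for i
    proof -
      have "co i (act (rev b) \<gamma>) = (\<Sum>t\<in>J. co t \<gamma> * co i (act (rev b) (\<alpha> t)))"
        unfolding e using i by (simp add: co_sum co_scale)
      also have "\<dots> \<ge> 0"
        by (rule sum_nonneg) (use P_nn[OF gP] P_nn[OF bt] J i in \<open>auto intro!: mult_nonneg_nonneg\<close>)
      finally show ?thesis .
    qed
    have pm: "act (rev b) \<gamma> \<in> P \<or> - act (rev b) \<gamma> \<in> P" using act_P[of "rev b" \<gamma>] jb(3) gP by simp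
    have "- act (rev b) \<gamma> \<notin> P"
    proof
      assume m: "- act (rev b) \<gamma> \<in> P"
      then obtain i where "i \<in> S" "co i (- act (rev b) \<gamma>) > 0" using P_zero_iff by blast
      then show False using nn[of i] co_neg[of i "act (rev b) \<gamma>"] by simp
    qed
    then have p: "act (rev b) \<gamma> \<in> P" using pm by blast
    then have "even (N b \<gamma>)" using parity[OF jb(3) gP] by blast
    moreover have "N b \<gamma> \<le> 1" using jb(4) gP unfolding red_def by blast
    ultimately have "N b \<gamma> = 0" by (cases "N b \<gamma> = 1") auto
    then show ?thesis using p by blast
  qed
  define L where "L = {r\<in>K2. act b (\<alpha> r) \<in> PK J}"
  have LS: "L \<subseteq> S" "L \<subseteq> K2" using K2S unfolding L_def by auto
  have "\<exists>t. t \<in> J \<and> act b (\<alpha> r) = \<alpha> t" if r: "r \<in> L" for r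
  proof -
    let ?g = "act b (\<alpha> r)"
    have g: "?g \<in> PK J" and rS: "r \<in> S" using r LS unfolding L_def by auto
    obtain t where t: "t \<in> S" "co t ?g > 0" using P_zero_iff[OF PK_P[OF g]] by blast
    then have tJ: "t \<in> J" using g unfolding PK_def by force
    have e: "\<alpha> r = (\<Sum>t\<in>J. co t ?g *\<^sub>R act (rev b) (\<alpha> t))"
      using arg_cong[OF VK_expand[OF J PK_VK[OF J g]], of "act (rev b)"] by (simp add: act_sum act_scale)
    \<comment> \<open>\<open>e\<close> expresses a simple root as a nonnegative combination of
      positive roots, so each root that occurs in it must be that simple root.\<close>
    have "act (rev b) (\<alpha> t) = \<alpha> r"
    proof (rule P_simple[OF bt[OF tJ] rS])
      fix i assume i: "i \<in> S" "i \<noteq> r"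
      have "(\<Sum>t\<in>J. co t ?g * co i (act (rev b) (\<alpha> t))) = co i (\<alpha> r)"
        by (subst (2) e) (use i in \<open>simp add: co_sum co_scale\<close>)
      also have "\<dots> = 0" using i rS by (simp add: co_\<alpha>)
      finally have z: "(\<Sum>t\<in>J. co t ?g * co i (act (rev b) (\<alpha> t))) = 0" .
      have "\<forall>t\<in>J. co t ?g * co i (act (rev b) (\<alpha> t)) = 0"
        using z by (subst (asm) sum_nonneg_eq_0_iff)
          (use finite_subset[OF J finS] P_nn[OF PK_P[OF g]] P_nn[OF bt] J i in \<open>auto intro!: mult_nonneg_nonneg\<close>)
      then show "co i (act (rev b) (\<alpha> t)) = 0" using tJ t(2) by auto
    qed
    then have "\<alpha> t = ?g" by (metis act_rev(2))
    then show ?thesis using tJ by metis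
  qed
  then have "\<forall>r\<in>L. \<exists>t. t \<in> J \<and> act b (\<alpha> r) = \<alpha> t" by blast
  from bchoice[OF this] obtain f where f: "\<forall>r\<in>L. f r \<in> J \<and> act b (\<alpha> r) = \<alpha> (f r)" ..
  have br: "act (b @ [r]) = act (f r # b)" if "r \<in> L" for r using sr_conj f that by blast
  have mv1: "b @ [r] \<approx>\<^sub>b f r # b" if r: "r \<in> L" for r
  proof -
    have s: "set (b @ [r]) \<subseteq> S" "set (f r # b) \<subseteq> S" "f r \<in> S" using jb(3) f r LS J by auto
    have r2: "red (f r # b)" using red_Cons[OF s(3)] jb(4,5) f r by blast
    have "red (b @ [r])" using red_length(2)[OF s(2,1) br[OF r, symmetric] r2] by simp
    then show ?thesis using matsumoto[OF s(1,2) _ r2 br[OF r]] by blast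
  qed
  have mv: "b @ a \<approx>\<^sub>b map f a @ b" if "set a \<subseteq> L" for a
    using that
  proof (induction a)
    case (Cons r a)
    then have "(b @ [r]) @ a \<approx>\<^sub>b (f r # b) @ a" using mv1 by (intro beq_append beq_refl) auto
    moreover have "f r # b @ a \<approx>\<^sub>b f r # map f a @ b" using Cons by (intro beq_Cons) auto
    ultimately show ?case using beq_trans by fastforce
  qed simp
  have Nmap: "N (map f a) (act b \<epsilon>) = N a \<epsilon>" if "set a \<subseteq> L" "\<epsilon> \<in> P" "act b \<epsilon> \<in> PK J" for a \<epsilon>
    using that
  proof (induction a arbitrary: \<epsilon>)
    case (Cons r a)
    have r: "r \<in> L" "r \<in> S" "f r \<in> J" "f r \<in> S" using Cons.prems f LS J by auto
    have iff: "act b \<epsilon> = \<alpha> (f r) \<longleftrightarrow> \<epsilon> = \<alpha> r" using f r(1) by (metis act_rev(1))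
    have t: "\<tau> (f r) (act b \<epsilon>) = act b (\<tau> r \<epsilon>)"
    proof (cases "\<epsilon> = \<alpha> r")
      case True
      then show ?thesis using iff by (simp add: \<tau>_def)
    next
      case False
      then show ?thesis using iff fun_cong[OF br[OF r(1)], of \<epsilon>] by (simp add: \<tau>_def act_append)
    qed
    have "N (map f a) (act b (\<tau> r \<epsilon>)) = N a (\<tau> r \<epsilon>)"
    proof (rule Cons.IH)
      show "set a \<subseteq> L" using Cons.prems by simp
      show "\<tau> r \<epsilon> \<in> P" using \<tau>_P r Cons.prems by blast
      show "act b (\<tau> r \<epsilon>) \<in> PK J" unfolding t[symmetric] by (rule \<tau>_PK[OF J r(3) Cons.prems(3)])
    qed
    then show ?case using iff t by simp
  qed simp
  obtain a2 y where a2: "set a2 \<subseteq> L" "a2 @ y \<approx>\<^sub>b u" "\<forall>\<gamma>\<in>PK L. N a2 \<gamma> = N u \<gamma>"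
    using JPu[unfolded JP_def, rule_format, OF LS(1)] unfolding pre_def by (elim exE conjE)
  let ?a = "j @ map f a2"
  have xu: "x @ u \<approx>\<^sub>b (j @ b) @ u" by (rule beq_append[OF jb(2) beq_refl])
  have aJ: "set ?a \<subseteq> J" using jb(1) a2(1) f by auto
  have "b @ u \<approx>\<^sub>b b @ (a2 @ y)" by (rule beq_append[OF beq_refl beq_sym[OF a2(2)]])
  moreover have "(b @ a2) @ y \<approx>\<^sub>b (map f a2 @ b) @ y" by (rule beq_append[OF mv[OF a2(1)] beq_refl])
  ultimately have "b @ u \<approx>\<^sub>b map f a2 @ (b @ y)" using beq_trans[of "b @ u" "b @ (a2 @ y)"] by simp
  then have "j @ (b @ u) \<approx>\<^sub>b j @ (map f a2 @ (b @ y))" by (rule beq_append[OF beq_refl])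
  then have "(j @ b) @ u \<approx>\<^sub>b ?a @ (b @ y)" by simp
  from beq_sym[OF beq_trans[OF xu this]] have pre: "?a \<preceq> x @ u" unfolding pre_def by blast
  have "N ?a \<gamma> = N (x @ u) \<gamma>" if g: "\<gamma> \<in> PK J" for \<gamma>
  proof -
    have gP: "\<gamma> \<in> P" using PK_P[OF g] .
    let ?h = "fold \<tau> j \<gamma>"
    have "fold \<tau> j \<gamma> \<in> PK J" using jb(1) g
    proof (induction j arbitrary: \<gamma>)
      case (Cons a j)
      then show ?case using \<tau>_PK[OF J] by auto
    qed simp
    then have h: "?h \<in> PK J" .
    let ?e = "fold \<tau> b ?h"
    have eP: "?e \<in> P" using fold_\<tau>_P[OF jb(3) PK_P[OF h]] .
    have be: "act b ?e = ?h" by (rule N_zero_act[OF jb(3) PK_P[OF h] conjunct1[OF bJ[OF h]]])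
    have "N (x @ u) \<gamma> = N ((j @ b) @ u) \<gamma>" using beq_N[OF xu _ gP] xS uS by simp
    also have "\<dots> = N j \<gamma> + N u ?e" using bJ[OF h] by (simp add: N_append)
    finally have 1: "N (x @ u) \<gamma> = N j \<gamma> + N u ?e" .
    have "N (map f a2) ?h = N a2 ?e" using Nmap[OF a2(1) eP] be h by simp
    then have 2: "N ?a \<gamma> = N j \<gamma> + N a2 ?e" by (simp add: N_append)
    have "N a2 ?e = N u ?e"
    proof (cases "?e \<in> PK L")
      case True
      then show ?thesis by (rule bspec[OF a2(3)])
    next
      case False
      have "N u ?e = 0"
      proof (rule ccontr)
        assume "N u ?e \<noteq> 0"
        then have e2: "?e \<in> PK K2" using N_support[OF uK K2S eP] by simp
        have hexp: "?h = (\<Sum>r\<in>K2. co r ?e *\<^sub>R act b (\<alpha> r))"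
          using arg_cong[OF VK_expand[OF K2S PK_VK[OF K2S e2]], of "act b"] be by (simp add: act_sum act_scale)
        \<comment> \<open>Here the descent assumption enters. \<open>j\<close> preserves
          coefficients outside \<open>J\<close>, so a positive \<open>act b (\<alpha> r)\<close> not
          in the subsystem on \<open>J\<close> would leave a positive coefficient in the negative
          root \<open>act x (\<alpha> r)\<close>.\<close>
        have out: "- act b (\<alpha> r) \<in> P \<and> (\<exists>i\<in>S - J. co i (- act b (\<alpha> r)) > 0)" if r: "r \<in> K2 - L" for r
        proof -
          have rS: "r \<in> S" using r K2S by blast
          have nJ: "act b (\<alpha> r) \<notin> PK J" using r unfolding L_def by blast
          have pm: "act b (\<alpha> r) \<in> P \<or> - act b (\<alpha> r) \<in> P" by (rule act_P[OF jb(3) \<alpha>_P[OF rS]])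
          have ax: "act x (\<alpha> r) = act j (act b (\<alpha> r))" using beq_act[OF jb(2)] by (simp add: act_append)
          have n1: "act b (\<alpha> r) \<notin> P"
          proof
            assume p: "act b (\<alpha> r) \<in> P"
            then obtain i where i: "i \<in> S - J" "co i (act b (\<alpha> r)) \<noteq> 0" using nJ unfolding PK_def by blast
            then have "co i (act b (\<alpha> r)) > 0" using P_nn[OF p, of i] by simp
            then have "co i (act x (\<alpha> r)) > 0" unfolding ax using act_co[OF jb(1) J i(1)] by simp
            moreover have "- act x (\<alpha> r) \<in> P" using neg r by blast
            then have "co i (- act x (\<alpha> r)) \<ge> 0" using P_nn i by blast
            ultimately show False using i co_neg[of i "act x (\<alpha> r)"] by simp
          qed
          then have m: "- act b (\<alpha> r) \<in> P" using pm by blast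
          have "- act b (\<alpha> r) \<notin> PK J"
          proof
            assume "- act b (\<alpha> r) \<in> PK J"
            then have "act (rev b) (- act b (\<alpha> r)) \<in> P" using bJ by blast
            then have "- \<alpha> r \<in> P" by (simp add: act_neg)
            then show False using P_neg[OF \<alpha>_P[OF rS]] by blast
          qed
          then obtain i where i: "i \<in> S - J" "co i (- act b (\<alpha> r)) \<noteq> 0" using m unfolding PK_def by blast
          then have "co i (- act b (\<alpha> r)) > 0" using P_nn[OF m, of i] by simp
          then show ?thesis using m i by blast
        qed
        have "co r ?e = 0" if r: "r \<in> K2 - L" for r
        proof -
          obtain i where i: "i \<in> S - J" "co i (- act b (\<alpha> r)) > 0" using out[OF r] by blast
          \<comment> \<open>The coefficient of \<open>?h\<close> at \<open>i\<close> is zero, but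
            all its summands have the same sign, so each vanishes.\<close>
          have "0 = co i ?h" using h i unfolding PK_def by simp
          also have "\<dots> = (\<Sum>r\<in>K2. co r ?e * co i (act b (\<alpha> r)))"
            by (subst hexp) (use i in \<open>simp add: co_sum co_scale\<close>)
          also have "\<dots> = - (\<Sum>r\<in>K2. co r ?e * co i (- act b (\<alpha> r)))"
            using i by (simp add: co_neg sum_negf)
          finally have z: "(\<Sum>r\<in>K2. co r ?e * co i (- act b (\<alpha> r))) = 0" by simp
          have nn: "co r ?e * co i (- act b (\<alpha> r)) \<ge> 0" if r: "r \<in> K2" for r
          proof (cases "r \<in> L")
            case True
            then have "co i (act b (\<alpha> r)) = 0" using i unfolding L_def PK_def by blast
            then show ?thesis using i by (simp add: co_neg)
          next
            case False
            then show ?thesis using out[of r] P_nn[OF eP, of r] P_nn[of "- act b (\<alpha> r)" i] i r K2S by auto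
          qed
          have "\<forall>r\<in>K2. co r ?e * co i (- act b (\<alpha> r)) = 0"
            using z by (subst (asm) sum_nonneg_eq_0_iff) (use finite_subset[OF K2S finS] nn in auto)
          then show ?thesis using r i(2) by auto
        qed
        then have "?e \<in> PK L" using e2 unfolding PK_def by blast
        then show False using False by blast
      qed
      moreover have "N a2 ?e = 0" using N_notin_PK[OF a2(1) LS(1) eP False] .
      ultimately show ?thesis by simp
    qed
    then show ?thesis using 1 2 by simp
  qed
  then show "\<exists>a. set a \<subseteq> J \<and> a \<preceq> x @ u \<and> (\<forall>\<gamma>\<in>PK J. N a \<gamma> = N (x @ u) \<gamma>)" using aJ pre by blast
qed

text \<open>Peels off one Garside factor at a time: the descent clause of
  \<open>sortable_head\<close> is the hypothesis of \<open>JP_append\<close>.\<close>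

lemma Srt_JP: "Srt K E u \<Longrightarrow> form E \<Longrightarrow> K \<subseteq> S \<Longrightarrow> JP u"
proof (induction "length u" arbitrary: u K E rule: less_induct)
  case less
  show ?case
  proof (cases "u = []")
    case True
    show ?thesis unfolding True JP_def by (intro allI impI exI[of _ "[]"]) simp
  next
    case False
    obtain x1 u2 K2 where G: "u \<approx>\<^sub>b x1 @ u2" "Srt K E x1" "red x1" "K2 \<subseteq> K"
      "\<forall>r\<in>K2. - act x1 (\<alpha> r) \<in> P" "Srt K2 (rots x1 E) u2" "x1 \<noteq> []"
      using sortable_head[OF less.prems] False by blast
    have xS: "set x1 \<subseteq> S" using Srt_set[OF G(2)] less.prems by blast
    have K2S: "K2 \<subseteq> S" using G less.prems by blast
    have "length u2 < length u" using beq_length[OF G(1)] G(7) by simp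
    from less.hyps[OF this G(6) form_rots[OF less.prems(2) xS] K2S] have "JP u2" .
    then have J: "JP (x1 @ u2)" using JP_append[OF xS G(3) Srt_set[OF G(6)] K2S] G(5) by blast
    have uS: "set u \<subseteq> S" using Srt_set[OF less.prems(1)] less.prems(3) by blast
    show ?thesis unfolding JP_def
    proof (intro allI impI)
      fix J assume JS: "J \<subseteq> S"
      then obtain a where a: "set a \<subseteq> J" "a \<preceq> x1 @ u2" "\<forall>\<gamma>\<in>PK J. N a \<gamma> = N (x1 @ u2) \<gamma>"
        using J unfolding JP_def by blast
      have "a \<preceq> u" using pre_trans[OF a(2) pre_beq[OF beq_sym[OF G(1)]]] .
      moreover have "\<forall>\<gamma>\<in>PK J. N a \<gamma> = N u \<gamma>" using a(3) beq_N[OF G(1) uS PK_P] by simp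
      ultimately show "\<exists>a. set a \<subseteq> J \<and> a \<preceq> u \<and> (\<forall>\<gamma>\<in>PK J. N a \<gamma> = N u \<gamma>)" using a(1) by blast
    qed
  qed
qed

subsection \<open>Extending sortable words\<close>

text \<open>If \<open>s\<close> is initial for \<open>insert s K\<close>, the left side is
  \<open>om E (act x (\<alpha> s)) (act x (\<alpha> r))\<close>. Values of \<open>E\<close> at
  \<open>\<alpha> s\<close> are eliminated so that the induction may rotate \<open>E\<close>, after
  which they would not be controlled.\<close>

lemma sorted_prefix_om_nonneg: "Srt K E z \<Longrightarrow> form E \<Longrightarrow> K \<subseteq> S \<Longrightarrow> z = x @ r # y \<Longrightarrow> red z \<Longrightarrow> s \<in> S - K \<Longrightarrow>
    E (act x (\<alpha> s) - \<alpha> s) (act x (\<alpha> r)) - E (act x (\<alpha> r)) (act x (\<alpha> s) - \<alpha> s) - act x (\<alpha> r) \<bullet> \<alpha> s \<ge> 0"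
proof (induction arbitrary: x rule: Srt.induct)
  case (use q K E z)
  have q: "q \<in> S" "q \<in> K" using use init_in by (auto simp: init_def)
  note fE = use.prems(1)
  have fr: "form (rot q E)" using form_rot[OF fE q(1)] .
  have zK: "set z \<subseteq> K" using Srt_set[OF use.hyps(2)] .
  have s: "s \<in> S" "s \<notin> K" "s \<noteq> q" using use.prems q by auto
  show ?case
  proof (cases x)
    case Nil
    then have "r = q" using use.prems by simp
    then show ?thesis using Nil \<alpha>_inner_le[OF q(1) s(1)] s(3) by (simp add: form_lin[OF fE])
  next
    case (Cons a x')
    then have a: "a = q" "z = x' @ r # y" using use.prems by auto
    have rz: "red z" using iffD1[OF red_Cons[OF q(1)] use.prems(4)] by blast
    let ?v = "act x' (\<alpha> s) - \<alpha> s" and ?b = "act x' (\<alpha> r)" and ?k = "cf q (\<alpha> s)"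
    have IH: "rot q E ?v ?b - rot q E ?b ?v - ?b \<bullet> \<alpha> s \<ge> 0"
      by (rule use.IH[OF fr use.prems(2) a(2) rz use.prems(5)])
    have v: "act x (\<alpha> s) - \<alpha> s = sr q ?v - ?k *\<^sub>R \<alpha> q"
      unfolding Cons a by (simp add: sr_diff) (simp add: sr_eq)
    have b: "act x (\<alpha> r) = sr q ?b" unfolding Cons a by simp
    have bP: "sr q ?b \<in> PK K"
      unfolding b[symmetric] by (rule act_red_PK[OF _ use.prems(2), of _ _ y]) (use use.prems Cons a zK q in auto)
    have "\<alpha> s \<bullet> \<alpha> q \<le> 0" using \<alpha>_inner_le s q by blast
    then have k: "?k \<le> 0" unfolding cf_def using \<alpha>_norm[OF q(1)] by (simp add: divide_nonpos_pos)
    have Eq: "E (\<alpha> q) (sr q ?b) \<ge> 0"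
      unfolding init_form[OF fE use.prems(2) use.hyps(1) PK_VK[OF use.prems(2) bP]]
      using P_nn[OF PK_P[OF bP] q(1)] by simp
    have bS: "sr q ?b \<in> VK S" using VK_mono[OF use.prems(2)] PK_VK[OF use.prems(2) bP] by blast
    have sym: "E (\<alpha> q) (sr q ?b) + E (sr q ?b) (\<alpha> q) = \<alpha> q \<bullet> sr q ?b"
      by (rule form_sym[OF fE \<alpha>_VK[OF q(1)] bS])
    have in1: "\<alpha> q \<bullet> sr q ?b = - (?b \<bullet> \<alpha> q)"
      using root_reflection_inner[of "\<alpha> q" "\<alpha> q" "sr q ?b"] by (simp add: sr_self inner_commute)
    have in2: "sr q ?b \<bullet> \<alpha> s = ?b \<bullet> \<alpha> s - ?k * (?b \<bullet> \<alpha> q)"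
    proof -
      have "sr q ?b \<bullet> \<alpha> s = ?b \<bullet> sr q (\<alpha> s)" using root_reflection_inner[of "\<alpha> q" "sr q ?b" "\<alpha> s"] by simp
      then show ?thesis by (simp add: sr_eq inner_diff_right)
    qed
    have "E (sr q ?v - ?k *\<^sub>R \<alpha> q) (sr q ?b) - E (sr q ?b) (sr q ?v - ?k *\<^sub>R \<alpha> q) - sr q ?b \<bullet> \<alpha> s
      = (rot q E ?v ?b - rot q E ?b ?v - ?b \<bullet> \<alpha> s)
        - ?k * (E (\<alpha> q) (sr q ?b) - E (sr q ?b) (\<alpha> q) - ?b \<bullet> \<alpha> q)"
      unfolding in2 form_lin(3,4)[OF fE] form_lin(5,6)[OF fE] by (simp add: rot_eq algebra_simps)
    also have "E (\<alpha> q) (sr q ?b) - E (sr q ?b) (\<alpha> q) - ?b \<bullet> \<alpha> q = 2 * E (\<alpha> q) (sr q ?b)"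
      using sym in1 by linarith
    finally have e: "E (sr q ?v - ?k *\<^sub>R \<alpha> q) (sr q ?b) - E (sr q ?b) (sr q ?v - ?k *\<^sub>R \<alpha> q) - sr q ?b \<bullet> \<alpha> s
      = (rot q E ?v ?b - rot q E ?b ?v - ?b \<bullet> \<alpha> s) - ?k * (2 * E (\<alpha> q) (sr q ?b))" .
    have "?k * (2 * E (\<alpha> q) (sr q ?b)) \<le> 0" using k Eq by (intro mult_nonpos_nonneg) auto
    then show ?thesis unfolding v b e using IH by linarith
  qed
next
  case (skip q K E z)
  show ?case by (rule skip.IH) (use skip.prems in auto)
qed simp

text \<open>If \<open>x s\<close> has an aligned inversion function, \<open>s\<close> is initial and \<open>s\<close> does not occur in \<open>x\<close>,
  then \<open>\<beta> = x \<alpha>\<^sub>s\<close> is the only inverted root involving \<open>\<alpha> s\<close>. Every letter of \<open>x\<close> that is not orthogonal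
  to \<open>s\<close> would give an unaligned pair of roots.\<close>

lemma aligned_snoc_orth:
  assumes fE: "form E" and KS: "K \<subseteq> S" and ini: "init s K E" and sx: "Srt (K - {s}) E x"
    and al: "AL K E (N (x @ [s]))"
  shows "orth x s"
proof -
  let ?K = "K - {s}"
  have s: "s \<in> S" "s \<in> K" using ini KS by (auto simp: init_def)
  have K'S: "?K \<subseteq> S" using KS by blast
  have sn: "s \<in> S - ?K" using s by blast
  have xK: "set x \<subseteq> ?K" using Srt_set[OF sx] .
  have xS: "set x \<subseteq> S" and xKK: "set x \<subseteq> K" using xK KS by auto
  let ?N = "N (x @ [s])" and ?\<beta> = "act x (\<alpha> s)"
  have posco: "\<gamma> \<in> P" if "\<gamma> \<in> P \<or> - \<gamma> \<in> P" "co s \<gamma> > 0" for \<gamma>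
    using that P_nn[of "- \<gamma>" s] s co_neg[of s \<gamma>] by force
  have notPK: "\<gamma> \<notin> PK ?K" if "co s \<gamma> > 0" for \<gamma> using that sn unfolding PK_def by force
  have cb: "co s ?\<beta> = 1" using act_co[OF xK K'S sn] s by (simp add: co_\<alpha>)
  have bP: "?\<beta> \<in> P" by (rule posco[OF act_P[OF xS \<alpha>_P[OF s(1)]]]) (simp add: cb)
  have PKK: "act u (\<alpha> r) \<in> PK K" if "act u (\<alpha> r) \<in> P" "set u \<subseteq> K" "r \<in> K" for u r
    using P_VK_PK[OF KS that(1)] act_VK[OF that(2) \<alpha>_VK[OF that(3)]] by blast
  have bK: "?\<beta> \<in> PK K" by (rule PKK[OF bP xKK s(2)])
  have fx: "fold \<tau> x \<gamma> = \<alpha> s \<longleftrightarrow> \<gamma> = ?\<beta>" if g: "\<gamma> \<in> P" for \<gamma>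
  proof -
    have fb: "fold \<tau> x ?\<beta> = \<alpha> s" using fold_\<tau>_act[OF xS bP] \<alpha>_P[OF s(1)] by simp
    have "inj_on (fold \<tau> x) P" using fold_\<tau>_bij[OF xS] unfolding bij_betw_def by blast
    then show ?thesis using fb bP g unfolding inj_on_def by metis
  qed
  have Nb: "?N ?\<beta> > 0" using fx[OF bP] by (simp add: N_append)
  have N0: "?N \<gamma> = 0" if "\<gamma> \<in> P" "\<gamma> \<noteq> ?\<beta>" "co s \<gamma> > 0" for \<gamma>
    using fx[OF that(1)] that(2) N_notin_PK[OF xK K'S that(1) notPK[OF that(3)]] by (simp add: N_append)
  have Nge: "?N \<gamma> \<ge> N x \<gamma>" for \<gamma> by (simp add: N_append)
  obtain x1 u2 K2 where G: "x \<approx>\<^sub>b x1 @ u2" "Srt ?K E x1" "red x1" "K2 \<subseteq> ?K"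
      "\<forall>r\<in>K2. - act x1 (\<alpha> r) \<in> P" "Srt K2 (rots x1 E) u2"
    using sortable_head[OF sx fE K'S] by (elim exE conjE)
  have x1K: "set x1 \<subseteq> ?K" using Srt_set[OF G(2)] .
  have x1S: "set x1 \<subseteq> S" "set x1 \<subseteq> K" using x1K KS by auto
  have u2K: "set u2 \<subseteq> K2" using Srt_set[OF G(6)] .
  have u2S: "set u2 \<subseteq> S" "K2 \<subseteq> S" using u2K G(4) KS by auto
  have ax: "act x y = act x1 (act u2 y)" for y using beq_act[OF G(1)] by (simp add: act_append)
  have u2s: "act u2 (\<alpha> s) = \<alpha> s"
  proof (rule ccontr)
    assume ne: "act u2 (\<alpha> s) \<noteq> \<alpha> s"
    let ?t = "act u2 (\<alpha> s)"
    let ?w = "?t - \<alpha> s"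
    have u2K': "set u2 \<subseteq> ?K" using u2K G(4) by blast
    have ct: "co s ?t = 1" using act_co[OF u2K' K'S sn] s by (simp add: co_\<alpha>)
    have tP: "?t \<in> P" by (rule posco[OF act_P[OF u2S(1) \<alpha>_P[OF s(1)]]]) (simp add: ct)
    have wV: "?w \<in> VK K2" by (rule act_diff_VK[OF u2K])
    have "?t \<bullet> ?t = \<alpha> s \<bullet> \<alpha> s" by (simp add: act_inner)
    then have "?w \<bullet> ?w = 2 * (?t \<bullet> ?w)" by (simp add: inner_diff_left inner_diff_right inner_commute)
    moreover have "?w \<bullet> ?w > 0" using ne by simp
    ultimately have tw: "?t \<bullet> ?w > 0" by simp
    \<comment> \<open>\<open>?w\<close> is a nonnegative combination of simple roots in
      \<open>K2\<close> and pairs positively with \<open>?t\<close>, so one of these simple roots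
      does.\<close>
    have "\<exists>r\<in>K2. ?t \<bullet> \<alpha> r > 0"
    proof (rule ccontr)
      assume no: "\<not> (\<exists>r\<in>K2. ?t \<bullet> \<alpha> r > 0)"
      have "?t \<bullet> ?w = ?t \<bullet> (\<Sum>r\<in>K2. co r ?w *\<^sub>R \<alpha> r)" using VK_expand[OF u2S(2) wV] by simp
      also have "\<dots> = (\<Sum>r\<in>K2. co r ?w * (?t \<bullet> \<alpha> r))" by (simp add: inner_sum_right)
      also have "\<dots> \<le> 0"
      proof (rule sum_nonpos)
        fix r assume r: "r \<in> K2"
        then have r': "r \<in> S" "r \<noteq> s" using u2S G(4) by auto
        have "co r ?w = co r ?t" using r' s by (simp add: co_diff co_\<alpha>)
        then have "co r ?w \<ge> 0" using P_nn[OF tP r'(1)] by simp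
        moreover have "?t \<bullet> \<alpha> r \<le> 0" using no r by (simp add: not_less)
        ultimately show "co r ?w * (?t \<bullet> \<alpha> r) \<le> 0" by (rule mult_nonneg_nonpos)
      qed
      finally show False using tw by simp
    qed
    then obtain r where r: "r \<in> K2" "?t \<bullet> \<alpha> r > 0" by blast
    have rS: "r \<in> S" "r \<in> K" "r \<in> ?K" using r u2S G(4) by auto
    let ?d = "- act x1 (\<alpha> r)" and ?k = "cf r ?t"
    \<comment> \<open>\<open>?d\<close> is inverted because \<open>r\<close> is a descent of
      \<open>x1\<close>. The root \<open>?b\<close> between \<open>?\<beta>\<close> and
      \<open>?d\<close> has \<open>s\<close>-coefficient 1 and is not inverted, so
      \<open>T_mid\<close> fails in either order.\<close>
    let ?b = "1 *\<^sub>R ?\<beta> + ?k *\<^sub>R ?d"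
    have k: "?k > 0" unfolding cf_def using r(2) \<alpha>_norm[OF rS(1)] by simp
    have dP: "?d \<in> P" using G(5) r by blast
    have "?d \<in> VK K" using x1S rS by (intro VK_neg act_VK \<alpha>_VK)
    then have dK: "?d \<in> PK K" by (rule P_VK_PK[OF KS dP])
    have cd: "co s ?d = 0" using act_co[OF x1K K'S sn, of "\<alpha> r"] rS s by (simp add: co_neg co_\<alpha>)
    have be: "?b = act (x1 @ r # u2) (\<alpha> s)"
    proof -
      have "act (x1 @ r # u2) (\<alpha> s) = act x1 (?t - ?k *\<^sub>R \<alpha> r)"
        by (simp only: act_append root_act.simps sr_eq)
      then show ?thesis by (simp add: act_diff act_scale ax)
    qed
    have cb2: "co s ?b = 1" unfolding co_add[OF s(1)] co_scale[OF s(1)] cb cd by simp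
    have wS: "set (x1 @ r # u2) \<subseteq> S" using x1S u2S rS by auto
    have b2P: "?b \<in> P" by (rule posco) (use act_P[OF wS \<alpha>_P[OF s(1)]] be cb2 in auto)
    have b2K: "?b \<in> PK K"
      using P_VK_PK[OF KS b2P] VK_add VK_scale PK_VK[OF KS bK] PK_VK[OF KS dK] by blast
    have "?k *\<^sub>R ?d \<noteq> 0" using k dP zero_notin_P by auto
    then have "?b \<noteq> ?\<beta>" by simp
    then have Nb2: "?N ?b = 0" using N0[OF b2P] cb2 by simp
    have "odd (N x1 ?d)"
    proof
      assume "even (N x1 ?d)"
      then have "act (rev x1) ?d \<in> P" using parity[OF x1S(1) dP] by blast
      then have "- \<alpha> r \<in> P" by (simp add: act_neg)
      then show False using P_neg[OF \<alpha>_P[OF rS(1)]] by blast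
    qed
    then have "N x1 ?d > 0" by (rule odd_pos)
    then have "N x ?d > 0" using beq_N[OF G(1) xS dP] by (simp add: N_append)
    then have Nd: "?N ?d > 0" using Nge[of ?d] by simp
    have b3: "?k *\<^sub>R ?d + 1 *\<^sub>R ?\<beta> = ?b" by (rule add.commute)
    have "om E ?\<beta> ?d \<ge> 0 \<or> om E ?d ?\<beta> \<ge> 0" using om_swap[of E ?\<beta> ?d] by linarith
    then show False
    proof
      assume "om E ?\<beta> ?d \<ge> 0"
      from ALD[OF al bK dK zero_less_one k b2K this] have "T (?N ?\<beta>) 0 (?N ?d)" unfolding Nb2 .
      then show False using T_mid Nb Nd by fastforce
    next
      assume o: "om E ?d ?\<beta> \<ge> 0"
      have "T (?N ?d) (?N (?k *\<^sub>R ?d + 1 *\<^sub>R ?\<beta>)) (?N ?\<beta>)"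
        by (rule ALD[OF al dK bK k zero_less_one _ o]) (simp only: b3 b2K)
      then have "T (?N ?d) 0 (?N ?\<beta>)" unfolding b3 Nb2 .
      then show False using T_mid Nb Nd by fastforce
    qed
  qed
  have bx1: "?\<beta> = act x1 (\<alpha> s)" using ax u2s by simp
  have ox1: "orth x1 s"
  proof (rule ccontr)
    assume "\<not> orth x1 s"
    then have ex: "\<exists>r\<in>set x1. \<alpha> r \<bullet> \<alpha> s \<noteq> 0" using x1K unfolding orth_def by blast
    obtain x' r y where y: "x1 = x' @ r # y" "\<alpha> r \<bullet> \<alpha> s \<noteq> 0" "\<forall>z\<in>set y. \<not> \<alpha> z \<bullet> \<alpha> s \<noteq> 0"
      using split_list_last_prop[OF ex] by metis
    have r: "r \<in> S" "r \<noteq> s" "r \<in> K" "r \<in> ?K" using x1K KS y by auto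
    have yS: "set y \<subseteq> S" "set x' \<subseteq> S" "set x' \<subseteq> K" "set x' \<subseteq> ?K" using x1S x1K y by auto
    have "orth y s" using y x1K unfolding orth_def by auto
    then have ys: "act y (\<alpha> s) = \<alpha> s" using orth_act(1)[OF yS(1) s(1)] by blast
    \<comment> \<open>\<open>r\<close> is the last letter of \<open>x1\<close> not orthogonal to
      \<open>s\<close>, so \<open>?\<beta>\<close> lies between \<open>?d1\<close> and
      \<open>?d2\<close>. As \<open>?d1\<close> comes first and is not inverted,
      \<open>T_zero\<close> would make \<open>?\<beta>\<close> uninverted.\<close>
    let ?d1 = "act x' (\<alpha> s)" and ?d2 = "act x' (\<alpha> r)" and ?k = "- cf r (\<alpha> s)"
    have be: "?\<beta> = 1 *\<^sub>R ?d1 + ?k *\<^sub>R ?d2"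
      unfolding bx1 y(1) by (simp add: act_append ys sr_eq act_diff act_scale)
    have "\<alpha> s \<bullet> \<alpha> r < 0" using \<alpha>_inner_le[OF s(1) r(1)] r(2) y(2) by (simp add: inner_commute)
    then have k: "?k > 0" unfolding cf_def using \<alpha>_norm[OF r(1)] by (simp add: divide_neg_pos)
    have c1: "co s ?d1 = 1" using act_co[OF yS(4) K'S sn] s by (simp add: co_\<alpha>)
    have d1P: "?d1 \<in> P" by (rule posco[OF act_P[OF yS(2) \<alpha>_P[OF s(1)]]]) (simp add: c1)
    have d1K: "?d1 \<in> PK K" by (rule PKK[OF d1P yS(3) s(2)])
    have d2K': "?d2 \<in> PK ?K"
      by (rule act_red_PK[OF _ K'S, of _ _ y]) (use x1K y G(3) in auto)
    then have d2K: "?d2 \<in> PK K" using PK_mono[of ?K K] by blast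
    have "?k *\<^sub>R ?d2 \<noteq> 0" using k PK_P[OF d2K] zero_notin_P by auto
    then have "?d1 \<noteq> ?\<beta>" unfolding be by simp
    then have Nd1: "?N ?d1 = 0" using N0[OF d1P] c1 by simp
    have om1: "E (?d1 - \<alpha> s) ?d2 - E ?d2 (?d1 - \<alpha> s) - ?d2 \<bullet> \<alpha> s \<ge> 0"
      by (rule sorted_prefix_om_nonneg[OF G(2) fE K'S y(1) G(3) sn])
    have d2S: "?d2 \<in> VK S" using act_VK[OF yS(2) \<alpha>_VK[OF r(1)]] .
    have "co s ?d2 = 0" using d2K' s unfolding PK_def by auto
    then have "E (\<alpha> s) ?d2 = 0" using init_form[OF fE KS ini PK_VK[OF KS d2K]] by simp
    moreover have "E (\<alpha> s) ?d2 + E ?d2 (\<alpha> s) = \<alpha> s \<bullet> ?d2" by (rule form_sym[OF fE \<alpha>_VK[OF s(1)] d2S])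
    ultimately have "om E ?d1 ?d2 \<ge> 0" using om1 by (simp add: om_def form_lin[OF fE] inner_commute)
    from ALD[OF al d1K d2K zero_less_one k _ this] have "T (?N ?d1) (?N ?\<beta>) (?N ?d2)"
      using bK unfolding be[symmetric] by blast
    then have "?N ?\<beta> = 0" unfolding Nd1 by (rule T_zero)
    then show False using Nb by simp
  qed
  have bs: "?\<beta> = \<alpha> s" unfolding bx1 by (rule orth_act(1)[OF x1S(1) s(1) ox1])
  \<comment> \<open>Now that \<open>?\<beta>\<close> is \<open>\<alpha> s\<close>, an inverted root
    not orthogonal to it would have the uninverted root \<open>sr s \<gamma>\<close> in between,
    against \<open>T_mid\<close>.\<close>
  have perp: "\<gamma> \<bullet> \<alpha> s = 0" if g: "\<gamma> \<in> P" "N x \<gamma> > 0" for \<gamma>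
  proof (rule ccontr)
    assume ne: "\<gamma> \<bullet> \<alpha> s \<noteq> 0"
    have gK': "\<gamma> \<in> PK ?K" by (rule N_support[OF xK K'S g])
    then have gK: "\<gamma> \<in> PK K" using PK_mono[of ?K K] by blast
    have "\<gamma> \<bullet> \<alpha> s = (\<Sum>r\<in>?K. co r \<gamma> *\<^sub>R \<alpha> r) \<bullet> \<alpha> s" using VK_expand[OF K'S PK_VK[OF K'S gK']] by simp
    also have "\<dots> = (\<Sum>r\<in>?K. co r \<gamma> * (\<alpha> r \<bullet> \<alpha> s))" by (simp add: inner_sum_left)
    also have "\<dots> \<le> 0"
    proof (rule sum_nonpos)
      fix r assume "r \<in> ?K"
      then have "r \<in> S" "r \<noteq> s" using KS by auto
      then show "co r \<gamma> * (\<alpha> r \<bullet> \<alpha> s) \<le> 0"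
        using P_nn[OF g(1)] \<alpha>_inner_le[OF _ s(1)] by (simp add: mult_nonneg_nonpos)
    qed
    finally have "\<gamma> \<bullet> \<alpha> s < 0" using ne by simp
    then have k: "- cf s \<gamma> > 0" unfolding cf_def using \<alpha>_norm[OF s(1)] by (simp add: divide_neg_pos)
    let ?g = "(- cf s \<gamma>) *\<^sub>R \<alpha> s + 1 *\<^sub>R \<gamma>"
    have ge: "?g = sr s \<gamma>" by (simp add: sr_eq)
    have cg: "co s \<gamma> = 0" using gK' s unfolding PK_def by auto
    have cg2: "co s ?g > 0" using k cg s by (simp add: co_add co_scale co_\<alpha> co_diff co_neg)
    have gs: "\<gamma> \<noteq> \<alpha> s" using cg s by (auto simp: co_\<alpha>)
    have g2K: "?g \<in> PK K" unfolding ge by (rule refl_PK[OF KS s(2) gK gs])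
    have "?g \<noteq> \<alpha> s"
    proof
      assume "?g = \<alpha> s"
      then have "sr s (sr s \<gamma>) = sr s (\<alpha> s)" unfolding ge by simp
      then have "\<gamma> = - \<alpha> s" by (simp add: sr_self)
      then show False using P_neg[OF \<alpha>_P[OF s(1)]] g(1) by simp
    qed
    then have "?N ?g = 0" using N0[OF PK_P[OF g2K] _ cg2] bs by simp
    moreover have "T (?N (\<alpha> s)) (?N ?g) (?N \<gamma>)"
      by (rule ALD[OF al \<alpha>_PK[OF s(2) KS] gK k zero_less_one g2K om_init_nonneg[OF fE KS ini gK]])
    ultimately have "?N (\<alpha> s) = 0 \<or> ?N \<gamma> = 0" using T_mid by metis
    then show False using Nb bs g(2) Nge[of \<gamma>] by auto
  qed
  show ?thesis
  proof (rule ccontr)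
    assume "\<not> orth x s"
    then have ex: "\<exists>r\<in>set x. \<alpha> r \<bullet> \<alpha> s \<noteq> 0" using xK unfolding orth_def by blast
    obtain x' r y where y: "x = x' @ r # y" "\<alpha> r \<bullet> \<alpha> s \<noteq> 0" "\<forall>z\<in>set x'. \<not> \<alpha> z \<bullet> \<alpha> s \<noteq> 0"
      using split_list_first_prop[OF ex] by metis
    have r: "r \<in> S" and x'S: "set x' \<subseteq> S" using xS y by auto
    have "orth x' s" using y xK unfolding orth_def by auto
    then have xs: "act x' (\<alpha> s) = \<alpha> s" using orth_act(1)[OF x'S s(1)] by blast
    have x'R: "set (rev x') \<subseteq> S" using x'S by simp
    \<comment> \<open>The root inverted by the first letter not orthogonal to \<open>s\<close>: up
      to sign its product with \<open>\<alpha> s\<close> is that of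
      \<open>\<alpha> r\<close>.\<close>
    let ?g = "fold \<tau> (rev x') (\<alpha> r)"
    have gP: "?g \<in> P" by (rule fold_\<tau>_P[OF x'R \<alpha>_P[OF r]])
    have "fold \<tau> x' ?g = \<alpha> r" using fold_rev_\<tau>[OF x'R \<alpha>_P[OF r]] by simp
    then have "N x ?g > 0" by (simp add: y(1) N_append)
    then have "?g \<bullet> \<alpha> s = 0" by (rule perp[OF gP])
    moreover have "?g = act x' (\<alpha> r) \<or> ?g = - act x' (\<alpha> r)"
      using fold_\<tau>_act[OF x'R \<alpha>_P[OF r]] by (simp split: if_splits)
    moreover have "act x' (\<alpha> r) \<bullet> \<alpha> s = \<alpha> r \<bullet> \<alpha> s" using act_inner[of x' "\<alpha> r" "\<alpha> s"] xs by simp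
    ultimately show False using y(2) by auto
  qed
qed

text \<open>Repeats the sorting recursion of \<open>x\<close> with \<open>t\<close> carried along at
  the end; alignment survives by \<open>AL_rot\<close> and \<open>AL_subset\<close>. If the skipped
  letter is \<open>t\<close> itself, \<open>aligned_snoc_orth\<close> moves it to the front.\<close>

lemma aligned_snoc_sortable: "Srt K E x \<Longrightarrow> form E \<Longrightarrow> K \<subseteq> S \<Longrightarrow> t \<in> K \<Longrightarrow> AL K E (N (x @ [t])) \<Longrightarrow>
    \<exists>y. y \<approx>\<^sub>b x @ [t] \<and> Srt K E y"
proof (induction "length x + card K" arbitrary: x K E rule: less_induct)
  case less
  note fE = less.prems(2) and KS = less.prems(3)
  have cox: "Cox K E" by (rule Srt_Cox[OF less.prems(1-3)])
  then obtain s where ini: "init s K E" using less.prems(4) unfolding Cox_def by blast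
  have s: "s \<in> S" "s \<in> K" using ini KS by (auto simp: init_def)
  have fK: "finite K" by (rule finite_subset[OF KS finS])
  have fr: "form (rot s E)" by (rule form_rot[OF fE s(1)])
  have xS: "set (x @ [t]) \<subseteq> S" using Srt_set[OF less.prems(1)] KS less.prems(4) by auto
  have K'S: "K - {s} \<subseteq> S" using KS by blast
  from Srt_canonical[OF less.prems(1-3) ini] show ?case
  proof
    assume "\<exists>w'. x \<approx>\<^sub>b s # w' \<and> Srt K (rot s E) w'"
    then obtain w where w: "x \<approx>\<^sub>b s # w" "Srt K (rot s E) w" by blast
    have xw: "x @ [t] \<approx>\<^sub>b s # w @ [t]" using beq_append[OF w(1) beq_refl[of "[t]"]] by simp
    have "AL K E (N (s # w @ [t]))"
      by (rule AL_cong[OF less.prems(5)]) (rule beq_N[OF xw xS PK_P])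
    then have al: "AL K (rot s E) (N (w @ [t]))" using AL_rot[OF fE KS ini] by blast
    have "length w + card K < length x + card K" using beq_length[OF w(1)] by simp
    from less.hyps[OF this w(2) fr KS less.prems(4) al]
    obtain y where y: "y \<approx>\<^sub>b w @ [t]" "Srt K (rot s E) y" by blast
    have "s # y \<approx>\<^sub>b x @ [t]" by (rule beq_trans[OF beq_Cons[OF y(1)] beq_sym[OF xw]])
    then show ?thesis using Srt.use[OF ini y(2)] by blast
  next
    assume sx: "Srt (K - {s}) E x"
    show ?thesis
    proof (cases "t = s")
      case False
      have "length x + card (K - {s}) < length x + card K" using card_Diff1_less[OF fK s(2)] by simp
      moreover have "t \<in> K - {s}" using False less.prems by blast
      moreover have "AL (K - {s}) E (N (x @ [t]))" by (rule AL_subset[OF less.prems(5) Diff_subset])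
      ultimately obtain y where "y \<approx>\<^sub>b x @ [t]" "Srt (K - {s}) E y"
        using less.hyps[OF _ sx fE K'S] by blast
      then show ?thesis using Srt.skip[OF ini] by blast
    next
      case True
      have o: "orth x s" by (rule aligned_snoc_orth[OF fE KS ini sx]) (use less.prems(5) True in simp)
      have xs: "set x \<subseteq> S" using xS by simp
      have sw: "s # x \<approx>\<^sub>b x @ [s]" by (rule orth_act(3)[OF xs s(1) o])
      have ag: "agree (K - {s}) E (rot s E)" unfolding agree_def using rot_pair[OF fE KS ini] by simp
      have "Srt (K - {s}) (rot s E) x" by (rule Srt_cong[OF sx fE fr K'S ag])
      moreover have "Cox K (rot s E)" using Cox_rot[OF fE KS ini] cox by blast
      ultimately obtain y where y: "y \<approx>\<^sub>b x" "Srt K (rot s E) y"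
        using Srt_weaken[OF fr KS _ Diff_subset] by blast
      have "s # y \<approx>\<^sub>b x @ [t]" unfolding True by (rule beq_trans[OF beq_Cons[OF y(1)] sw])
      then show ?thesis using Srt.use[OF ini y(2)] by blast
    qed
  qed
qed

text \<open>A further letter of \<open>u\<close> adds one inversion, hence at most one letter to the
  prefix over \<open>J\<close>. \<open>Srt_JP\<close> provides the longer prefix, and
  \<open>aligned_snoc_sortable\<close> shows it sortable.\<close>

lemma sortable_parabolic_prefix: "form E \<Longrightarrow> K \<subseteq> S \<Longrightarrow> J \<subseteq> K \<Longrightarrow> Srt K E u \<Longrightarrow>
    \<exists>a. Srt J E a \<and> a \<preceq> u \<and> (\<forall>\<gamma>\<in>PK J. N a \<gamma> = N u \<gamma>)"
proof (induction u rule: rev_induct)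
  case Nil
  then have "Cox J E" using Srt_Cox Cox_subset by blast
  then show ?case using Srt.nil by (intro exI[of _ "[]"]) simp
next
  case (snoc q u)
  note fE = snoc.prems(1) and KS = snoc.prems(2) and JK = snoc.prems(3) and su = snoc.prems(4)
  have JS: "J \<subseteq> S" using KS JK by blast
  have "Srt K E u" using Srt_prefix[OF su fE KS] by blast
  from snoc.IH[OF fE KS JK this] obtain a0 where
    a0: "Srt J E a0" "a0 \<preceq> u" "\<forall>\<gamma>\<in>PK J. N a0 \<gamma> = N u \<gamma>" by blast
  have uS: "set (u @ [q]) \<subseteq> S" using Srt_set[OF su] KS by blast
  obtain a where a: "set a \<subseteq> J" "a \<preceq> u @ [q]" "\<forall>\<gamma>\<in>PK J. N a \<gamma> = N (u @ [q]) \<gamma>"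
    using Srt_JP[OF su fE KS] JS unfolding JP_def by blast
  have a0J: "set a0 \<subseteq> J" using Srt_set[OF a0(1)] .
  have a0u: "a0 \<preceq> u @ [q]" by (rule pre_trans[OF a0(2) pre_append])
  obtain l where l: "set l \<subseteq> J" "a0 \<preceq> l" "a \<preceq> l" "l \<preceq> u @ [q]"
    using upper_bound_in[OF JS uS a0u a(2) a0J a(1)] .
  have subS: "set l \<subseteq> S" "set a \<subseteq> S" "set a0 \<subseteq> S" using l(1) a(1) a0J JS by auto
  have lenJ: "length w = (\<Sum>\<gamma>\<in>PK J. N w \<gamma>)" if "set w \<subseteq> J" for w
  proof -
    have "(\<Sum>\<gamma>\<in>P. N w \<gamma>) = (\<Sum>\<gamma>\<in>PK J. N w \<gamma>)"
      by (rule sum.mono_neutral_right) (use finP N_notin_PK[OF that JS] PK_P in auto)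
    then show ?thesis using sum_N[of w] that JS by simp
  qed
  \<comment> \<open>\<open>a\<close> has all inversions of \<open>u @ [q]\<close> in the subsystem
    on \<open>J\<close>, so the common multiple \<open>l\<close> is no longer than \<open>a\<close>;
    this puts \<open>a0\<close> below \<open>a\<close>.\<close>
  have "length l \<le> length a"
    unfolding lenJ[OF l(1)] lenJ[OF a(1)]
    by (rule sum_mono) (use pre_N[OF l(4) uS PK_P] a(3) in simp)
  then have al: "a \<approx>\<^sub>b l" by (rule pre_length_eq[OF l(3)])
  have a0a: "a0 \<preceq> a" by (rule pre_trans[OF l(2) pre_beq[OF beq_sym[OF al]]])
  then obtain d where d: "a0 @ d \<approx>\<^sub>b a" unfolding pre_def by blast
  have dJ: "set d \<subseteq> J" using beq_set[OF d] a(1) by auto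
  have "length a \<le> length a0 + 1"
  proof -
    have fJ: "finite (PK J)" using finP finite_subset[of "PK J" P] PK_P by blast
    let ?g = "\<lambda>\<gamma>. N [q] (fold \<tau> u \<gamma>)"
    have "(\<Sum>\<gamma>\<in>PK J. ?g \<gamma>) \<le> (\<Sum>\<gamma>\<in>P. ?g \<gamma>)"
      by (rule sum_mono2) (use finP PK_P in auto)
    also have "\<dots> = (\<Sum>\<gamma>\<in>P. N [q] \<gamma>)"
      by (rule sum.reindex_bij_betw[OF fold_\<tau>_bij]) (use uS in simp)
    also have "\<dots> = 1" using sum_N[of "[q]"] uS by simp
    finally have "(\<Sum>\<gamma>\<in>PK J. ?g \<gamma>) \<le> 1" .
    moreover have "length a = (\<Sum>\<gamma>\<in>PK J. N a0 \<gamma> + ?g \<gamma>)"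
      unfolding lenJ[OF a(1)] by (rule sum.cong[OF refl]) (use a(3) a0(3) in \<open>simp add: N_append\<close>)
    ultimately show ?thesis unfolding sum.distrib lenJ[OF a0J, symmetric] by simp
  qed
  then have "length d \<le> 1" using beq_length[OF d] by simp
  then consider "d = []" | t where "d = [t]" by (cases d) auto
  then show ?case
  proof cases
    case 1
    then have d0: "a0 \<approx>\<^sub>b a" using d by simp
    have "N a0 \<gamma> = N (u @ [q]) \<gamma>" if "\<gamma> \<in> PK J" for \<gamma>
      using beq_N[OF d0 subS(3) PK_P[OF that]] a(3) that by simp
    then show ?thesis using a0(1) a0u by blast
  next
    case 2
    have tJ: "t \<in> J" using dJ 2 by simp
    have dt: "a0 @ [t] \<approx>\<^sub>b a" using d 2 by simp
    have Nt: "N (a0 @ [t]) \<gamma> = N (u @ [q]) \<gamma>" if "\<gamma> \<in> PK J" for \<gamma>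
      using beq_N[OF dt _ PK_P[OF that]] subS tJ JS a(3) that by auto
    have "AL J E (N (u @ [q]))" by (rule AL_subset[OF Srt_AL[OF su fE KS] JK])
    then have "AL J E (N (a0 @ [t]))" by (rule AL_cong) (simp only: Nt)
    from aligned_snoc_sortable[OF a0(1) fE JS tJ this] obtain y where
      y: "y \<approx>\<^sub>b a0 @ [t]" "Srt J E y" by blast
    have ya: "y \<approx>\<^sub>b a" by (rule beq_trans[OF y(1) dt])
    have "y \<preceq> u @ [q]" by (rule pre_trans[OF pre_beq[OF ya] a(2)])
    moreover have "N y \<gamma> = N (u @ [q]) \<gamma>" if "\<gamma> \<in> PK J" for \<gamma>
      using beq_N[OF ya _ PK_P[OF that]] beq_set[OF ya] subS a(3) that by simp
    ultimately show ?thesis using y(2) by blast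
  qed
qed

subsection \<open>Meets of sortable words\<close>

lemma min_outside: assumes "K \<subseteq> S" "set a \<subseteq> K" "set g \<subseteq> K"
  and "\<And>\<beta>. \<beta> \<in> PK K \<Longrightarrow> N g \<beta> = min (N a \<beta>) (f \<beta>)" "\<beta> \<in> P"
  shows "N g \<beta> = min (N a \<beta>) (f \<beta>)"
proof (cases "\<beta> \<in> PK K")
  case False
  then show ?thesis using N_notin_PK[OF assms(2,1,5)] N_notin_PK[OF assms(3,1,5)] by simp
qed (rule assms(4))

text \<open>The measure includes \<open>card K\<close> because skipping \<open>s\<close> need not
  shorten either word.\<close>

lemma sortable_common_prefix: "form E \<Longrightarrow> K \<subseteq> S \<Longrightarrow> Srt K E w \<Longrightarrow> Srt K E u \<Longrightarrow>
    \<exists>g. g \<preceq> w \<and> g \<preceq> u \<and> (\<forall>\<beta>\<in>P. N g \<beta> = min (N w \<beta>) (N u \<beta>))"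
proof (induction "length w + length u + card K" arbitrary: w u K E rule: less_induct)
  case less
  note fE = less.prems(1) and KS = less.prems(2)
  have fK: "finite K" by (rule finite_subset[OF KS finS])
  show ?case
  proof (cases "K = {}")
    case True
    then have "w = []" using Srt_set[OF less.prems(3)] by simp
    then show ?thesis by (intro exI[of _ "[]"]) simp
  next
    case False
    then obtain s where ini: "init s K E" using Srt_Cox[OF less.prems(3) fE KS] unfolding Cox_def by blast
    have s: "s \<in> S" "s \<in> K" using ini KS by (auto simp: init_def)
    have fr: "form (rot s E)" by (rule form_rot[OF fE s(1)])
    let ?J = "K - {s}"
    have JS: "?J \<subseteq> S" using KS by blast
    have cJ: "card ?J < card K" using card_Diff1_less[OF fK s(2)] .
    have wS: "set w \<subseteq> S" "set u \<subseteq> S" using Srt_set less.prems by blast+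
    have mixed: "\<exists>g. g \<preceq> x \<and> g \<preceq> y \<and> (\<forall>\<beta>\<in>P. N g \<beta> = min (N x \<beta>) (N y \<beta>))"
      if x: "Srt ?J E x" and y: "Srt K E y" and xy: "length x + length y = length w + length u" for x y
    proof -
      obtain a where a: "Srt ?J E a" "a \<preceq> y" "\<forall>\<gamma>\<in>PK ?J. N a \<gamma> = N y \<gamma>"
        using sortable_parabolic_prefix[OF fE KS Diff_subset y] by blast
      have "length x + length a + card ?J < length w + length u + card K"
        using pre_length[OF a(2)] xy cJ by simp
      from less.hyps[OF this fE JS x a(1)] obtain g where
        g: "g \<preceq> x" "g \<preceq> a" "\<forall>\<beta>\<in>P. N g \<beta> = min (N x \<beta>) (N a \<beta>)" by blast
      have xJ: "set x \<subseteq> ?J" using Srt_set[OF x] .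
      have gJ: "set g \<subseteq> ?J" using pre_set[OF g(1)] xJ by blast
      \<comment> \<open>Outside the subsystem on \<open>?J\<close> neither \<open>g\<close> nor
        \<open>x\<close> has inversions, and inside it \<open>a\<close> counts like
        \<open>y\<close>.\<close>
      have "N g \<beta> = min (N x \<beta>) (N y \<beta>)" if "\<beta> \<in> P" for \<beta>
        by (rule min_outside[OF JS xJ gJ _ that]) (use g(3) a(3) PK_P in auto)
      then show ?thesis using g(1) pre_trans[OF g(2) a(2)] by blast
    qed
    note cw = Srt_canonical[OF less.prems(3) fE KS ini] and cu = Srt_canonical[OF less.prems(4) fE KS ini]
    show ?thesis
    proof (cases "Srt ?J E w \<or> Srt ?J E u")
      case True
      then show ?thesis
      proof
        assume "Srt ?J E w"
        from mixed[OF this less.prems(4)] show ?thesis by simp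
      next
        assume "Srt ?J E u"
        from mixed[OF this less.prems(3)] obtain g where
          g: "g \<preceq> u" "g \<preceq> w" "\<forall>\<beta>\<in>P. N g \<beta> = min (N u \<beta>) (N w \<beta>)" by auto
        then show ?thesis by (intro exI[of _ g]) (simp add: min.commute)
      qed
    next
      case False
      obtain w' where w': "w \<approx>\<^sub>b s # w'" "Srt K (rot s E) w'" using cw False by blast
      obtain u' where u': "u \<approx>\<^sub>b s # u'" "Srt K (rot s E) u'" using cu False by blast
      have "length w' + length u' + card K < length w + length u + card K"
        using beq_length[OF w'(1)] beq_length[OF u'(1)] by simp
      from less.hyps[OF this fr KS w'(2) u'(2)] obtain g where
        g: "g \<preceq> w'" "g \<preceq> u'" "\<forall>\<beta>\<in>P. N g \<beta> = min (N w' \<beta>) (N u' \<beta>)" by blast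
      have "N (s # g) \<beta> = min (N w \<beta>) (N u \<beta>)" if b: "\<beta> \<in> P" for \<beta>
        unfolding beq_N[OF w'(1) wS(1) b] beq_N[OF u'(1) wS(2) b]
        using g(3) \<tau>_P[OF s(1) b] by simp
      moreover have "s # g \<preceq> w" by (rule pre_trans[OF pre_Cons[OF g(1)] pre_beq[OF beq_sym[OF w'(1)]]])
      moreover have "s # g \<preceq> u" by (rule pre_trans[OF pre_Cons[OF g(2)] pre_beq[OF beq_sym[OF u'(1)]]])
      ultimately show ?thesis by blast
    qed
  qed
qed

lemma pre_N_eq: assumes "x \<preceq> y" "set y \<subseteq> S" "\<And>\<beta>. \<beta> \<in> P \<Longrightarrow> N y \<beta> \<le> N x \<beta>" shows "x \<approx>\<^sub>b y"
proof (rule pre_length_eq[OF assms(1)])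
  have xS: "set x \<subseteq> S" using pre_set[OF assms(1)] assms(2) by blast
  show "length y \<le> length x" unfolding sum_N[OF xS, symmetric] sum_N[OF assms(2), symmetric]
    by (rule sum_mono) (rule assms(3))
qed

text \<open>\<open>g\<close> is a prefix of the greatest common prefix \<open>d\<close>, and
  \<open>N d\<close> is bounded by the minimum \<open>N g\<close>, so the two agree.\<close>

theorem sortable_meet: assumes "form E" "Srt S E w" "Srt S E u"
  obtains g where "g \<preceq> w" "g \<preceq> u" "\<forall>x. x \<preceq> w \<longrightarrow> x \<preceq> u \<longrightarrow> x \<preceq> g"
    "\<forall>\<beta>\<in>P. N g \<beta> = min (N w \<beta>) (N u \<beta>)"
proof -
  have S: "set w \<subseteq> S" "set u \<subseteq> S" using Srt_set assms by blast+
  obtain g where g: "g \<preceq> w" "g \<preceq> u" "\<forall>\<beta>\<in>P. N g \<beta> = min (N w \<beta>) (N u \<beta>)"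
    using sortable_common_prefix[OF assms(1) subset_refl assms(2,3)] by blast
  obtain d where d: "d \<preceq> w" "d \<preceq> u" "\<And>x. x \<preceq> w \<Longrightarrow> x \<preceq> u \<Longrightarrow> x \<preceq> d"
    by (rule gcd_exists[OF S], rule that) blast+
  have dS: "set d \<subseteq> S" using pre_set[OF d(1)] S by blast
  have "g \<approx>\<^sub>b d"
    by (rule pre_N_eq[OF d(3)[OF g(1,2)] dS]) (use pre_N[OF d(1) S(1)] pre_N[OF d(2) S(2)] g(3) in simp)
  then have "x \<preceq> g" if "x \<preceq> w" "x \<preceq> u" for x
    using pre_trans[OF d(3)[OF that] pre_beq[OF beq_sym]] by blast
  then show ?thesis using that[of g] g by blast
qed

text \<open>For the converse, the common prefix with minimal counts has all inversions of
  \<open>w\<close>, hence its length.\<close>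

theorem sortable_prefix_iff: assumes "form E" "Srt S E w" "Srt S E u"
  shows "w \<preceq> u \<longleftrightarrow> (\<forall>\<beta>\<in>P. N w \<beta> \<le> N u \<beta>)"
proof
  have S: "set w \<subseteq> S" "set u \<subseteq> S" using Srt_set assms by blast+
  show "w \<preceq> u \<Longrightarrow> \<forall>\<beta>\<in>P. N w \<beta> \<le> N u \<beta>" using pre_N S by blast
  assume le: "\<forall>\<beta>\<in>P. N w \<beta> \<le> N u \<beta>"
  obtain g where g: "g \<preceq> w" "g \<preceq> u" "\<forall>\<beta>\<in>P. N g \<beta> = min (N w \<beta>) (N u \<beta>)"
    using sortable_common_prefix[OF assms(1) subset_refl assms(2,3)] by blast
  have "g \<approx>\<^sub>b w" by (rule pre_N_eq[OF g(1) S(1)]) (use g(3) le in simp)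
  then show "w \<preceq> u" by (rule pre_trans[OF pre_beq[OF beq_sym] g(2)])
qed

end

subsection \<open>Sorting words\<close>

lemma lexord_less_linear: "xs = ys \<or> (xs, ys) \<in> lexord {(i, j). i < j} \<or> (ys, xs) \<in> lexord {(i, j). i < (j::nat)}"
proof (induction xs arbitrary: ys)
  case Nil
  then show ?case by (cases ys) auto
next
  case (Cons a xs)
  show ?case
  proof (cases ys)
    case (Cons b ys')
    then show ?thesis using Cons.IH[of ys'] by (auto simp: neq_iff)
  qed simp
qed

text \<open>\<open>lexord\<close> is not well-founded in general; on lists of one length it is
  contained in the well-founded \<open>lenlex\<close>.\<close>

lemma lex_least_exists: assumes "A \<noteq> {}" "\<And>x. x \<in> A \<Longrightarrow> length x = n"
  shows "\<exists>!x. x \<in> A \<and> (\<forall>y\<in>A. y = x \<or> (x, y) \<in> lexord {(i, j). i < (j::nat)})"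
proof -
  let ?r = "{(i, j). i < (j::nat)}"
  have wr: "wf ?r" by (rule wf_less)
  then have "wf (lenlex ?r)" by (rule wf_lenlex)
  then obtain x where x: "x \<in> A" "\<And>y. (y, x) \<in> lenlex ?r \<Longrightarrow> y \<notin> A"
    using wfE_min assms(1) by (metis ex_in_conv)
  have least: "y = x \<or> (x, y) \<in> lexord ?r" if y: "y \<in> A" for y
  proof (rule ccontr)
    assume n: "\<not> (y = x \<or> (x, y) \<in> lexord ?r)"
    then have "(y, x) \<in> lexord ?r" using lexord_less_linear[of y x] by blast
    then have "(y, x) \<in> lex ?r" unfolding lexord_lex using assms(2)[OF y] assms(2)[OF x(1)] by simp
    then have "(y, x) \<in> lenlex ?r" using assms(2)[OF y] assms(2)[OF x(1)] by (simp add: lenlex_conv)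
    then show False using x(2) y by blast
  qed
  have "asym ?r" by (auto intro: asymI)
  then have asy: "asym (lexord ?r)" by (rule lexord_asym)
  show ?thesis
  proof (rule ex1I[of _ x])
    show "x \<in> A \<and> (\<forall>y\<in>A. y = x \<or> (x, y) \<in> lexord ?r)" using x(1) least by blast
    fix z assume z: "z \<in> A \<and> (\<forall>y\<in>A. y = z \<or> (z, y) \<in> lexord ?r)"
    show "z = x"
    proof (rule ccontr)
      assume ne: "z \<noteq> x"
      then have "(z, x) \<in> lexord ?r" using z x(1) by metis
      moreover have "(x, z) \<in> lexord ?r" using least[of z] z ne by blast
      ultimately show False using asy by (meson asymD)
    qed
  qed
qed

text \<open>Takes one letter from each copy of \<open>cs\<close>, beginning with copy
  \<open>k\<close>.\<close>

lemma subword_positions_exist: assumes "cs \<noteq> []" "set v \<subseteq> set cs"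
  shows "\<exists>is. sorted_wrt (<) is \<and> (\<forall>i\<in>set is. k * length cs \<le> i) \<and> map (\<lambda>i. cs ! (i mod length cs)) is = v"
  using assms(2)
proof (induction v arbitrary: k)
  case (Cons a v)
  let ?n = "length cs"
  obtain j where j: "j < ?n" "cs ! j = a" using Cons.prems by (auto simp: in_set_conv_nth)
  have "set v \<subseteq> set cs" using Cons.prems by simp
  from Cons.IH[OF this, of "Suc k"] obtain js where
    js: "sorted_wrt (<) js" "\<forall>i\<in>set js. Suc k * ?n \<le> i" "map (\<lambda>i. cs ! (i mod ?n)) js = v" by blast
  have lt: "k * ?n + j < i" if "i \<in> set js" for i
  proof -
    have "Suc k * ?n \<le> i" using js(2) that by blast
    then show ?thesis using j(1) by simp
  qed
  have le: "k * ?n \<le> i" if "i \<in> set js" for i using lt[OF that] by simp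
  show ?case
    by (rule exI[of _ "(k * ?n + j) # js"]) (use j js lt le in \<open>auto\<close>)
qed simp

context positive_roots_datum
begin

text \<open>Advances one position at a time: the first letter of \<open>cs\<close> goes to the end
  and all positions drop by one, in step with \<open>rot\<close> when the letter is used.
  \<open>K\<close> collects the letters not yet skipped.\<close>

lemma Srt_of_positions:
  assumes "form E" "distinct cs" "K \<subseteq> S" "K \<subseteq> set cs" "sorted_wrt (<) is"
    and "\<And>i. i + length cs \<in> set is \<Longrightarrow> i \<in> set is"
    and "\<And>i. i \<in> set is \<Longrightarrow> cs ! (i mod length cs) \<in> K"
    and "\<And>i j. i < j \<Longrightarrow> j < length cs \<Longrightarrow> cs ! i \<in> K \<Longrightarrow> cs ! j \<in> K \<Longrightarrow> E (\<alpha> (cs ! i)) (\<alpha> (cs ! j)) = 0"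
    and "\<And>i. i \<in> set is \<Longrightarrow> i < M"
  shows "Srt K E (map (\<lambda>i. cs ! (i mod length cs)) is)"
  using assms
proof (induction M arbitrary: cs K E "is")
  case 0
  have e: "is = []" using 0(9)[of "hd is"] by (cases "is") auto
  have "Cox K E" unfolding Cox_def
  proof (intro allI impI)
    fix K' assume K': "K' \<subseteq> K" "K' \<noteq> {}"
    define i where "i = (LEAST i. i < length cs \<and> cs ! i \<in> K')"
    have "\<exists>i. i < length cs \<and> cs ! i \<in> K'"
    proof -
      obtain a where "a \<in> K'" using K' by blast
      then show ?thesis using 0(4) K' by (metis in_set_conv_nth subsetD)
    qed
    then have i: "i < length cs" "cs ! i \<in> K'" unfolding i_def by (metis (mono_tags, lifting) LeastI_ex)+
    have "init (cs ! i) K' E" unfolding init_def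
    proof (intro conjI ballI)
      fix r assume r: "r \<in> K' - {cs ! i}"
      then obtain j where j: "j < length cs" "r = cs ! j" using 0(4) K' by (metis DiffD1 in_set_conv_nth subsetD)
      have "i \<le> j" unfolding i_def by (rule Least_le) (use j r in simp)
      moreover have "i \<noteq> j" using r j by auto
      ultimately show "E (\<alpha> (cs ! i)) (\<alpha> r) = 0" using 0(8)[of i j] i j r K' by auto
    qed (rule i)
    then show "\<exists>s. init s K' E" by blast
  qed
  then show ?case unfolding e using Srt.nil by simp
next
  case (Suc M)
  note fE = Suc.prems(1) and dc = Suc.prems(2) and KS = Suc.prems(3) and Kc = Suc.prems(4) and so = Suc.prems(5)
    and per = Suc.prems(6) and ltr = Suc.prems(7) and rel = Suc.prems(8) and bnd = Suc.prems(9)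
  show ?case
  proof (cases "cs = []")
    case True
    then have K0: "K = {}" using Kc by simp
    then have "is = []" using ltr by (cases "is") auto
    then show ?thesis using K0 Srt.nil[of "{}" E] by (simp add: Cox_def)
  next
    case False
    then obtain s cs' where cs: "cs = s # cs'" by (meson neq_Nil_conv)
    let ?n = "length cs" and ?ds = "cs' @ [s]"
    have n: "?n > 0" "length ?ds = ?n" "set ?ds = set cs" "distinct ?ds" using cs dc by auto
    have rotn: "?ds ! (i mod ?n) = cs ! (Suc i mod ?n)" for i
    proof (cases "Suc (i mod ?n) = ?n")
      case True
      then have "Suc i mod ?n = 0" by (simp add: mod_Suc)
      moreover have "?ds ! (i mod ?n) = s" using True cs by (simp add: nth_append)
      ultimately show ?thesis using cs by simp
    next
      case False
      then have lt: "Suc (i mod ?n) < ?n" using n(1) by (metis Suc_lessI mod_less_divisor)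
      have "Suc i mod ?n = Suc (i mod ?n)" using False by (simp add: mod_Suc)
      moreover have "?ds ! (i mod ?n) = cs ! Suc (i mod ?n)" using lt cs by (simp add: nth_append)
      ultimately show ?thesis by simp
    qed
    have ini: "init s K E" if sK: "s \<in> K"
      unfolding init_def
    proof (intro conjI ballI)
      fix r assume r: "r \<in> K - {s}"
      then obtain j where j: "j < ?n" "r = cs ! j" using Kc by (metis DiffD1 in_set_conv_nth subsetD)
      have "j \<noteq> 0" using r j cs by (cases j) auto
      then show "E (\<alpha> s) (\<alpha> r) = 0" using rel[of 0 j] j r sK cs by auto
    qed (rule sK)
    have nxt: "?ds ! i = cs ! Suc i" if "Suc i < ?n" for i using that cs by (simp add: nth_append)
    have lst: "?ds ! i = s" if "Suc i = ?n" for i using that cs by (simp add: nth_append)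
    show ?thesis
    proof (cases "0 \<in> set is")
      case True
      then obtain is' where isd: "is = 0 # is'" using so by (cases "is") auto
      have pos: "i > 0" if "i \<in> set is'" for i using so isd that by auto
      let ?js = "map (\<lambda>i. i - 1) is'"
      have sK: "s \<in> K" using ltr[OF True] cs by simp
      note ini' = ini[OF sK]
      have sS: "s \<in> S" using sK KS by blast
      have mem: "i \<in> set ?js \<longleftrightarrow> Suc i \<in> set is" for i
      proof
        assume "i \<in> set ?js"
        then obtain j where j: "j \<in> set is'" "i = j - 1" by auto
        then have "Suc i = j" using pos[OF j(1)] by simp
        then show "Suc i \<in> set is" using j(1) isd by simp
      next
        assume "Suc i \<in> set is"
        then have "Suc i \<in> set is'" using isd by simp
        then show "i \<in> set ?js" by force
      qed
      have "Srt K (rot s E) (map (\<lambda>i. ?ds ! (i mod length ?ds)) ?js)"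
      proof (rule Suc.IH)
        show "form (rot s E)" by (rule form_rot[OF fE sS])
        show "distinct ?ds" "K \<subseteq> S" "K \<subseteq> set ?ds" using n KS Kc by auto
        show "sorted_wrt (<) ?js"
          unfolding sorted_wrt_map
        proof (rule sorted_wrt_mono_rel[of is' "(<)"])
          show "sorted_wrt (<) is'" using so isd by simp
          fix x y assume "x \<in> set is'" "x < y"
          then show "x - 1 < y - 1" using pos[of x] by linarith
        qed
        fix i
        show "i \<in> set ?js" if "i + length ?ds \<in> set ?js"
        proof -
          have "Suc i + ?n \<in> set is" using that unfolding mem n(2) by simp
          then show ?thesis using per mem by blast
        qed
        show "?ds ! (i mod length ?ds) \<in> K" if "i \<in> set ?js"
          unfolding n(2) rotn by (rule ltr) (use that mem in blast)
        show "i < M" if "i \<in> set ?js" using bnd[of "Suc i"] that mem by auto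
        fix j assume ij: "i < j" "j < length ?ds" "?ds ! i \<in> K" "?ds ! j \<in> K"
        have i: "?ds ! i = cs ! Suc i" "Suc i < ?n" using nxt ij n(2) by auto
        have isn: "cs ! Suc i \<noteq> s" using i(2) dc cs by (auto simp: in_set_conv_nth)
        show "rot s E (\<alpha> (?ds ! i)) (\<alpha> (?ds ! j)) = 0"
        proof (cases "Suc j = ?n")
          case True
          then show ?thesis using rot_final[OF fE KS ini'] lst i isn ij(3) by (auto simp: final_def)
        next
          case False
          then have j: "?ds ! j = cs ! Suc j" "Suc j < ?n" using nxt ij n(2) by auto
          have js: "cs ! Suc j \<noteq> s" using j(2) dc cs by (auto simp: in_set_conv_nth)
          have "rot s E (\<alpha> (?ds ! i)) (\<alpha> (?ds ! j)) = E (\<alpha> (?ds ! i)) (\<alpha> (?ds ! j))"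
            by (rule rot_pair[OF fE KS ini']) (use ij i j isn js in auto)
          then show ?thesis using rel[of "Suc i" "Suc j"] i j ij by auto
        qed
      qed
      then have "Srt K (rot s E) (map (\<lambda>i. cs ! (Suc i mod ?n)) ?js)" unfolding n(2) rotn .
      moreover have "map (\<lambda>i. cs ! (Suc i mod ?n)) ?js = map (\<lambda>i. cs ! (i mod ?n)) is'"
        using pos by simp
      ultimately have "Srt K (rot s E) (map (\<lambda>i. cs ! (i mod ?n)) is')" by (simp only:)
      then have "Srt K E (s # map (\<lambda>i. cs ! (i mod ?n)) is')" by (rule Srt.use[OF ini'])
      then show ?thesis unfolding isd using cs by simp
    next
      case False
      have mult: "k * ?n \<notin> set is" for k
      proof (induction k)
        case (Suc k)
        then show ?case using per[of "k * ?n"] by (auto simp: add.commute)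
      qed (use False in simp)
      have nos: "cs ! (i mod ?n) \<noteq> s" if i: "i \<in> set is" for i
      proof
        assume e: "cs ! (i mod ?n) = s"
        have "i mod ?n < ?n" using n by simp
        then have "i mod ?n = 0" using e dc cs nth_eq_iff_index_eq[OF dc, of "i mod ?n" 0] by simp
        then have "i = (i div ?n) * ?n" by (metis add.right_neutral div_mult_mod_eq)
        then show False using mult i by metis
      qed
      have pos: "i > 0" if "i \<in> set is" for i using False that by (cases i) auto
      let ?js = "map (\<lambda>i. i - 1) is" and ?K = "K - {s}"
      have mem: "i \<in> set ?js \<longleftrightarrow> Suc i \<in> set is" for i
      proof
        assume "i \<in> set ?js"
        then obtain j where j: "j \<in> set is" "i = j - 1" by auto
        then have "Suc i = j" using pos[OF j(1)] by simp
        then show "Suc i \<in> set is" using j(1) by simp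
      next
        assume "Suc i \<in> set is"
        then show "i \<in> set ?js" by force
      qed
      have "Srt ?K E (map (\<lambda>i. ?ds ! (i mod length ?ds)) ?js)"
      proof (rule Suc.IH)
        show "form E" by (rule fE)
        show "distinct ?ds" "?K \<subseteq> S" "?K \<subseteq> set ?ds" using n KS Kc by auto
        show "sorted_wrt (<) ?js"
          unfolding sorted_wrt_map
        proof (rule sorted_wrt_mono_rel[of "is" "(<)"])
          show "sorted_wrt (<) is" by (rule so)
          fix x y assume "x \<in> set is" "x < y"
          then show "x - 1 < y - 1" using pos[of x] by linarith
        qed
        fix i
        show "i \<in> set ?js" if "i + length ?ds \<in> set ?js"
        proof -
          have "Suc i + ?n \<in> set is" using that unfolding mem n(2) by simp
          then show ?thesis using per mem by blast
        qed
        show "?ds ! (i mod length ?ds) \<in> ?K" if "i \<in> set ?js"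
          unfolding n(2) rotn using ltr nos that mem by blast
        show "i < M" if "i \<in> set ?js" using bnd[of "Suc i"] that mem by auto
        fix j assume ij: "i < j" "j < length ?ds" "?ds ! i \<in> ?K" "?ds ! j \<in> ?K"
        have i: "?ds ! i = cs ! Suc i" "Suc i < ?n" using nxt ij n(2) by auto
        have "Suc j \<noteq> ?n" using lst[of j] ij(4) by auto
        then have j: "?ds ! j = cs ! Suc j" "Suc j < ?n" using nxt ij n(2) by auto
        show "E (\<alpha> (?ds ! i)) (\<alpha> (?ds ! j)) = 0" using rel[of "Suc i" "Suc j"] i j ij by auto
      qed
      then have "Srt ?K E (map (\<lambda>i. cs ! (Suc i mod ?n)) ?js)" unfolding n(2) rotn .
      moreover have "map (\<lambda>i. cs ! (Suc i mod ?n)) ?js = map (\<lambda>i. cs ! (i mod ?n)) is"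
        using pos by simp
      ultimately have S': "Srt ?K E (map (\<lambda>i. cs ! (i mod ?n)) is)" by (simp only:)
      show ?thesis
      proof (cases "s \<in> K")
        case True
        show ?thesis by (rule Srt.skip[OF ini[OF True] S'])
      next
        case False
        then have "?K = K" by blast
        then show ?thesis using S' by simp
      qed
    qed
  qed
qed

section \<open>The Euler form of an ordering of the simple reflections\<close>

definition before :: "'a list \<Rightarrow> 'a \<Rightarrow> 'a \<Rightarrow> bool" where
  "before cs a b \<longleftrightarrow> (\<exists>i j. i < j \<and> j < length cs \<and> cs ! i = a \<and> cs ! j = b)"

text \<open>Half the norm on the diagonal makes the symmetrization equal to the inner
  product.\<close>

definition cox_form :: "'a list \<Rightarrow> 'v \<Rightarrow> 'v \<Rightarrow> real" where
  "cox_form cs x y = (\<Sum>a\<in>S. \<Sum>b\<in>S. co a x * co b y *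
     (if a = b then (\<alpha> a \<bullet> \<alpha> a) / 2
      else if before cs a b then 0 else \<alpha> a \<bullet> \<alpha> b))"

lemma cox_form_simple: assumes "a \<in> S" "b \<in> S"
  shows "cox_form cs (\<alpha> a) (\<alpha> b) = (if a = b then (\<alpha> a \<bullet> \<alpha> a) / 2
      else if before cs a b then 0 else \<alpha> a \<bullet> \<alpha> b)"
    (is "_ = ?M a b")
proof -
  have "cox_form cs (\<alpha> a) (\<alpha> b) = (\<Sum>x\<in>S. \<Sum>y\<in>S. if y = b then (if x = a then ?M a b else 0) else 0)"
    unfolding cox_form_def using assms by (intro sum.cong refl) (simp add: co_\<alpha>)
  also have "\<dots> = ?M a b" using assms finS by (simp add: sum.delta)
  finally show ?thesis .
qed

lemma bilinear_cox_form: "bilinear (cox_form cs)"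
  unfolding bilinear_def cox_form_def
  by (intro conjI allI linearI)
    (simp_all add: co_add co_scale algebra_simps sum.distrib sum_distrib_left cong: sum.cong)

lemma form_cox_form: assumes "distinct cs" "set cs = S" shows "form (cox_form cs)"
  unfolding form_def
proof (intro conjI ballI)
  show b: "bilinear (cox_form cs)" by (rule bilinear_cox_form)
  fix x y assume xy: "x \<in> VK S" "y \<in> VK S"
  let ?F = "\<lambda>x y. cox_form cs x y + cox_form cs y x"
  show "?F x y = x \<bullet> y"
  proof (rule bilinear_eq[of ?F inner "VK S" "\<alpha> ` S" "VK S" "\<alpha> ` S"])
    show "bilinear ?F" using b unfolding bilinear_def by (auto intro: linear_compose_add)
    show "bilinear (inner :: 'v \<Rightarrow> 'v \<Rightarrow> real)"
      using bilinear_conv_bounded_bilinear bounded_bilinear_inner by blast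
    fix u v assume "u \<in> \<alpha> ` S" "v \<in> \<alpha> ` S"
    then obtain a c where ac: "a \<in> S" "c \<in> S" "u = \<alpha> a" "v = \<alpha> c" by blast
    show "?F u v = u \<bullet> v"
    proof (cases "a = c")
      case True
      then show ?thesis using ac by (simp add: cox_form_simple)
    next
      case False
      obtain i j where ij: "i < length cs" "cs ! i = a" "j < length cs" "cs ! j = c"
        using ac assms(2) by (metis in_set_conv_nth)
      have uniq: "before cs (cs ! k) (cs ! l) \<longleftrightarrow> k < l"
        if "k < length cs" "l < length cs" for k l
        unfolding before_def
      proof
        assume "\<exists>i' j'. i' < j' \<and> j' < length cs \<and> cs ! i' = cs ! k \<and> cs ! j' = cs ! l"
        then obtain i' j' where "i' < j'" "j' < length cs" "cs ! i' = cs ! k" "cs ! j' = cs ! l" by blast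
        then show "k < l" using nth_eq_iff_index_eq[OF assms(1)] that by (metis order_less_trans)
      qed (use that in blast)
      have "i \<noteq> j" using ij False by auto
      then consider "i < j" "\<not> j < i" | "j < i" "\<not> i < j" by linarith
      then show ?thesis
        using cox_form_simple[OF ac(1,2), of cs] cox_form_simple[OF ac(2,1), of cs]
          uniq[OF ij(1,3)] uniq[OF ij(3,1)] False
        unfolding ac(3,4) ij(2,4) by cases (simp_all add: inner_commute)
    qed
  qed (use xy in \<open>auto simp: VK_def\<close>)
qed

lemma Srt_of_sortable_positions:
  assumes "distinct cs" "set cs = S" "sorted_wrt (<) is"
    and "\<And>i. i + length cs \<in> set is \<Longrightarrow> i \<in> set is" and "set (map (\<lambda>i. cs ! (i mod length cs)) is) \<subseteq> S"
  shows "Srt S (cox_form cs) (map (\<lambda>i. cs ! (i mod length cs)) is)"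
proof (rule Srt_of_positions)
  show "form (cox_form cs)" by (rule form_cox_form[OF assms(1,2)])
  show "S \<subseteq> S" "S \<subseteq> set cs" using assms by auto
  fix i
  show "cs ! (i mod length cs) \<in> S" if "i \<in> set is" using assms(5) that by auto
  show "i < Suc (Max (set is))" if "i \<in> set is" using that by (simp add: less_Suc_eq_le)
  show "cox_form cs (\<alpha> (cs ! i)) (\<alpha> (cs ! j)) = 0" if ij: "i < j" "j < length cs" "cs ! i \<in> S" "cs ! j \<in> S" for j
  proof -
    have "cs ! i \<noteq> cs ! j" using nth_eq_iff_index_eq[OF assms(1)] ij by auto
    moreover have "before cs (cs ! i) (cs ! j)" using ij unfolding before_def by blast
    ultimately show ?thesis using cox_form_simple[OF ij(3,4), of cs] by simp
  qed
qed (use assms in auto)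

subsection \<open>Colored inversions\<close>

lemma colored_sequence_Cons: "colored_inversion_sequence \<alpha> (s # v)
    = (\<alpha> s, 0) # map (colored_act \<alpha> s) (colored_inversion_sequence \<alpha> v)"
  unfolding colored_inversion_sequence_def
  by (simp add: upt_conv_Cons map_Suc_upt[symmetric] del: upt_Suc map_Suc_upt)

text \<open>Putting \<open>s\<close> in front gives \<open>\<alpha> s\<close> the color 0 and raises
  its old colors by one, so the colors at each root always fill an initial segment.\<close>

lemma colored_sequence_set: "set v \<subseteq> S \<Longrightarrow>
    set (colored_inversion_sequence \<alpha> v) = {(\<beta>, k). \<beta> \<in> P \<and> k < N v \<beta>}"
proof (induction v)
  case (Cons s v)
  have s: "s \<in> S" using Cons.prems by simp
  have IH: "set (colored_inversion_sequence \<alpha> v) = {(\<beta>, k). \<beta> \<in> P \<and> k < N v \<beta>}" using Cons by simp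
  have "(\<beta>, k) \<in> insert (\<alpha> s, 0) (colored_act \<alpha> s ` {(\<beta>, k). \<beta> \<in> P \<and> k < N v \<beta>}) \<longleftrightarrow>
     \<beta> \<in> P \<and> k < N (s # v) \<beta>" for \<beta> k
  proof (cases "\<beta> = \<alpha> s")
    case True
    have ne: "sr s \<gamma> \<noteq> \<alpha> s" if "\<gamma> \<in> P" for \<gamma>
    proof
      assume "sr s \<gamma> = \<alpha> s"
      then have "\<gamma> = - \<alpha> s" by (metis root_reflection_involution sr_self)
      then show False using that P_neg[OF \<alpha>_P[OF s]] by simp
    qed
    have "(\<alpha> s, k) \<in> colored_act \<alpha> s ` {(\<beta>, k). \<beta> \<in> P \<and> k < N v \<beta>} \<longleftrightarrow> (\<exists>j<N v (\<alpha> s). k = Suc j)"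
    proof
      assume "(\<alpha> s, k) \<in> colored_act \<alpha> s ` {(\<beta>, k). \<beta> \<in> P \<and> k < N v \<beta>}"
      then obtain \<gamma> j where g: "\<gamma> \<in> P" "j < N v \<gamma>" "(\<alpha> s, k) = colored_act \<alpha> s (\<gamma>, j)" by auto
      then have "\<gamma> = \<alpha> s" using ne[OF g(1)] by (auto simp: colored_act_def split: if_splits)
      then show "\<exists>j<N v (\<alpha> s). k = Suc j" using g by (auto simp: colored_act_def)
    next
      assume "\<exists>j<N v (\<alpha> s). k = Suc j"
      then obtain j where "j < N v (\<alpha> s)" "k = Suc j" by blast
      then have "(\<alpha> s, k) = colored_act \<alpha> s (\<alpha> s, j)" by (simp add: colored_act_def)
      then show "(\<alpha> s, k) \<in> colored_act \<alpha> s ` {(\<beta>, k). \<beta> \<in> P \<and> k < N v \<beta>}"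
        using \<open>j < N v (\<alpha> s)\<close> \<alpha>_P[OF s] by blast
    qed
    then show ?thesis using True \<alpha>_P[OF s] by (cases k) (auto simp: \<tau>_def)
  next
    case False
    have "(\<beta>, k) \<in> colored_act \<alpha> s ` {(\<beta>, k). \<beta> \<in> P \<and> k < N v \<beta>} \<longleftrightarrow> \<beta> \<in> P \<and> k < N v (sr s \<beta>)"
    proof
      assume "(\<beta>, k) \<in> colored_act \<alpha> s ` {(\<beta>, k). \<beta> \<in> P \<and> k < N v \<beta>}"
      then obtain \<gamma> j where g: "\<gamma> \<in> P" "j < N v \<gamma>" "(\<beta>, k) = colored_act \<alpha> s (\<gamma>, j)" by auto
      have ne: "\<gamma> \<noteq> \<alpha> s" using g(3) False by (auto simp: colored_act_def)
      then have "\<beta> = sr s \<gamma>" "k = j" using g(3) by (auto simp: colored_act_def)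
      then show "\<beta> \<in> P \<and> k < N v (sr s \<beta>)" using g refl_P[OF s g(1) ne] by simp
    next
      assume b: "\<beta> \<in> P \<and> k < N v (sr s \<beta>)"
      have p: "sr s \<beta> \<in> P" using refl_P[OF s] b False by blast
      have "sr s \<beta> \<noteq> \<alpha> s"
      proof
        assume "sr s \<beta> = \<alpha> s"
        then have "\<beta> = - \<alpha> s" by (metis root_reflection_involution sr_self)
        then show False using b P_neg[OF \<alpha>_P[OF s]] by simp
      qed
      then have "(\<beta>, k) = colored_act \<alpha> s (sr s \<beta>, k)" by (simp add: colored_act_def)
      then show "(\<beta>, k) \<in> colored_act \<alpha> s ` {(\<beta>, k). \<beta> \<in> P \<and> k < N v \<beta>}" using p b by blast
    qed
    then show ?thesis using False by (simp add: \<tau>_def)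
  qed
  then show ?case unfolding colored_sequence_Cons using IH by auto
qed (simp add: colored_inversion_sequence_def)

subsection \<open>The quotient monoid\<close>

context
  fixes G :: "('a, 'b) monoid_scheme"
  assumes mG: "cox_mat G = m"
begin

abbreviation cl :: "'a list \<Rightarrow> 'a list set" where "cl u \<equiv> braid_congruence G S `` {u}"

lemma braid_congruence_iff: "(u, v) \<in> braid_congruence G S \<longleftrightarrow> u \<approx>\<^sub>b v \<and> set u \<subseteq> S \<and> set v \<subseteq> S"
proof -
  have "braid_relations G S = brel" unfolding braid_relations_def brel_def mG ..
  then show ?thesis unfolding braid_congruence_def word_congruence_def beq_def by (auto simp: in_lists_conv_set)
qed

lemma cl_mem: "set u \<subseteq> S \<Longrightarrow> v \<in> cl u \<longleftrightarrow> u \<approx>\<^sub>b v"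
  using beq_set[of u v] by (auto simp: braid_congruence_iff)

lemma cl_eq: assumes "set u \<subseteq> S" "set v \<subseteq> S" shows "cl u = cl v \<longleftrightarrow> u \<approx>\<^sub>b v"
proof
  assume "cl u = cl v"
  then have "v \<in> cl u" using cl_mem[OF assms(2), of v] by simp
  then show "u \<approx>\<^sub>b v" using cl_mem[OF assms(1)] by simp
next
  assume uv: "u \<approx>\<^sub>b v"
  have "z \<in> cl u \<longleftrightarrow> z \<in> cl v" for z
    unfolding cl_mem[OF assms(1)] cl_mem[OF assms(2)]
    using beq_trans[OF uv, of z] beq_trans[OF beq_sym[OF uv], of z] by (rule iffI[rotated])
  then show "cl u = cl v" by blast
qed

lemma artin_carrier: "A \<in> carrier (artin_monoid G S) \<longleftrightarrow> (\<exists>u. set u \<subseteq> S \<and> A = cl u)"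
  unfolding artin_monoid_def by (auto simp: quotient_def in_lists_conv_set subset_iff)

lemma artin_mult: assumes "set u \<subseteq> S" "set v \<subseteq> S"
  shows "cl u \<otimes>\<^bsub>artin_monoid G S\<^esub> cl v = cl (u @ v)"
proof -
  have uv: "set (u @ v) \<subseteq> S" using assms by simp
  have "z \<in> cl u \<otimes>\<^bsub>artin_monoid G S\<^esub> cl v \<longleftrightarrow> z \<in> cl (u @ v)" for z
  proof
    assume "z \<in> cl u \<otimes>\<^bsub>artin_monoid G S\<^esub> cl v"
    then obtain a b where ab: "a \<in> cl u" "b \<in> cl v" "(a @ b, z) \<in> braid_congruence G S"
      unfolding artin_monoid_def by auto
    have "u @ v \<approx>\<^sub>b a @ b" using ab cl_mem assms by (intro beq_append) auto
    then have "u @ v \<approx>\<^sub>b z" by (rule beq_trans) (use ab(3) braid_congruence_iff in blast)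
    then show "z \<in> cl (u @ v)" unfolding cl_mem[OF uv] .
  next
    assume z: "z \<in> cl (u @ v)"
    have "u \<in> cl u" "v \<in> cl v" using cl_mem assms by simp_all
    then show "z \<in> cl u \<otimes>\<^bsub>artin_monoid G S\<^esub> cl v" using z unfolding artin_monoid_def by auto
  qed
  then show ?thesis by blast
qed

lemma weak_order_carrier: "carrier (weak_order G S) = carrier (artin_monoid G S)"
  by (simp add: weak_order_def)

lemma weak_order_le: assumes "set u \<subseteq> S" "set v \<subseteq> S" shows "cl u \<sqsubseteq>\<^bsub>weak_order G S\<^esub> cl v \<longleftrightarrow> u \<preceq> v"
proof
  assume "cl u \<sqsubseteq>\<^bsub>weak_order G S\<^esub> cl v"
  then obtain A where A: "A \<in> carrier (artin_monoid G S)" "cl u \<otimes>\<^bsub>artin_monoid G S\<^esub> A = cl v"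
    unfolding weak_order_def by auto
  then obtain y where y: "set y \<subseteq> S" "A = cl y" using artin_carrier by blast
  have "cl (u @ y) = cl v" using A(2) unfolding y(2) artin_mult[OF assms(1) y(1)] .
  then have "u @ y \<approx>\<^sub>b v" using cl_eq[of "u @ y" v] assms y by simp
  then show "u \<preceq> v" unfolding pre_def by blast
next
  assume "u \<preceq> v"
  then obtain y where y: "u @ y \<approx>\<^sub>b v" unfolding pre_def by blast
  have yS: "set y \<subseteq> S" using beq_set[OF y] assms by auto
  have "cl u \<otimes>\<^bsub>artin_monoid G S\<^esub> cl y = cl v"
    unfolding artin_mult[OF assms(1) yS] using cl_eq[of "u @ y" v] assms y yS by simp
  moreover have "cl y \<in> carrier (artin_monoid G S)" using artin_carrier yS by blast
  ultimately show "cl u \<sqsubseteq>\<^bsub>weak_order G S\<^esub> cl v" unfolding weak_order_def by auto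
qed

lemma weak_order_meet: assumes S: "set w \<subseteq> S" "set u \<subseteq> S" and g: "g \<preceq> w" "g \<preceq> u" "\<forall>x. x \<preceq> w \<longrightarrow> x \<preceq> u \<longrightarrow> x \<preceq> g"
  shows "cl w \<sqinter>\<^bsub>weak_order G S\<^esub> cl u = cl g"
proof -
  let ?L = "weak_order G S"
  have gS: "set g \<subseteq> S" using pre_set[OF g(1)] S by blast
  have c: "cl z \<in> carrier ?L" if "set z \<subseteq> S" for z using that artin_carrier weak_order_carrier by blast
  have low: "cl x \<in> Lower ?L {cl w, cl u} \<longleftrightarrow> x \<preceq> w \<and> x \<preceq> u" if x: "set x \<subseteq> S" for x
    unfolding Lower_def using c[OF x] c[OF S(1)] c[OF S(2)] weak_order_le[OF x S(1)] weak_order_le[OF x S(2)] by auto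
  have lowc: "\<exists>x. set x \<subseteq> S \<and> X = cl x" if "X \<in> Lower ?L {cl w, cl u}" for X
    using IntD2[OF that[unfolded Lower_def]] unfolding weak_order_carrier artin_carrier .
  have gr: "greatest ?L (cl g) (Lower ?L {cl w, cl u})"
    unfolding greatest_def
  proof (intro conjI ballI)
    show "Lower ?L {cl w, cl u} \<subseteq> carrier ?L" unfolding Lower_def by blast
    show "cl g \<in> Lower ?L {cl w, cl u}" using low[OF gS] g(1,2) by simp
    fix X assume X: "X \<in> Lower ?L {cl w, cl u}"
    then obtain x where x: "set x \<subseteq> S" "X = cl x"
      using lowc by blast
    then have "x \<preceq> w \<and> x \<preceq> u" using X low[OF x(1)] by simp
    then have "x \<preceq> g" using g(3) by simp
    then show "X \<sqsubseteq>\<^bsub>?L\<^esub> cl g" unfolding x(2) weak_order_le[OF x(1) gS] .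
  qed
  \<comment> \<open>The meet is a \<open>SOME\<close> choice, so uniqueness is needed: mutual
    prefixes have equal length and coincide.\<close>
  have "Y = cl g" if Y: "greatest ?L Y (Lower ?L {cl w, cl u})" for Y
  proof -
    have YL: "Y \<in> Lower ?L {cl w, cl u}" using Y unfolding greatest_def by blast
    then obtain y where y: "set y \<subseteq> S" "Y = cl y"
      using lowc by blast
    have "y \<preceq> w \<and> y \<preceq> u" using YL y(2) low[OF y(1)] by simp
    then have yg: "y \<preceq> g" using g(3) by simp
    have gL: "cl g \<in> Lower ?L {cl w, cl u}" using low[OF gS] g(1,2) by simp
    have "\<forall>x\<in>Lower ?L {cl w, cl u}. x \<sqsubseteq>\<^bsub>?L\<^esub> Y" using Y unfolding greatest_def by (elim conjE)
    from bspec[OF this gL] have "cl g \<sqsubseteq>\<^bsub>?L\<^esub> cl y" unfolding y(2) .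
    then have "g \<preceq> y" unfolding weak_order_le[OF gS y(1)] .
    then have "y \<approx>\<^sub>b g" by (rule pre_length_eq[OF yg pre_length])
    then show ?thesis unfolding y(2) cl_eq[OF y(1) gS] .
  qed
  with gr show ?thesis unfolding meet_def inf_def by (rule some_equality)
qed

lemma colored_inv_cl: assumes "set u \<subseteq> S" shows "colored_inv \<alpha> (cl u) = {(\<beta>, k). \<beta> \<in> P \<and> k < N u \<beta>}"
proof -
  let ?z = "SOME ws. ws \<in> cl u"
  have "u \<in> cl u" using cl_mem[OF assms] by simp
  then have "?z \<in> cl u" by (rule someI)
  then have uz: "u \<approx>\<^sub>b ?z" unfolding cl_mem[OF assms] .
  have zS: "set ?z \<subseteq> S" using beq_set[OF uz] assms by simp
  show ?thesis unfolding colored_inv_def colored_sequence_set[OF zS] using beq_N[OF uz assms] by auto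
qed

lemma c_sortable_Srt:
  assumes cs: "distinct cs" "set cs = S" and W: "W \<in> carrier (artin_monoid G S)" "c_sortable cs W"
  obtains v where "set v \<subseteq> S" "W = cl v" "Srt S (cox_form cs) v"
proof (cases "cs = []")
  case True
  then have S0: "S = {}" using cs by simp
  obtain u where u: "set u \<subseteq> S" "W = cl u" using W artin_carrier by blast
  have "Srt S (cox_form cs) []" by (rule Srt.nil) (simp add: Cox_def S0)
  moreover have "u = []" using u S0 by simp
  ultimately show ?thesis using that u by blast
next
  case False
  obtain u where u: "set u \<subseteq> S" "W = cl u" using W artin_carrier by blast
  let ?n = "length cs" and ?A = "subword_positions cs W"
  let ?f = "\<lambda>i. cs ! (i mod ?n)"
  have len: "length is = length u" if "is \<in> ?A" for "is"
  proof -
    have "map ?f is \<in> cl u" using that u(2) unfolding subword_positions_def by simp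
    then have "u \<approx>\<^sub>b map ?f is" unfolding cl_mem[OF u(1)] .
    then show ?thesis using beq_length by fastforce
  qed
  have "\<exists>is. sorted_wrt (<) is \<and> (\<forall>i\<in>set is. 0 * ?n \<le> i) \<and> map ?f is = u"
    by (rule subword_positions_exist[OF False]) (use u cs in simp)
  then obtain "is" where "sorted_wrt (<) is" "map ?f is = u" by blast
  moreover have "u \<in> cl u" using cl_mem[OF u(1)] by simp
  ultimately have "is \<in> ?A" unfolding subword_positions_def u(2) by simp
  then have "?A \<noteq> {}" by blast
  from theI'[OF lex_least_exists[OF this len]]
  have pA: "sorting_positions cs W \<in> ?A" unfolding sorting_positions_def by blast
  let ?p = "sorting_positions cs W"
  let ?v = "map ?f ?p"
  have p: "sorted_wrt (<) ?p" "?v \<in> W" using pA unfolding subword_positions_def by auto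
  have uv: "u \<approx>\<^sub>b ?v" using p(2) unfolding u(2) cl_mem[OF u(1)] .
  have vS: "set ?v \<subseteq> S" using beq_set[OF uv] u(1) by blast
  \<comment> \<open>The decrease of the blocks, read as closure of the positions under subtracting
    \<open>length cs\<close>.\<close>
  have closed: "i \<in> set ?p" if i: "i + ?n \<in> set ?p" for i
  proof -
    have n: "?n > 0" using False by simp
    let ?k = "i div ?n" and ?r = "i mod ?n"
    have e: "?k * ?n + ?r = i" by simp
    have "Suc ?k * ?n + ?r = i + ?n" using e by (simp del: div_mult_mod_eq mod_div_mult_eq)
    then have "?r \<in> sorting_block cs W (Suc ?k)" using i n unfolding sorting_block_def by simp
    then have "?r \<in> sorting_block cs W ?k" using W(2) unfolding c_sortable_def by blast
    then show ?thesis unfolding sorting_block_def using e by simp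
  qed
  have "Srt S (cox_form cs) ?v"
    by (rule Srt_of_sortable_positions[OF cs p(1) closed vS])
  moreover have "W = cl ?v" using u(2) cl_eq[OF u(1) vS] uv by simp
  ultimately show ?thesis using that vS by blast
qed

theorem weak_order_sortable:
  assumes cs: "distinct cs" "set cs = S"
    and W: "W \<in> carrier (artin_monoid G S)" "c_sortable cs W"
    and U: "U \<in> carrier (artin_monoid G S)" "c_sortable cs U"
  shows "(W \<sqsubseteq>\<^bsub>weak_order G S\<^esub> U \<longleftrightarrow> colored_inv \<alpha> W \<subseteq> colored_inv \<alpha> U) \<and>
    colored_inv \<alpha> (W \<sqinter>\<^bsub>weak_order G S\<^esub> U) = colored_inv \<alpha> W \<inter> colored_inv \<alpha> U"
proof -
  obtain w where w: "set w \<subseteq> S" "W = cl w" "Srt S (cox_form cs) w" using c_sortable_Srt[OF cs W] .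
  obtain u where u: "set u \<subseteq> S" "U = cl u" "Srt S (cox_form cs) u" using c_sortable_Srt[OF cs U] .
  have fE: "form (cox_form cs)" by (rule form_cox_form[OF cs])
  note inv = colored_inv_cl[OF w(1)] colored_inv_cl[OF u(1)]
  have "colored_inv \<alpha> W \<subseteq> colored_inv \<alpha> U \<longleftrightarrow> (\<forall>\<beta>\<in>P. N w \<beta> \<le> N u \<beta>)"
  proof
    assume sub: "colored_inv \<alpha> W \<subseteq> colored_inv \<alpha> U"
    show "\<forall>\<beta>\<in>P. N w \<beta> \<le> N u \<beta>"
    proof (rule ballI, rule ccontr)
      fix \<beta> assume b: "\<beta> \<in> P" "\<not> N w \<beta> \<le> N u \<beta>"
      then have "(\<beta>, N u \<beta>) \<in> colored_inv \<alpha> W" unfolding w(2) inv by simp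
      then have "(\<beta>, N u \<beta>) \<in> colored_inv \<alpha> U" using sub by blast
      then show False unfolding u(2) inv by simp
    qed
  next
    assume "\<forall>\<beta>\<in>P. N w \<beta> \<le> N u \<beta>"
    then show "colored_inv \<alpha> W \<subseteq> colored_inv \<alpha> U" unfolding w(2) u(2) inv using less_le_trans by fastforce
  qed
  then have 1: "W \<sqsubseteq>\<^bsub>weak_order G S\<^esub> U \<longleftrightarrow> colored_inv \<alpha> W \<subseteq> colored_inv \<alpha> U"
    using sortable_prefix_iff[OF fE w(3) u(3)] weak_order_le[OF w(1) u(1)] w(2) u(2) by simp
  obtain g where g: "g \<preceq> w" "g \<preceq> u" "\<forall>x. x \<preceq> w \<longrightarrow> x \<preceq> u \<longrightarrow> x \<preceq> g"
    "\<forall>\<beta>\<in>P. N g \<beta> = min (N w \<beta>) (N u \<beta>)"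
    using sortable_meet[OF fE w(3) u(3)] .
  have gS: "set g \<subseteq> S" using pre_set[OF g(1)] w(1) by blast
  have "W \<sqinter>\<^bsub>weak_order G S\<^esub> U = cl g" unfolding w(2) u(2) by (rule weak_order_meet[OF w(1) u(1) g(1-3)])
  then have "colored_inv \<alpha> (W \<sqinter>\<^bsub>weak_order G S\<^esub> U) = colored_inv \<alpha> W \<inter> colored_inv \<alpha> U"
    unfolding w(2) u(2) inv using colored_inv_cl[OF gS] g(4) by auto
  with 1 show ?thesis ..
qed

end

text \<open>The \<open>s\<close>-coefficient of a vector is only changed by the letter \<open>s\<close>.\<close>

lemma letters_of_coxeter_word: assumes "distinct ws" "set ws = S" "set cs \<subseteq> S" "act cs = act ws"
  shows "set cs = S"
proof (rule ccontr)
  assume "set cs \<noteq> S"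
  then obtain s where s: "s \<in> S" "s \<notin> set cs" using assms(3) by blast
  obtain p q where pq: "ws = p @ s # q" using s assms(2) by (metis split_list)
  have K: "set p \<subseteq> S - {s}" "set q \<subseteq> S - {s}" "set (rev q) \<subseteq> S - {s}" "set cs \<subseteq> S - {s}"
    using assms(1-3) pq s by auto
  have KS: "S - {s} \<subseteq> S" and sn: "s \<in> S - (S - {s})" using s by auto
  let ?x = "act (rev q) (\<alpha> s)"
  have x: "co s ?x = 1" using act_co[OF K(3) KS sn] s by (simp add: co_\<alpha>)
  have "co s (act cs ?x) = 1" using act_co[OF K(4) KS sn] x by simp
  moreover have "act ws ?x = act p (- \<alpha> s)" unfolding pq by (simp add: act_append sr_self)
  then have "co s (act ws ?x) = - 1" using act_co[OF K(1) KS sn] s by (simp add: co_neg co_\<alpha>)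
  ultimately show False using assms(4) by simp
qed

end

subsection \<open>Coxeter systems and their root systems\<close>

lemma alternating_word_even_snoc: "alternating_word s t (Suc (k + k)) = alternating_word s t (k + k) @ [s]"
  by (induction k) auto

text \<open>For involutions reversal is inversion, so the two alternating words of length
  \<open>k\<close> have equal products iff the \<open>k\<close>-th power of \<open>s t\<close> is
  the identity.\<close>

lemma alternating_word_append_rev:
  "alternating_word s t k @ rev (alternating_word t s k) = alternating_word s t (k + k)"
proof (induction k arbitrary: s t)
  case (Suc k)
  have "alternating_word s t (Suc k) @ rev (alternating_word t s (Suc k))
      = s # (alternating_word t s k @ rev (alternating_word s t k)) @ [t]" by simp
  also have "\<dots> = s # alternating_word t s (Suc (k + k))"
    unfolding Suc alternating_word_even_snoc by simp
  finally show ?case by simp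
qed simp

context group
begin

lemma word_prod_simps: "word_prod G [] = \<one>" "word_prod G (s # w) = s \<otimes> word_prod G w"
  by (simp_all add: word_prod_def)

lemma word_prod_closed: "set w \<subseteq> carrier G \<Longrightarrow> word_prod G w \<in> carrier G"
  by (induction w) (auto simp: word_prod_simps)

lemma word_prod_append: "set u \<subseteq> carrier G \<Longrightarrow> set v \<subseteq> carrier G \<Longrightarrow>
    word_prod G (u @ v) = word_prod G u \<otimes> word_prod G v"
  by (induction u) (auto simp: word_prod_simps word_prod_closed m_assoc)

lemma word_prod_rev: assumes "\<And>s. s \<in> set w \<Longrightarrow> s \<otimes> s = \<one>" "set w \<subseteq> carrier G"
  shows "word_prod G (rev w) = inv (word_prod G w)"
  using assms
proof (induction w)
  case (Cons s w)
  have s: "s \<in> carrier G" "inv s = s" using Cons.prems inv_equality[of s s] by auto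
  have w: "set w \<subseteq> carrier G" using Cons.prems by simp
  have "word_prod G (rev (s # w)) = inv (word_prod G w) \<otimes> s"
    using Cons w s by (simp add: word_prod_append word_prod_simps)
  then show ?case using inv_mult_group[OF s(1) word_prod_closed[OF w]] s by (simp add: word_prod_simps)
qed (simp add: word_prod_simps)

lemma word_prod_alternating: assumes "s \<in> carrier G" "t \<in> carrier G"
  shows "word_prod G (alternating_word s t (k + k)) = (s \<otimes> t) [^] k"
proof (induction k)
  case (Suc k)
  have e: "alternating_word s t (Suc k + Suc k) = s # t # alternating_word s t (k + k)" by simp
  have "word_prod G (alternating_word s t (Suc k + Suc k)) = s \<otimes> (t \<otimes> (s \<otimes> t) [^] k)"
    unfolding e word_prod_simps Suc ..
  also have "\<dots> = (s \<otimes> t) [^] Suc k"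
    using nat_pow_Suc2[of "s \<otimes> t" k] assms by (simp add: m_assoc)
  finally show ?case .
qed (simp add: word_prod_simps)

lemma word_prod_alternating_eq_iff:
  assumes "s \<in> carrier G" "t \<in> carrier G" "s \<otimes> s = \<one>" "t \<otimes> t = \<one>"
  shows "word_prod G (alternating_word s t k) = word_prod G (alternating_word t s k) \<longleftrightarrow> ord (s \<otimes> t) dvd k"
proof -
  have sub: "set (alternating_word a b k) \<subseteq> {a, b}" for a b :: 'a
    by (induction a b k rule: alternating_word.induct) auto
  let ?a = "alternating_word s t k" and ?b = "alternating_word t s k"
  have c: "set ?a \<subseteq> carrier G" "set ?b \<subseteq> carrier G" using sub[of s t] sub[of t s] assms by auto
  have cl: "word_prod G ?a \<in> carrier G" "word_prod G ?b \<in> carrier G" using c word_prod_closed by auto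
  have "(s \<otimes> t) [^] k = word_prod G (?a @ rev ?b)"
    unfolding alternating_word_append_rev word_prod_alternating[OF assms(1,2)] ..
  also have "\<dots> = word_prod G ?a \<otimes> word_prod G (rev ?b)" using c by (intro word_prod_append) auto
  also have "word_prod G (rev ?b) = inv (word_prod G ?b)"
    by (rule word_prod_rev) (use sub[of t s] assms c in auto)
  finally have "(s \<otimes> t) [^] k = word_prod G ?a \<otimes> inv (word_prod G ?b)" .
  moreover have "word_prod G ?a \<otimes> inv (word_prod G ?b) = \<one> \<longleftrightarrow> word_prod G ?a = word_prod G ?b"
    using cl by (metis inv_closed inv_equality inv_inv r_inv)
  ultimately show ?thesis using pow_eq_id[of "s \<otimes> t" k] assms by simp
qed

end

lemma faithful_word_action:
  assumes "group G" "faithful_action G (UNIV :: 'v::euclidean_space set) \<rho>" "S \<subseteq> carrier G"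
    "\<forall>s\<in>S. \<rho> s = root_reflection (\<alpha> s)"
  shows "set w \<subseteq> S \<Longrightarrow> \<rho> (word_prod G w) = root_act \<alpha> w"
    and "set u \<subseteq> S \<Longrightarrow> set v \<subseteq> S \<Longrightarrow> root_act \<alpha> u = root_act \<alpha> v \<longleftrightarrow> word_prod G u = word_prod G v"
proof -
  interpret group G by fact
  interpret A: faithful_action G UNIV \<rho> by fact
  interpret H: group_hom G "BijGroup (UNIV :: 'v set)" \<rho> by (rule A.group_hom)
  have one: "\<rho> \<one>\<^bsub>G\<^esub> = (\<lambda>x. x)" using H.hom_one by (simp add: BijGroup_def restrict_def)
  have mult: "\<rho> (x \<otimes>\<^bsub>G\<^esub> y) = (\<lambda>z. \<rho> x (\<rho> y z))" if "x \<in> carrier G" "y \<in> carrier G" for x y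
  proof -
    have "\<rho> x \<in> Bij UNIV" "\<rho> y \<in> Bij UNIV" using H.hom_closed that by (simp_all add: BijGroup_def)
    then show ?thesis using H.hom_mult[OF that] by (simp add: BijGroup_def compose_def restrict_def)
  qed
  have act: "\<rho> (word_prod G w) = root_act \<alpha> w" if "set w \<subseteq> S" for w
    using that
  proof (induction w)
    case Nil
    then show ?case using one by (auto simp: word_prod_simps)
  next
    case (Cons s w)
    then have "s \<in> carrier G" "word_prod G w \<in> carrier G" using assms(3) word_prod_closed[of w] by auto
    from mult[OF this] have "\<rho> (word_prod G (s # w)) = (\<lambda>z. \<rho> s (\<rho> (word_prod G w) z))"
      unfolding word_prod_simps .
    moreover have "\<rho> (word_prod G w) = root_act \<alpha> w" "\<rho> s = root_reflection (\<alpha> s)" using Cons assms(4) by auto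
    ultimately show ?case by (simp add: fun_eq_iff)
  qed
  then show "set w \<subseteq> S \<Longrightarrow> \<rho> (word_prod G w) = root_act \<alpha> w" .
  assume uv: "set u \<subseteq> S" "set v \<subseteq> S"
  have "word_prod G u \<in> carrier G" "word_prod G v \<in> carrier G"
    using uv assms(3) word_prod_closed by (meson subset_trans)+
  then show "root_act \<alpha> u = root_act \<alpha> v \<longleftrightarrow> word_prod G u = word_prod G v"
    using A.faithful act[OF uv(1)] act[OF uv(2)] unfolding inj_on_def by metis
qed

lemma positive_roots_datum_of_root_system:
  fixes \<Phi> :: "'v::euclidean_space set"
  assumes cox: "coxeter_system G S" and fin: "finite (carrier G)" and rs: "root_system_for G S \<Phi> \<alpha>"
  obtains co where "positive_roots_datum S \<alpha> (positive_roots S \<Phi> \<alpha>) co (cox_mat G)"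
proof -
  interpret group G using cox by (simp add: coxeter_system_def)
  have SG: "S \<subseteq> carrier G" and ord2: "\<And>s. s \<in> S \<Longrightarrow> group.ord G s = 2" using cox by (auto simp: coxeter_system_def)
  have fS: "finite S" using SG fin finite_subset by blast
  let ?P = "positive_roots S \<Phi> \<alpha>"
  have R: "finite \<Phi>" "0 \<notin> \<Phi>" "\<forall>\<beta>\<in>\<Phi>. root_reflection \<beta> ` \<Phi> = \<Phi>"
    "\<forall>\<beta>\<in>\<Phi>. \<Phi> \<inter> span {\<beta>} = {\<beta>, - \<beta>}" "inj_on \<alpha> S" "\<alpha> ` S \<subseteq> \<Phi>" "independent (\<alpha> ` S)"
    "\<Phi> = ?P \<union> uminus ` ?P" and "\<exists>\<rho>. faithful_action G (UNIV :: 'v set) \<rho> \<and> (\<forall>s\<in>S. \<rho> s = root_reflection (\<alpha> s))"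
    using rs unfolding root_system_for_def by - (elim conjE, assumption)+
  then obtain \<rho> where \<rho>: "faithful_action G (UNIV :: 'v set) \<rho>" "\<forall>s\<in>S. \<rho> s = root_reflection (\<alpha> s)"
    by (elim exE conjE)
  \<comment> \<open>Dual functionals to the simple roots, extended to the whole space since the
    roots need not span it.\<close>
  have "\<forall>r. \<exists>g. linear g \<and> (\<forall>x\<in>\<alpha> ` S. g x = (if x = \<alpha> r then 1 else (0::real)))"
  proof
    fix r
    show "\<exists>g. linear g \<and> (\<forall>x\<in>\<alpha> ` S. g x = (if x = \<alpha> r then 1 else (0::real)))"
      by (rule linear_independent_extend[OF R(7), of "\<lambda>x. if x = \<alpha> r then 1 else 0"])
  qed
  from choice[OF this] obtain co
    where "\<forall>r. linear (co r) \<and> (\<forall>x\<in>\<alpha> ` S. co r x = (if x = \<alpha> r then 1 else (0::real)))" ..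
  then have co: "\<And>r. linear (co r)" "\<And>r x. x \<in> \<alpha> ` S \<Longrightarrow> co r x = (if x = \<alpha> r then 1 else (0::real))"
    by blast+
  have coa: "co r (\<alpha> s) = (if r = s then 1 else 0)" if "r \<in> S" "s \<in> S" for r s
    using co(2)[of "\<alpha> s" r] that R(5) by (auto simp: inj_on_def)
  have cosum: "co r (\<Sum>s\<in>S. a s *\<^sub>R \<alpha> s) = a r" if "r \<in> S" for r a
  proof -
    have "co r (\<Sum>s\<in>S. a s *\<^sub>R \<alpha> s) = (\<Sum>s\<in>S. a s * co r (\<alpha> s))"
      using co(1)[of r] by (simp add: linear_sum linear_scale)
    also have "\<dots> = (\<Sum>s\<in>S. if s = r then a r else 0)" using that coa by (intro sum.cong) auto
    finally show ?thesis using fS that by simp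
  qed
  have Pexp: "\<beta> = (\<Sum>r\<in>S. co r \<beta> *\<^sub>R \<alpha> r) \<and> (\<forall>r\<in>S. 0 \<le> co r \<beta>)" if "\<beta> \<in> ?P" for \<beta>
  proof -
    obtain a where a: "\<forall>s\<in>S. 0 \<le> a s" "\<beta> = (\<Sum>s\<in>S. a s *\<^sub>R \<alpha> s)"
      using \<open>\<beta> \<in> ?P\<close> unfolding positive_roots_def by blast
    have "co r \<beta> = a r" if "r \<in> S" for r using cosum[OF that] a(2) by simp
    then show ?thesis using a by simp
  qed
  have aP: "\<alpha> s \<in> ?P" if s: "s \<in> S" for s
  proof -
    have "\<alpha> s = (\<Sum>r\<in>S. (if r = s then 1 else 0) *\<^sub>R \<alpha> r)"
      using fS s by (simp add: if_distrib[of "\<lambda>c. c *\<^sub>R _"] cong: if_cong)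
    then show ?thesis using R(6) s unfolding positive_roots_def
      by (intro CollectI conjI exI[of _ "\<lambda>r. if r = s then 1 else 0"]) auto
  qed
  have refl: "root_reflection (\<alpha> s) \<beta> \<in> ?P" if s: "s \<in> S" and b: "\<beta> \<in> ?P" "\<beta> \<noteq> \<alpha> s" for s \<beta>
  proof (rule ccontr)
    let ?g = "root_reflection (\<alpha> s) \<beta>"
    assume n: "?g \<notin> ?P"
    have aF: "\<alpha> s \<in> \<Phi>" using R(6) s by blast
    have bF: "\<beta> \<in> \<Phi>" using b unfolding positive_roots_def by blast
    then have "?g \<in> \<Phi>" using R(3) aF by blast
    then have m: "- ?g \<in> ?P" using n R(8) by (metis UnE imageE minus_minus)
    \<comment> \<open>The reflection alters the coefficient at \<open>s\<close> alone, so a negative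
      image leaves \<open>\<beta>\<close> proportional to \<open>\<alpha> s\<close>.\<close>
    have "co r \<beta> = 0" if r: "r \<in> S" "r \<noteq> s" for r
    proof -
      have "co r (- ?g) = - co r \<beta>"
        unfolding root_reflection_def using co(1)[of r] coa[OF r(1) s] r(2)
        by (simp add: linear_neg linear_diff linear_scale)
      then show ?thesis using Pexp[OF m] Pexp[OF b(1)] r by force
    qed
    then have z: "(\<Sum>r\<in>S. co r \<beta> *\<^sub>R \<alpha> r) = (\<Sum>r\<in>S. if r = s then co s \<beta> *\<^sub>R \<alpha> s else 0)"
      by (intro sum.cong) auto
    have bs: "\<beta> = co s \<beta> *\<^sub>R \<alpha> s" using Pexp[OF b(1)] z fS s by simp
    then have "\<beta> \<in> span {\<alpha> s}" by (metis span_base span_scale singletonI)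
    then have "\<beta> \<in> {\<alpha> s, - \<alpha> s}" using bF R(4) aF by blast
    then have "\<beta> = - \<alpha> s" using b(2) by blast
    then have "co s \<beta> = - 1" using co(1)[of s] coa[OF s s] by (simp add: linear_neg)
    then show False using Pexp[OF b(1)] s by force
  qed
  have sq: "s \<otimes>\<^bsub>G\<^esub> s = \<one>\<^bsub>G\<^esub>" if s: "s \<in> S" for s
  proof -
    have "s [^]\<^bsub>G\<^esub> (2::nat) = \<one>\<^bsub>G\<^esub>" using pow_ord_eq_1[of s] ord2[OF s] s SG by auto
    then show ?thesis using s SG by (simp add: numeral_2_eq_2 subset_iff)
  qed
  have dvd: "root_act \<alpha> (alternating_word s t k) = root_act \<alpha> (alternating_word t s k) \<longleftrightarrow> cox_mat G s t dvd k"
    if st: "s \<in> S" "t \<in> S" for s t k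
  proof -
    have sub: "set (alternating_word a b k) \<subseteq> {a, b}" for a b :: 'a
      by (induction a b k rule: alternating_word.induct) auto
    have "set (alternating_word s t k) \<subseteq> S" "set (alternating_word t s k) \<subseteq> S"
      using sub[of s t] sub[of t s] st by auto
    from faithful_word_action(2)[OF is_group \<rho>(1) SG \<rho>(2) this]
    show ?thesis unfolding cox_mat_def
      using word_prod_alternating_eq_iff[of s t k] st SG sq by auto
  qed
  have sym: "cox_mat G s t = cox_mat G t s" if st: "s \<in> S" "t \<in> S" for s t
  proof -
    have c: "s \<in> carrier G" "t \<in> carrier G" using st SG by auto
    have "inv\<^bsub>G\<^esub> s = s" "inv\<^bsub>G\<^esub> t = t" using inv_equality[of s s] inv_equality[of t t] c sq st by auto
    then have "inv\<^bsub>G\<^esub> (s \<otimes>\<^bsub>G\<^esub> t) = t \<otimes>\<^bsub>G\<^esub> s" using inv_mult_group[OF c] by simp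
    then show ?thesis unfolding cox_mat_def using ord_inv[of "s \<otimes>\<^bsub>G\<^esub> t"] c by simp
  qed
  have ge2: "2 \<le> cox_mat G s t" if st: "s \<in> S" "t \<in> S" "s \<noteq> t" for s t
  proof -
    have c: "s \<in> carrier G" "t \<in> carrier G" "s \<otimes>\<^bsub>G\<^esub> t \<in> carrier G" using st SG by auto
    have "group.ord G (s \<otimes>\<^bsub>G\<^esub> t) \<noteq> 1"
    proof
      assume "group.ord G (s \<otimes>\<^bsub>G\<^esub> t) = 1"
      then have "s \<otimes>\<^bsub>G\<^esub> t = \<one>\<^bsub>G\<^esub>" using ord_eq_1[OF c(3)] by simp
      then have "inv\<^bsub>G\<^esub> t = s" using inv_equality[of s t] c by simp
      moreover have "inv\<^bsub>G\<^esub> t = t" using inv_equality[of t t] c sq st by simp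
      ultimately show False using st by simp
    qed
    \<comment> \<open>Finiteness rules out the value 0 that stands for infinite order.\<close>
    moreover have "group.ord G (s \<otimes>\<^bsub>G\<^esub> t) \<ge> 1" by (rule ord_ge_1[OF fin c(3)])
    ultimately show ?thesis unfolding cox_mat_def by linarith
  qed
  have "positive_roots_datum S \<alpha> ?P co (cox_mat G)"
  proof (rule positive_roots_datum.intro)
    show "finite S" by (rule fS)
    show "finite ?P" by (rule finite_subset[OF _ R(1)]) (auto simp: positive_roots_def)
    show "0 \<notin> ?P" using R(2) by (auto simp: positive_roots_def)
    fix r s
    show "linear (co r)" by (rule co(1))
    show "co r (\<alpha> s) = (if r = s then 1 else 0)" if "r \<in> S" "s \<in> S" using coa[OF that] .
    show "\<beta> = (\<Sum>r\<in>S. co r \<beta> *\<^sub>R \<alpha> r)" if "\<beta> \<in> ?P" for \<beta> using Pexp[OF that] by (rule conjunct1)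
    show "0 \<le> co r \<beta>" if "\<beta> \<in> ?P" "r \<in> S" for \<beta> using Pexp[OF that(1)] that(2) by (elim conjE bspec)
    show "\<alpha> s \<in> ?P" if "s \<in> S" using aP[OF that] .
    show "root_reflection (\<alpha> s) \<beta> \<in> ?P" if "s \<in> S" "\<beta> \<in> ?P" "\<beta> \<noteq> \<alpha> s" for \<beta> using refl[OF that] .
    fix t k
    show "cox_mat G s t = cox_mat G t s" if "s \<in> S" "t \<in> S" using sym[OF that] .
    show "2 \<le> cox_mat G s t" if "s \<in> S" "t \<in> S" "s \<noteq> t" using ge2[OF that] .
    show "root_act \<alpha> (alternating_word s t k) = root_act \<alpha> (alternating_word t s k) \<longleftrightarrow> cox_mat G s t dvd k"
      if "s \<in> S" "t \<in> S" using dvd[OF that] .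
  qed
  then show ?thesis by (rule that)
qed

theorem mainTheorem7:
  fixes G :: "('a, 'b) monoid_scheme" and S :: "'a set"
    and \<Phi> :: "'v::euclidean_space set" and \<alpha> :: "'a \<Rightarrow> 'v"
    and c :: 'a and cs :: "'a list" and m :: nat and w u :: "'a list set"
  assumes "coxeter_system G S" and "finite (carrier G)"
    and "root_system_for G S \<Phi> \<alpha>"
    and "coxeter_element G S c" and "reduced_word G S c cs"
    and "w \<in> Sort_fuss G S m cs" and "u \<in> Sort_fuss G S m cs"
  shows "(w \<sqsubseteq>\<^bsub>weak_order G S\<^esub> u \<longleftrightarrow> colored_inv \<alpha> w \<subseteq> colored_inv \<alpha> u) \<and>
    colored_inv \<alpha> (w \<sqinter>\<^bsub>weak_order G S\<^esub> u) = colored_inv \<alpha> w \<inter> colored_inv \<alpha> u"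
proof -
  obtain co where "positive_roots_datum S \<alpha> (positive_roots S \<Phi> \<alpha>) co (cox_mat G)"
    using positive_roots_datum_of_root_system[OF assms(1-3)] .
  then interpret positive_roots_datum S \<alpha> "positive_roots S \<Phi> \<alpha>" co "cox_mat G" .
  have gr: "group G" and SG: "S \<subseteq> carrier G" using assms(1) by (auto simp: coxeter_system_def)
  have "\<exists>\<rho>. faithful_action G (UNIV :: 'v set) \<rho> \<and> (\<forall>s\<in>S. \<rho> s = root_reflection (\<alpha> s))"
    using assms(3) unfolding root_system_for_def by (elim conjE)
  then obtain \<rho> where \<rho>: "faithful_action G (UNIV :: 'v set) \<rho>" "\<forall>s\<in>S. \<rho> s = root_reflection (\<alpha> s)"
    by (elim exE conjE)
  obtain ws where ws: "distinct ws" "set ws = S" "word_prod G ws = c"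
    using assms(4) unfolding coxeter_element_def by blast
  have csr: "set cs \<subseteq> S" "word_prod G cs = c" "length cs = cox_length G S c"
    using assms(5) unfolding reduced_word_def by auto
  have "act cs = act ws"
    using faithful_word_action(2)[OF gr \<rho>(1) SG \<rho>(2) csr(1), of ws] ws csr by simp
  then have css: "set cs = S" by (rule letters_of_coxeter_word[OF ws(1,2) csr(1)])
  \<comment> \<open>\<open>ws\<close> bounds the length of \<open>c\<close> by the number of simple
    reflections; as \<open>cs\<close> contains all of them, none repeats.\<close>
  have "cox_length G S c \<le> length ws"
    unfolding cox_length_def by (rule Least_le) (use ws in \<open>auto intro!: bexI[of _ ws]\<close>)
  also have "\<dots> = card (set cs)" unfolding css ws(2)[symmetric] by (rule distinct_card[OF ws(1), symmetric])
  finally have "card (set cs) = length cs" using csr(3) card_length[of cs] by simp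
  then have dcs: "distinct cs" by (rule card_distinct)
  show ?thesis
    by (rule weak_order_sortable[OF refl dcs css]) (use assms(6,7) in \<open>auto simp: Sort_fuss_def W_fuss_def\<close>)
qed

end
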